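(* Suppose Assumptions 1, 2, 3 hold with $\kappa>3$, and that $G_2=G_\mu''(x^* )=0$. Let $0<\epsilon<\min\left(\frac{\kappa-3}{8(\kappa+1)},\frac1{24}\right)$. Then as $n\to\infty$, \[\frac{1}{c_3n^{3/4}}\tilde K_{n,t_n^{\rm P}(\tau_1),t_n^{\rm P}(\tau_2)}\left(x_n^{\rm P}(\tau_1)+\frac{u}{c_3n^{3/4}},\,x_n^{\rm P}(\tau_2)+\frac{v}{c_3n^{3/4}}\right)=\mathbb K^{\rm P}_{\tau_1,\tau_2}(u,v)+\mathcal O(n^{-\epsilon}),\] uniformly for $\tau_1,\tau_2$ in compact subsets of $\mathbb R$ and $u,v\in[-M,M]$ for any fixed $M>0$.
   Context: NIBM: $X(t)=(X_1(t)\le\dots\le X_n(t))$ solves $dX_j=n^{-1/2}dB_j+\frac1n\sum_{k\ne j}\frac{dt}{X_j-X_k}$ with independent Brownian motions and deterministic initial points; $\mu_n=\frac1n\sum_j\delta_{X_j(0)}$ with distribution function $F_n$. Assumption 1: supports of $\mu_n$ in a fixed bounded set, $\mu_n\to\mu$ weakly, $\mu$ has density $\psi$ continuous on its support, and $\psi(x)\sim c|x-x^*|^\kappa$ as $x\to x^*$ for some $x^*$, $c>0$, $\kappa$. Assumption 2: $|F_n(x)-F(x)|\le M_0/n$ for all $x$, $n\ge n_0$ ($F$ distribution function of $\mu$). Assumption 3: for some $m_0>0$ and $n\ge n_0$, $[x^*-m_0n^{-1/(\kappa+1)},x^*+m_0n^{-1/(\kappa+1)}]$ does not meet the support of $\mu_n$.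 Notation: $G_\mu(z)=\int\frac{\mu(ds)}{z-s}$, $G_j=G_\mu^{(j)}(x^* )=(-1)^jj!\int\frac{\mu(ds)}{(x^*-s)^{j+1}}$ (so $G_3<0$), $t_{\rm cr}=\left(\int\frac{\mu(ds)}{(x^*-s)^2}\right)^{-1}$, $c_3:=\frac1{t_{\rm cr}}\left(\frac{6}{-G_3}\right)^{1/4}$, $t_n^{\rm P}(\tau):=t_{\rm cr}+\frac{\tau}{c_3^2n^{1/2}}$, $x_n^{\rm P}(\tau):=x^*+t_n^{\rm P}(\tau)G_0$. Kernel: $K_{n,s,t}(x,y)=\frac{n}{(2\pi i)^2\sqrt{st}}\int_{x_0+i\mathbb R}dz\int_\Gamma dw\,\frac{\exp(\frac{n}{2t}[(z-y)^2+2tg_{\mu_n}(z)]-\frac{n}{2s}[(w-x)^2+2sg_{\mu_n}(w)])}{z-w}-1(s>t)\frac{\sqrt n}{\sqrt{2\pi(s-t)}}e^{-\frac{n(x-y)^2}{2(s-t)}}$, with $g_{\mu_n}(z)=\int\log(z-s)d\mu_n(s)$, $\Gamma$ a positively oriented closed contour winding once around each initial point, $x_0+i\mathbb R$ (upward) disjoint from $\Gamma$. $\tilde K_{n,s,t}(x,y)=K_{n,s,t}(x,y)e^{f_n(t,y)-f_n(s,x)}$ with $f_n(s,x)=-nG_0x+\frac{nG_0^2s}{2}$. Extended Pearcey kernel: $\mathbb K^{\rm P}_{\tau_1,\tau_2}(u,v)=\frac1{(2\pi i)^2}\int_{i\mathbb R}d\zeta\int_{\Gamma^{\rm P}}d\omega\,\frac{\exp(-\frac{\zeta^4}{4}-\frac{\tau_2\zeta^2}{2}-v\zeta+\frac{\omega^4}{4}+\frac{\tau_1\omega^2}{2}+u\omega)}{\zeta-\omega}-1(\tau_1>\tau_2)\frac{1}{\sqrt{2\pi(\tau_1-\tau_2)}}e^{-\frac{(u-v)^2}{2(\tau_1-\tau_2)}}$,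 where $\Gamma^{\rm P}$ consists of four rays: two from the origin to $\pm\infty e^{-i\pi/4}$ and two from $\pm\infty e^{i\pi/4}$ to the origin. *)

theory Defs
  imports "HOL-Probability.Probability" "HOL-Complex_Analysis.Complex_Analysis"
begin

definition measure_support :: "real measure \<Rightarrow> real set" where
  "measure_support M = {x. \<forall>e>0. emeasure M (ball x e) > 0}"

definition emp_cdf :: "(nat \<Rightarrow> nat \<Rightarrow> real) \<Rightarrow> nat \<Rightarrow> real \<Rightarrow> real" where
  "emp_cdf a n x = real (card {j\<in>{..<n}. a n j \<le> x}) / real n"

text \<open>g_{mu_n}(z) = int log(z-s) dmu_n(s) (principal logarithm; only exp(n g) enters).\<close>
definition g_emp :: "(nat \<Rightarrow> nat \<Rightarrow> real) \<Rightarrow> nat \<Rightarrow> complex \<Rightarrow> complex" where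
  "g_emp a n z = (\<Sum>j<n. Ln (z - of_real (a n j))) / of_nat n"

definition Gcoef :: "real measure \<Rightarrow> real \<Rightarrow> nat \<Rightarrow> real" where
  "Gcoef mu xs j = (-1)^j * fact j * (LINT s|mu. 1 / (xs - s)^(j+1))"

definition tcr :: "real measure \<Rightarrow> real \<Rightarrow> real" where
  "tcr mu xs = 1 / (LINT s|mu. 1 / (xs - s)^2)"

definition c3 :: "real measure \<Rightarrow> real \<Rightarrow> real" where
  "c3 mu xs = (1 / tcr mu xs) * (6 / (- Gcoef mu xs 3)) powr (1/4)"

definition tP :: "real measure \<Rightarrow> real \<Rightarrow> nat \<Rightarrow> real \<Rightarrow> real" where
  "tP mu xs n \<tau> = tcr mu xs + \<tau> / ((c3 mu xs)^2 * sqrt (real n))"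

definition xP :: "real measure \<Rightarrow> real \<Rightarrow> nat \<Rightarrow> real \<Rightarrow> real" where
  "xP mu xs n \<tau> = xs + tP mu xs n \<tau> * Gcoef mu xs 0"

definition fconj :: "real measure \<Rightarrow> real \<Rightarrow> nat \<Rightarrow> real \<Rightarrow> real \<Rightarrow> real" where
  "fconj mu xs n s x = - real n * Gcoef mu xs 0 * x + real n * (Gcoef mu xs 0)^2 * s / 2"

text \<open>Correlation kernel K_{n,s,t}(x,y). The z-integral runs over the upward vertical line
  x0 n + i R, parametrised as z = x0 n + i eta (dz = i d eta); the w-integral is the contour
  integral over the closed path Gam n.\<close>
definition Kn :: "(nat \<Rightarrow> nat \<Rightarrow> real) \<Rightarrow> (nat \<Rightarrow> real \<Rightarrow> complex) \<Rightarrow> (nat \<Rightarrow> real)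
    \<Rightarrow> nat \<Rightarrow> real \<Rightarrow> real \<Rightarrow> real \<Rightarrow> real \<Rightarrow> complex" where
  "Kn a Gam x0 n s t x y =
     of_real (real n / sqrt (s * t)) / (2 * of_real pi * \<i>)^2 *
     (LINT eta|lborel. \<i> * contour_integral (Gam n) (\<lambda>w.
        exp (of_real (real n / (2 * t)) * ((Complex (x0 n) eta - of_real y)^2
                 + 2 * of_real t * g_emp a n (Complex (x0 n) eta))
             - of_real (real n / (2 * s)) * ((w - of_real x)^2 + 2 * of_real s * g_emp a n w))
        / (Complex (x0 n) eta - w)))
   - (if s > t then of_real (sqrt (real n) / sqrt (2 * pi * (s - t))
                        * exp (- real n * (x - y)^2 / (2 * (s - t)))) else 0)"

definition Ktilde :: "real measure \<Rightarrow> real \<Rightarrow> (nat \<Rightarrow> nat \<Rightarrow> real) \<Rightarrow> (nat \<Rightarrow> real \<Rightarrow> complex)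
    \<Rightarrow> (nat \<Rightarrow> real) \<Rightarrow> nat \<Rightarrow> real \<Rightarrow> real \<Rightarrow> real \<Rightarrow> real \<Rightarrow> complex" where
  "Ktilde mu xs a Gam x0 n s t x y =
     Kn a Gam x0 n s t x y * of_real (exp (fconj mu xs n t y - fconj mu xs n s x))"

text \<open>Integral over Gamma^P: rays from 0 to infinity*e^{-i pi/4} and to -infinity*e^{-i pi/4}
  = infinity*e^{3 i pi/4} (outgoing), and from infinity*e^{i pi/4} and
  -infinity*e^{i pi/4} = infinity*e^{5 i pi/4} to 0 (incoming).\<close>
definition ray_integral :: "real \<Rightarrow> (complex \<Rightarrow> complex) \<Rightarrow> complex" where
  "ray_integral \<theta> f = (LINT r:{0..}|lborel. f (of_real r * cis \<theta>) * cis \<theta>)"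

definition GammaP_integral :: "(complex \<Rightarrow> complex) \<Rightarrow> complex" where
  "GammaP_integral f =
     ray_integral (- pi/4) f + ray_integral (3*pi/4) f
     - ray_integral (pi/4) f - ray_integral (5*pi/4) f"

text \<open>Extended Pearcey kernel; zeta runs over i R upward: zeta = i eta, d zeta = i d eta.\<close>
definition pearceyK :: "real \<Rightarrow> real \<Rightarrow> real \<Rightarrow> real \<Rightarrow> complex" where
  "pearceyK \<tau>1 \<tau>2 u v =
     1 / (2 * of_real pi * \<i>)^2 *
     (LINT eta|lborel. \<i> * GammaP_integral (\<lambda>\<omega>.
        exp (- ((\<i> * of_real eta)^4) / 4 - of_real \<tau>2 * (\<i> * of_real eta)^2 / 2
             - of_real v * (\<i> * of_real eta)
             + \<omega>^4 / 4 + of_real \<tau>1 * \<omega>^2 / 2 + of_real u * \<omega>)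
        / (\<i> * of_real eta - \<omega>)))
   - (if \<tau>1 > \<tau>2 then of_real (1 / sqrt (2 * pi * (\<tau>1 - \<tau>2))
                        * exp (- ((u - v)^2) / (2 * (\<tau>1 - \<tau>2)))) else 0)"

end

theory Submission
  imports Defs
begin

text \<open>
  The integrand of the kernel factors, up to \<open>1 / (z - w)\<close>, into a function of \<open>z\<close> times the reciprocal
  of a function of the same type in \<open>w\<close>. Cauchy's theorem moves the \<open>z\<close>-line to \<open>x\<^sup>* + i\<real>\<close>, and residues
  replace \<open>\<Gamma>\<close> by two triangles with a vertex at \<open>x\<^sup>*\<close>, which open up to four rays from \<open>x\<^sup>*\<close> at
  the angles \<open>\<pm>\<pi>/6\<close> and \<open>\<pi> \<pm> \<pi>/6\<close>. At these angles, unlike at \<open>\<pi>/4\<close>, the contribution of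
  each initial point to the \<open>w\<close>-function decreases along the whole ray, not only near its origin.

  At the scale \<open>k = m\<^sub>4 powr (-1/4) * n powr (-1/4)\<close>, with \<open>m\<^sub>j\<close> the \<open>j\<close>-th inverse moment of \<open>\<mu>\<close> at \<open>x\<^sup>*\<close>,
  the two functions become products over the points \<open>k / (x\<^sup>* - a\<^sub>j)\<close>, all at most
  \<open>\<beta> = O(n powr (-(\<kappa> - 3) / (4 * (\<kappa> + 1))))\<close> by the gap condition. Their logarithms are quartic Taylor
  polynomials up to \<open>O(\<beta>)\<close>, because the empirical inverse moments are close to those of \<open>\<mu>\<close>. So each
  function converges to its Pearcey counterpart at rate \<open>\<beta>\<close> with exponential bounds. The Cauchy
  kernel is integrable on line times ray since \<open>\<bar>i\<eta> - \<omega>\<bar>\<^sup>2 \<ge> \<bar>\<eta>\<bar> \<bar>\<omega>\<bar>\<close> there, so the double integrals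
  converge at the same rate. Finally the Pearcey rays are rotated from \<open>\<pi>/4\<close> to \<open>\<pi>/6\<close>.
\<close>

subsection \<open>Elementary estimates\<close>

text \<open>The angle \<pi>/6 comes from the cubic term p^3 cos(3\<theta>)/3 of log |1 + p
  e^(i\<theta>)|. Initial points lie on both sides of \<open>xs\<close>, so p takes both signs and a
  nonzero cubic term has the wrong sign on one side. In the first quadrant cos(3\<theta>) = 0 leaves
  \<pi>/6, for the rays, and \<pi>/2, which is the z-line; the quartic terms then give the decay.
  Each factor damps quartically only for bounded p and quadratically beyond, but after summation the
  quadratic rate is of order \<beta>^(-2). This beats quadratic error terms with bounded
  coefficients as soon as \<beta> is small. Moving the z-line across \<Gamma> would create residues
  at w = z. To avoid them, the w-integral is replaced beforehand by its entire extension in z, which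
  exists because the z-factor has zeros where the w-factor has poles. Conjugation, the Gaussian part
  and the rescaled weights match exactly once \<tau>, u, v are multiplied by the ratio \<phi> of
  \<open>tcr\<close> to the time. Errors thus come only from power sums, from \<phi> and from a
  scalar prefactor.\<close>

text \<open>Applied with X = y^2, this measures how far |1 + iy| stays below exp(y^2/2). The
  difference of the two sides vanishes at 0 and is monotone.\<close>

lemma ln_one_plus_le:
  fixes X :: real
  assumes "X \<ge> 0"
  shows "ln (1 + X) \<le> X - X^2 / (2 * (1 + X))"
proof -
  define h where "h = (\<lambda>x::real. x - x^2 / (2 * (1 + x)) - ln (1 + x))"
  have d: "(h has_real_derivative (x^2 / (2 * (1 + x)^2))) (at x)" if "x \<ge> 0" for x
  proof -
    have "(h has_real_derivative (1 - (2 * x * (2 * (1 + x)) - x^2 * 2) / (2 * (1 + x))^2 - 1 / (1 + x))) (at x)"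
      unfolding h_def using that
      by (auto intro!: derivative_eq_intros simp: power2_eq_square)
    moreover have "1 - (2 * x * (2 * (1 + x)) - x^2 * 2) / (2 * (1 + x))^2 - 1 / (1 + x) = x^2 / (2 * (1 + x)^2)"
      using that by (simp add: divide_simps) (simp add: algebra_simps power2_eq_square)
    ultimately show ?thesis by simp
  qed
  have "h 0 \<le> h X"
    by (rule DERIV_nonneg_imp_nondecreasing[OF assms]) (use d in \<open>force intro: divide_nonneg_nonneg\<close>)
  then show ?thesis by (simp add: h_def)
qed

text \<open>\<open>1 + sqrt 3 * p + p^2\<close> is |1 + p e^(i\<pi>/6)|^2, and its logarithm has no
  cubic Taylor term; this is why one estimate covers both signs of \<open>p\<close>. The difference
  of the two sides has derivative x^3 times a nonnegative factor, hence its minimum 0 at the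
  origin.\<close>

lemma ln_quadratic_ge:
  fixes p :: real
  shows "ln (1 + sqrt 3 * p + p^2) \<ge> sqrt 3 * p - p^2 / 2 + p^4 / (8 * (1 + p^2))"
proof -
  define h where "h = (\<lambda>x::real. ln (1 + sqrt 3 * x + x^2) - sqrt 3 * x + x^2 / 2 - x^4 / (8 * (1 + x^2)))"
  define h' where "h' = (\<lambda>x::real. x^3 / (1 + sqrt 3 * x + x^2) - x^3 * (2 + x^2) / (4 * (1 + x^2)^2))"
  have s3: "sqrt 3 * sqrt 3 = (3::real)" by simp
  have pos: "1 + sqrt 3 * x + x^2 > 0" for x :: real
  proof -
    have "1 + sqrt 3 * x + x^2 = (x + sqrt 3 / 2)^2 + 1/4"
      by (simp add: power2_eq_square algebra_simps s3)
    moreover have "(x + sqrt 3 / 2)^2 \<ge> 0" by simp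
    ultimately show ?thesis by linarith
  qed
  have p1: "1 + x^2 > 0" for x :: real by (simp add: add_pos_nonneg)
  have d: "(h has_real_derivative h' x) (at x)" for x
  proof -
    have "(h has_real_derivative ((sqrt 3 + 2 * x) / (1 + sqrt 3 * x + x^2) - sqrt 3 + x
        - (4 * x^3 * (8 * (1 + x^2)) - x^4 * (16 * x)) / (8 * (1 + x^2))^2)) (at x)"
      unfolding h_def using pos[of x] p1[of x]
      by (auto intro!: derivative_eq_intros simp: power2_eq_square)
    moreover have "(sqrt 3 + 2 * x) / (1 + sqrt 3 * x + x^2) - sqrt 3 + x = x^3 / (1 + sqrt 3 * x + x^2)"
    proof -
      have "(sqrt 3 + 2 * x) + (x - sqrt 3) * (1 + sqrt 3 * x + x^2) = x^3 + (3 - sqrt 3 * sqrt 3) * x"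
        by (simp add: algebra_simps power2_eq_square power3_eq_cube del: real_sqrt_mult_self)
      then have "(sqrt 3 + 2 * x) + (x - sqrt 3) * (1 + sqrt 3 * x + x^2) = x^3" by simp
      then show ?thesis using pos[of x] by (simp add: field_simps)
    qed
    moreover have "(4 * x^3 * (8 * (1 + x^2)) - x^4 * (16 * x)) / (8 * (1 + x^2))^2 = x^3 * (2 + x^2) / (4 * (1 + x^2)^2)"
    proof -
      have "4 * x^3 * (8 * (1 + x^2)) - x^4 * (16 * x) = 16 * (x^3 * (2 + x^2))" by algebra
      moreover have "(8 * (1 + x^2))^2 = 16 * (4 * (1 + x^2)^2)" by algebra
      ultimately show ?thesis by simp
    qed
    ultimately show ?thesis unfolding h'_def by simp
  qed
  have bnd: "(2 + x^2) / (4 * (1 + x^2)^2) \<le> 1 / (1 + sqrt 3 * x + x^2)" for x :: real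
  proof -
    \<comment> \<open>The difference of the two sides is the same quadratic at \<open>- x\<close>,
      which is positive.\<close>
    have a: "1 + sqrt 3 * x + x^2 \<le> 2 * (1 + x^2)"
      using pos[of "- x"] by simp
    have "(2 + x^2) / (4 * (1 + x^2)^2) \<le> 1 / (2 * (1 + x^2))"
    proof -
      have "(2 + x^2) * (2 * (1 + x^2)) + 2 * x^2 * (1 + x^2) = 4 * (1 + x^2)^2" by algebra
      moreover have "2 * x^2 * (1 + x^2) \<ge> 0" by simp
      ultimately have "(2 + x^2) * (2 * (1 + x^2)) \<le> 1 * (4 * (1 + x^2)^2)" by linarith
      then show ?thesis using p1[of x] by (subst frac_le_eq) (auto intro!: divide_nonpos_pos)
    qed
    also have "\<dots> \<le> 1 / (1 + sqrt 3 * x + x^2)" using a pos[of x] by (simp add: frac_le)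
    finally show ?thesis .
  qed
  have h'eq: "h' x = x^3 * (1 / (1 + sqrt 3 * x + x^2) - (2 + x^2) / (4 * (1 + x^2)^2))" for x
    unfolding h'_def by (simp add: algebra_simps)
  have h0: "h 0 = 0" by (simp add: h_def)
  have "h p \<ge> 0"
  proof (cases "p \<ge> 0")
    case True
    have "h 0 \<le> h p"
    proof (rule DERIV_nonneg_imp_nondecreasing[OF True])
      fix x :: real assume "0 \<le> x"
      then have "h' x \<ge> 0" unfolding h'eq using bnd[of x] by simp
      then show "\<exists>y. DERIV h x :> y \<and> 0 \<le> y" using d by blast
    qed
    then show ?thesis using h0 by simp
  next
    case False
    have "h 0 \<le> h p"
    proof (rule DERIV_nonpos_imp_nonincreasing[where f = h])
      show "p \<le> 0" using False by simp
      fix x :: real assume "p \<le> x" "x \<le> 0"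
      then have "x^3 \<le> 0" by (simp add: power3_eq_cube mult_nonneg_nonpos mult_nonpos_nonpos)
      then have "h' x \<le> 0" unfolding h'eq using bnd[of x] by (simp add: mult_nonpos_nonneg)
      then show "\<exists>y. DERIV h x :> y \<and> y \<le> 0" using d by blast
    qed
    then show ?thesis using h0 by simp
  qed
  then show ?thesis by (simp add: h_def)
qed

lemma Ln_one_plus_fourth_order:
  fixes y :: complex
  assumes "norm y \<le> 1/2"
  shows "norm (Ln (1 + y) - (y - y^2/2 + y^3/3 - y^4/4)) \<le> norm y ^ 5"
proof -
  \<comment> \<open>The term of index 0 is 0, by division by zero, so the first five terms are
    exactly the quartic polynomial.\<close>
  define f where "f = (\<lambda>n. - ((-y)^n) / of_nat n)"
  have "f sums Ln (1 + y)" unfolding f_def using Ln_series'[of y] assms by simp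
  then have "(\<lambda>n. f (n + 5)) sums (Ln (1 + y) - (\<Sum>i<5. f i))" by (simp add: sums_iff_shift)
  moreover have "(\<Sum>i<5. f i) = y - y^2/2 + y^3/3 - y^4/4"
    by (simp add: f_def eval_nat_numeral)
  ultimately have s: "(\<lambda>n. f (n + 5)) sums (Ln (1 + y) - (y - y^2/2 + y^3/3 - y^4/4))" by simp
  \<comment> \<open>Bounding the coefficient 1/(n + 5) by 1/2 makes the geometric sum exactly the
    claimed fifth power.\<close>
  have geo: "(\<lambda>n. norm y ^ 5 / 2 * (1/2)^n) sums (norm y ^ 5)"
    using sums_mult[OF geometric_sums[of "1/2::real"], of "norm y ^ 5 / 2"] by simp
  have b: "norm (f (n + 5)) \<le> norm y ^ 5 / 2 * (1/2)^n" for n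
  proof -
    have "norm (f (n + 5)) = norm y ^ 5 * norm y ^ n / real (n + 5)"
      by (simp only: f_def norm_divide norm_minus_cancel norm_mult norm_power power_add norm_of_nat mult.commute)
    also have "\<dots> \<le> norm y ^ 5 * (1/2) ^ n / 2"
      using assms by (intro frac_le mult_left_mono power_mono) auto
    finally show ?thesis by simp
  qed
  show ?thesis
    using norm_sums_le[OF s geo] b by blast
qed

text \<open>The half-plane Re z \<le> ln m is convex and the derivative of \<open>exp\<close> is at
  most m there, so the mean value bound applies.\<close>

lemma norm_exp_diff_le:
  fixes a b :: complex
  assumes "norm (exp a) \<le> m" "norm (exp b) \<le> m"
  shows "norm (exp a - exp b) \<le> m * norm (a - b)"
proof -
  have m: "0 < m" using assms(1) exp_gt_zero[of "Re a"] by (simp only: norm_exp_eq_Re)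
  have S: "convex {z. Re z \<le> ln m}" by (rule convex_halfspace_Re_le)
  have mem: "Re a \<le> ln m" "Re b \<le> ln m"
    using assms m by (simp_all add: norm_exp_eq_Re ln_ge_iff)
  have "norm (exp a - exp b) \<le> m * norm (a - b)"
  proof (rule field_differentiable_bound[OF S, where f' = exp])
    show "(exp has_field_derivative exp z) (at z within {z. Re z \<le> ln m})" for z :: complex
      by (rule DERIV_subset[OF DERIV_exp]) auto
    show "norm (exp z) \<le> m" if "z \<in> {z. Re z \<le> ln m}" for z
      using that m by (simp add: norm_exp_eq_Re ln_ge_iff)
  qed (use mem in auto)
  then show ?thesis .
qed

lemma power_le_fact_exp:
  fixes x :: real
  assumes "x \<ge> 0"
  shows "x ^ k \<le> fact k * exp x"
proof -
  have "x ^ k / fact k \<le> (\<Sum>i\<le>k. x ^ i / fact i)"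
    using assms by (intro member_le_sum) auto
  also have "\<dots> \<le> exp x"
    using sum_le_suminf[of "\<lambda>i. x ^ i / fact i" "{..k}"] assms exp_converges[of x]
    by (simp add: sums_iff divide_inverse mult.commute)
  finally show ?thesis by (simp add: field_simps)
qed

subsection \<open>Convergence of the rescaled weights\<close>

text \<open>The factor of the integrand that depends on \<open>z\<close>, at \<open>z = xs + k * \<zeta>\<close> and divided by its value at \<open>\<zeta> = 0\<close>;
  here \<open>x j = k / (xs - a n j)\<close>, while \<open>A1\<close> and \<open>A2\<close> are the values that the first two power sums of \<open>x\<close> approach.\<close>
definition Zfun :: "nat \<Rightarrow> (nat \<Rightarrow> real) \<Rightarrow> real \<Rightarrow> real \<Rightarrow> real \<Rightarrow> real \<Rightarrow> complex \<Rightarrow> complex" where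
  "Zfun n x A1 A2 \<sigma> \<nu> \<zeta> = (\<Prod>j<n. 1 + of_real (x j) * \<zeta>) *
     exp (- of_real A1 * \<zeta> + of_real A2 * \<zeta>^2 / 2 - of_real \<sigma> * \<zeta>^2 / 2 - of_real \<nu> * \<zeta>)"

definition Pfun :: "real \<Rightarrow> real \<Rightarrow> complex \<Rightarrow> complex" where
  "Pfun \<tau> v \<zeta> = exp (- (\<zeta>^4) / 4 - of_real \<tau> * \<zeta>^2 / 2 - of_real v * \<zeta>)"

text \<open>Common majorant of the z-factor on the imaginary axis and of the reciprocal w-factor on
  the rays. The first term is the damping by the points, quartic up to \<rho> of order 1/\<beta> and
  quadratic beyond; the second bounds the linear and quadratic errors.\<close>

definition decay :: "real \<Rightarrow> real \<Rightarrow> real \<Rightarrow> real" where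
  "decay \<beta> D \<rho> = exp (- (\<rho>^4 / (32 * (1 + \<beta>^2 * \<rho>^2))) + D * (\<rho> + \<rho>^2))"

text \<open>For \<beta>\<rho> \<le> 1 the quartic wins by completing a square; for \<beta>\<rho> > 1
  the damping is at least \<rho>^2/(64 \<beta>^2), which the smallness of \<beta> makes larger than
  the quadratic error. The 2 in D + 2 absorbs a factor exp(2\<rho>), of which half is later spent on
  the factor exp \<rho> in the difference estimates.\<close>

lemma decay_le:
  fixes \<beta> D \<rho> :: real
  assumes "\<rho> \<ge> 0" "D \<ge> 0" "\<beta> > 0" "128 * (D + 2) * \<beta>^2 \<le> 1"
  shows "decay \<beta> D \<rho> \<le> exp (64 * (D + 2)^2 + 2 * (D + 2)) * exp (- 2 * \<rho>)"
proof -
  define E where "E = D + 2"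
  have E: "E \<ge> 2" "128 * E * \<beta>^2 \<le> 1" using assms by (simp_all add: E_def)
  have r: "\<rho> \<le> 1 + \<rho>^2"
    using sum_squares_bound[of 1 \<rho>] assms(1) by simp
  have "E * \<rho> \<le> E * (1 + \<rho>^2)" using r E by (intro mult_left_mono) auto
  then have u: "D * (\<rho> + \<rho>^2) + 2 * \<rho> \<le> E + 2 * E * \<rho>^2"
  proof -
    have "0 \<le> D * \<rho>^2" "0 \<le> \<rho>^2" using assms by auto
    then show ?thesis using \<open>E * \<rho> \<le> E * (1 + \<rho>^2)\<close> unfolding E_def by (simp only: algebra_simps)
  qed
  have "E + 2 * E * \<rho>^2 - \<rho>^4 / (32 * (1 + \<beta>^2 * \<rho>^2)) \<le> 64 * E^2 + 2 * E"
  proof (cases "\<beta>^2 * \<rho>^2 \<le> 1")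
    case True
    have "\<rho>^4 / 64 \<le> \<rho>^4 / (32 * (1 + \<beta>^2 * \<rho>^2))"
      using True by (intro divide_left_mono) (auto intro!: mult_pos_pos add_pos_nonneg)
    moreover have "(\<rho>^2 / 8 - 8 * E)^2 = \<rho>^4 / 64 - 2 * E * \<rho>^2 + 64 * E^2"
      by (simp add: power2_diff power_divide power_mult_distrib flip: power_mult)
    moreover have "(\<rho>^2 / 8 - 8 * E)^2 \<ge> 0" by simp
    ultimately show ?thesis using E by linarith
  next
    case False
    then have pos: "\<beta>^2 * \<rho>^2 > 1" by simp
    then have rp: "\<rho>^2 > 0" by (cases "\<rho> = 0") auto
    have "2 * E * \<rho>^2 * (32 * (1 + \<beta>^2 * \<rho>^2)) \<le> 2 * E * \<rho>^2 * (64 * (\<beta>^2 * \<rho>^2))"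
      using pos E rp by (intro mult_left_mono) auto
    also have "\<dots> = (128 * E * \<beta>^2) * \<rho>^4" by (simp add: power2_eq_square power4_eq_xxxx)
    also have "\<dots> \<le> 1 * \<rho>^4" using E by (intro mult_right_mono) auto
    finally have "2 * E * \<rho>^2 \<le> \<rho>^4 / (32 * (1 + \<beta>^2 * \<rho>^2))"
      using pos by (subst pos_le_divide_eq) auto
    moreover have "64 * E^2 \<ge> 0" by simp
    ultimately show ?thesis using E by linarith
  qed
  then show ?thesis unfolding decay_def exp_add[symmetric] E_def[symmetric] using u
    by (intro iffD2[OF exp_le_cancel_iff]) linarith
qed

section \<open>Bounds for the weights on the imaginary axis and on the rays\<close>

lemma norm_gauss_factor_imag_le:
  fixes y :: real
  shows "norm ((1 + \<i> * of_real y) * exp (- (\<i> * of_real y) + (\<i> * of_real y)^2 / 2))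
    \<le> exp (- (y^4 / (16 * (1 + y^2))))"
proof -
  have "norm (1 + \<i> * of_real y) = sqrt (1 + y^2)"
    by (simp add: cmod_def)
  also have "\<dots> = exp (ln (1 + y^2) / 2)"
    by (simp add: add_pos_nonneg ln_sqrt[symmetric])
  finally have n1: "norm (1 + \<i> * of_real y) = exp (ln (1 + y^2) / 2)" .
  have n2: "norm (exp (- (\<i> * of_real y) + (\<i> * of_real y)^2 / 2)) = exp (- (y^2) / 2)"
    by (simp add: norm_exp_eq_Re power_mult_distrib)
  define q where "q = (y^2)^2 / (2 * (1 + y^2))"
  have q: "0 \<le> q" "(y^2)^2 / (16 * (1 + y^2)) = q / 8" by (simp_all add: q_def)
  have "ln (1 + y^2) / 2 - y^2 / 2 \<le> - ((y^2)^2 / (16 * (1 + y^2)))"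
    using ln_one_plus_le[OF zero_le_power2[of y]] q unfolding q(2) q_def[symmetric] by linarith
  then have "ln (1 + y^2) / 2 - y^2 / 2 \<le> - (y^4 / (16 * (1 + y^2)))" by (simp flip: power_mult)
  then show ?thesis unfolding norm_mult n1 n2 exp_add[symmetric] by simp
qed

text \<open>Only the two directions in the right half-plane: the opposite rays are reached by
  negative parameters, so ray estimates are stated for all real \<open>r\<close>.\<close>

definition dir :: "complex \<Rightarrow> bool" where
  "dir d \<longleftrightarrow> d = Complex (sqrt 3 / 2) (1/2) \<or> d = Complex (sqrt 3 / 2) (- 1/2)"

lemma dir_facts:
  assumes "dir d"
  shows "norm d = 1" "Re d = sqrt 3 / 2" "Re (d^2) = 1/2" "Re (d^4) = - 1/2" "\<bar>Im d\<bar> = 1/2"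
proof -
  have a: "sqrt 3 * sqrt 3 = (3::real)" by simp
  show "norm d = 1" "Re d = sqrt 3 / 2" "\<bar>Im d\<bar> = 1/2" using assms by (auto simp: dir_def cmod_def power_divide)
  have c: "d^2 = Complex (1/2) (sqrt 3 / 2) \<or> d^2 = Complex (1/2) (- sqrt 3 / 2)"
    using assms unfolding dir_def by (elim disjE; hypsubst) (simp_all add: power2_eq_square complex_eq_iff)
  then show "Re (d^2) = 1/2" by auto
  have "d^4 = d^2 * d^2" by (simp add: power2_eq_square power4_eq_xxxx)
  with c show "Re (d^4) = - 1/2" by (elim disjE) simp_all
qed

lemma norm_gauss_factor_ray_ge:
  fixes p :: real
  assumes "dir d"
  shows "exp (p^4 / (16 * (1 + p^2))) \<le> norm ((1 + of_real p * d) * exp (- (of_real p * d) + (of_real p * d)^2 / 2))"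
proof -
  have im: "(Im d)^2 = 1/4" using assms by (auto simp: dir_def power_divide)
  then have "(norm (1 + of_real p * d))^2 = 1 + sqrt 3 * p + p^2"
    unfolding cmod_power2
    by (simp add: dir_facts(2)[OF assms] im power_mult_distrib power2_sum power_divide algebra_simps)
  then have n0: "norm (1 + of_real p * d) = sqrt (1 + sqrt 3 * p + p^2)"
    by (metis norm_ge_zero real_sqrt_unique)
  have pos: "1 + sqrt 3 * p + p^2 > 0"
  proof -
    have "1 + sqrt 3 * p + p^2 = (p + sqrt 3 / 2)^2 + 1/4"
      by (simp add: power2_sum power_divide algebra_simps)
    moreover have "(p + sqrt 3 / 2)^2 \<ge> 0" by simp
    ultimately show ?thesis by linarith
  qed
  have n1: "norm (1 + of_real p * d) = exp (ln (1 + sqrt 3 * p + p^2) / 2)"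
    using pos by (simp add: n0 ln_sqrt[symmetric])
  have n2: "norm (exp (- (of_real p * d) + (of_real p * d)^2 / 2)) = exp (- (sqrt 3 * p / 2) + p^2 / 4)"
    by (simp add: mult.commute[of p] dir_facts(2,3)[OF assms] norm_exp_eq_Re power_mult_distrib flip: of_real_power)
  define q where "q = p^4 / (8 * (1 + p^2))"
  have q: "p^4 / (16 * (1 + p^2)) = q / 2" by (simp add: q_def)
  show ?thesis unfolding norm_mult n1 n2 exp_add[symmetric] exp_le_cancel_iff q
    using ln_quadratic_ge[of p] unfolding q_def[symmetric] by linarith
qed

text \<open>The limit weight decays faster than this; it is put under the majorant of
  \<open>Zfun\<close>, for every \<beta>, because \<open>norm_exp_diff_le\<close> needs one bound
  for both functions.\<close>

lemma norm_Pfun_imag_le: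
  assumes "\<bar>\<tau>\<bar> \<le> B"
  shows "norm (Pfun \<tau> v (\<i> * of_real \<eta>)) \<le> decay \<beta> (1 + B) \<bar>\<eta>\<bar>"
proof -
  have "norm (Pfun \<tau> v (\<i> * of_real \<eta>)) = exp (- (\<eta>^4 / 4) + \<tau> * \<eta>^2 / 2)"
    by (simp add: Pfun_def norm_exp_eq_Re power_mult_distrib flip: of_real_power)
  also have "\<dots> \<le> decay \<beta> (1 + B) \<bar>\<eta>\<bar>"
  proof -
    have "4 \<le> 32 * (1 + \<beta>^2 * \<eta>^2)" by (simp add: add_increasing2)
    then have "\<eta>^4 / (32 * (1 + \<beta>^2 * \<eta>^2)) \<le> \<eta>^4 / 4"
      by (intro divide_left_mono) (auto simp: add_pos_nonneg)
    moreover have "\<tau> * \<eta>^2 / 2 \<le> (1 + B) * (\<bar>\<eta>\<bar> + \<eta>^2)"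
    proof -
      have "\<tau> * \<eta>^2 \<le> (1 + B) * \<eta>^2" using assms by (intro mult_right_mono) auto
      moreover have "0 \<le> (1 + B) * \<bar>\<eta>\<bar>" "0 \<le> (1 + B) * \<eta>^2" using assms by auto
      ultimately show ?thesis by (simp add: distrib_left)
    qed
    ultimately show ?thesis unfolding decay_def by simp
  qed
  finally show ?thesis .
qed

lemma norm_inverse_Pfun_ray_le:
  assumes "dir d" "\<bar>\<tau>\<bar> \<le> B" "\<bar>v\<bar> \<le> B"
  shows "norm (1 / Pfun \<tau> v (of_real r * d)) \<le> decay \<beta> (1 + B) \<bar>r\<bar>"
proof -
  have "norm (1 / Pfun \<tau> v (of_real r * d)) = exp (- (r^4 / 8) + (\<tau> * r^2 / 4 + v * r * (sqrt 3 / 2)))"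
  proof -
    have "1 / Pfun \<tau> v (of_real r * d) = exp (of_real (r^4) * d^4 / 4 + of_real (\<tau> * r^2) * d^2 / 2 + of_real (v * r) * d)"
      by (simp add: Pfun_def inverse_eq_divide[symmetric] exp_minus[symmetric] power_mult_distrib algebra_simps)
    then show ?thesis
      by (simp only: norm_exp_eq_Re) (simp add: dir_facts[OF assms(1)])
  qed
  also have "\<dots> \<le> decay \<beta> (1 + B) \<bar>r\<bar>"
  proof -
    have "8 \<le> 32 * (1 + \<beta>^2 * r^2)" by (simp add: add_increasing2)
    then have "r^4 / (32 * (1 + \<beta>^2 * r^2)) \<le> r^4 / 8"
      by (intro divide_left_mono) (auto simp: add_pos_nonneg)
    moreover have "\<tau> * r^2 / 4 + v * r * (sqrt 3 / 2) \<le> (1 + B) * (\<bar>r\<bar> + r^2)"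
    proof -
      have "\<tau> * r^2 \<le> (1 + B) * r^2" using assms by (intro mult_right_mono) auto
      moreover have "v * r * (sqrt 3 / 2) \<le> (1 + B) * \<bar>r\<bar> * 1"
      proof -
        have s: "sqrt 3 / 2 \<le> (1::real)" using real_sqrt_le_mono[of 3 4] by simp
        have "v * r * (sqrt 3 / 2) \<le> \<bar>v\<bar> * \<bar>r\<bar> * (sqrt 3 / 2)"
          by (intro mult_right_mono) (auto simp: abs_mult[symmetric])
        also have "\<dots> \<le> (1 + B) * \<bar>r\<bar> * 1" using assms s by (intro mult_mono) auto
        finally show ?thesis .
      qed
      moreover have "0 \<le> (1 + B) * r^2" using assms by auto
      ultimately show ?thesis by (simp add: distrib_left)
    qed
    ultimately show ?thesis unfolding decay_def by simp
  qed
  finally show ?thesis .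
qed

text \<open>What the asymptotics need to know about the rescaled points. \<open>A1\<close> and
  \<open>A2\<close> may grow with n, but the exponential in \<open>Zfun\<close> compensates them;
  the third power sum is small because G_2 = 0, and the fourth is near 1 by the choice of
  scale.\<close>

locale configuration =
  fixes n :: nat and x :: "nat \<Rightarrow> real" and A1 A2 \<beta> C :: real
  assumes beta: "0 < \<beta>" "C * \<beta> \<le> 1/2" and C: "1 \<le> C"
    and x_le: "\<And>j. j < n \<Longrightarrow> \<bar>x j\<bar> \<le> \<beta>"
    and S1: "\<bar>(\<Sum>j<n. x j) - A1\<bar> \<le> C * \<beta>"
    and S2: "\<bar>(\<Sum>j<n. x j ^ 2) - A2\<bar> \<le> C * \<beta>"
    and S3: "\<bar>\<Sum>j<n. x j ^ 3\<bar> \<le> C * \<beta>"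
    and S4: "\<bar>(\<Sum>j<n. x j ^ 4) - 1\<bar> \<le> C * \<beta>"
begin

text \<open>A product of Weierstrass primary factors of genus 2, each with a logarithm of third
  order at 0. What is split off is collected in \<open>Ef\<close>, whose coefficients stay
  bounded.\<close>

definition Gf :: "complex \<Rightarrow> complex" where
  "Gf \<zeta> = (\<Prod>j<n. (1 + of_real (x j) * \<zeta>) * exp (- (of_real (x j) * \<zeta>) + (of_real (x j) * \<zeta>)^2 / 2))"

definition Ef :: "real \<Rightarrow> real \<Rightarrow> complex \<Rightarrow> complex" where
  "Ef \<sigma> \<nu> \<zeta> = of_real ((\<Sum>j<n. x j) - A1) * \<zeta> - of_real ((\<Sum>j<n. x j ^ 2) - A2) * \<zeta>^2 / 2
     - of_real \<sigma> * \<zeta>^2 / 2 - of_real \<nu> * \<zeta>"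

lemma Zfun_eq: "Zfun n x A1 A2 \<sigma> \<nu> \<zeta> = Gf \<zeta> * exp (Ef \<sigma> \<nu> \<zeta>)"
proof -
  have "Gf \<zeta> = (\<Prod>j<n. 1 + of_real (x j) * \<zeta>) *
      exp (\<Sum>j<n. - (of_real (x j) * \<zeta>) + (of_real (x j) * \<zeta>)^2 / 2)"
    by (simp add: Gf_def prod.distrib exp_sum)
  moreover have "(\<Sum>j<n. - (of_real (x j) * \<zeta>) + (of_real (x j) * \<zeta>)^2 / 2)
     = - of_real (\<Sum>j<n. x j) * \<zeta> + of_real (\<Sum>j<n. x j ^ 2) * \<zeta>^2 / 2"
    by (simp add: sum.distrib sum_negf sum_subtractf sum_distrib_right sum_divide_distrib power_mult_distrib)
  moreover have "- of_real A1 * \<zeta> + of_real A2 * \<zeta>^2 / 2 - of_real \<sigma> * \<zeta>^2 / 2 - of_real \<nu> * \<zeta>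
     = (- of_real a * \<zeta> + of_real b * \<zeta>^2 / 2) + (of_real (a - A1) * \<zeta> - of_real (b - A2) * \<zeta>^2 / 2
     - of_real \<sigma> * \<zeta>^2 / 2 - of_real \<nu> * \<zeta>)" for a b :: real
    by (simp add: left_diff_distrib diff_divide_distrib)
  ultimately show ?thesis unfolding Zfun_def Ef_def by (simp only: exp_add[symmetric] mult.assoc)
qed

lemma norm_Ef_le:
  assumes "\<bar>\<sigma>\<bar> \<le> B" "\<bar>\<nu>\<bar> \<le> B"
  shows "norm (Ef \<sigma> \<nu> \<zeta>) \<le> (1 + B) * (norm \<zeta> + norm \<zeta> ^ 2)"
proof -
  have "norm (Ef \<sigma> \<nu> \<zeta>) \<le> norm (of_real ((\<Sum>j<n. x j) - A1) * \<zeta>) + norm (of_real ((\<Sum>j<n. x j ^ 2) - A2) * \<zeta>^2 / 2)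
     + norm (of_real \<sigma> * \<zeta>^2 / 2) + norm (of_real \<nu> * \<zeta>)"
    unfolding Ef_def by (intro order.trans[OF norm_triangle_ineq4] add_mono order.refl)
  also have "\<dots> = \<bar>(\<Sum>j<n. x j) - A1\<bar> * norm \<zeta> + \<bar>(\<Sum>j<n. x j ^ 2) - A2\<bar> * norm \<zeta>^2 / 2
     + \<bar>\<sigma>\<bar> * norm \<zeta>^2 / 2 + \<bar>\<nu>\<bar> * norm \<zeta>"
    unfolding norm_mult norm_divide norm_power norm_of_real by simp
  also have "\<dots> \<le> 1/2 * norm \<zeta> + 1/2 * norm \<zeta>^2 / 2 + B * norm \<zeta>^2 / 2 + B * norm \<zeta>"
    using S1 S2 beta assms by (intro add_mono divide_right_mono mult_right_mono) auto
  also have "\<dots> \<le> (1 + B) * (norm \<zeta> + norm \<zeta> ^ 2)"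
  proof -
    have "0 \<le> B * norm \<zeta>^2" "0 \<le> norm \<zeta>" "0 \<le> norm \<zeta>^2" using assms by auto
    then show ?thesis by (simp only: algebra_simps)
  qed
  finally show ?thesis .
qed

lemma sum4_ge: "1/2 \<le> (\<Sum>j<n. x j ^ 4)" and sum4_le: "(\<Sum>j<n. x j ^ 4) \<le> 2"
  using S4 beta by linarith+

text \<open>Replacing \<open>x j\<close> by \<beta> in the denominators only decreases the terms,
  and then the fourth power sum factors out; it is at least 1/2, which turns 16 into 32.\<close>

lemma quartic_sum_ge:
  "r^4 / (32 * (1 + \<beta>^2 * r^2)) \<le> (\<Sum>j<n. (x j * r)^4 / (16 * (1 + (x j * r)^2)))"
proof -
  have "r^4 / (32 * (1 + \<beta>^2 * r^2)) = 1/2 * (r^4 / (16 * (1 + \<beta>^2 * r^2)))" by simp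
  also have "\<dots> \<le> (\<Sum>j<n. x j ^ 4) * (r^4 / (16 * (1 + \<beta>^2 * r^2)))"
    using sum4_ge by (intro mult_right_mono) auto
  also have "\<dots> = (\<Sum>j<n. (x j * r)^4 / (16 * (1 + \<beta>^2 * r^2)))"
    by (simp add: sum_distrib_right sum_divide_distrib power_mult_distrib)
  also have "\<dots> \<le> (\<Sum>j<n. (x j * r)^4 / (16 * (1 + (x j * r)^2)))"
  proof (intro sum_mono divide_left_mono mult_left_mono add_left_mono)
    fix j assume "j \<in> {..<n}"
    then have "\<bar>x j\<bar>^2 \<le> \<beta>^2" using x_le by (intro power_mono) auto
    then show "(x j * r)^2 \<le> \<beta>^2 * r^2" unfolding power_mult_distrib by (intro mult_right_mono) auto
  qed (auto intro!: mult_pos_pos add_pos_nonneg)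
  finally show ?thesis .
qed

lemma norm_Zfun_imag_le:
  assumes "\<bar>\<sigma>\<bar> \<le> B" "\<bar>\<nu>\<bar> \<le> B"
  shows "norm (Zfun n x A1 A2 \<sigma> \<nu> (\<i> * of_real \<eta>)) \<le> decay \<beta> (1 + B) \<bar>\<eta>\<bar>"
proof -
  have "norm (Gf (\<i> * of_real \<eta>)) \<le> (\<Prod>j<n. exp (- ((x j * \<eta>)^4 / (16 * (1 + (x j * \<eta>)^2)))))"
    unfolding Gf_def prod_norm[symmetric]
  proof (intro prod_mono conjI norm_ge_zero)
    fix j
    show "norm ((1 + of_real (x j) * (\<i> * of_real \<eta>)) * exp (- (of_real (x j) * (\<i> * of_real \<eta>))
        + (of_real (x j) * (\<i> * of_real \<eta>))^2 / 2)) \<le> exp (- ((x j * \<eta>)^4 / (16 * (1 + (x j * \<eta>)^2))))"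
      using norm_gauss_factor_imag_le[of "x j * \<eta>"] by (simp only: of_real_mult mult.left_commute)
  qed
  also have "\<dots> = exp (- (\<Sum>j<n. (x j * \<eta>)^4 / (16 * (1 + (x j * \<eta>)^2))))"
    by (simp add: exp_sum[symmetric] sum_negf)
  also have "\<dots> \<le> exp (- (\<eta>^4 / (32 * (1 + \<beta>^2 * \<eta>^2))))"
    using quartic_sum_ge[of \<eta>] by simp
  finally have a: "norm (Gf (\<i> * of_real \<eta>)) \<le> exp (- (\<eta>^4 / (32 * (1 + \<beta>^2 * \<eta>^2))))" .
  have "norm (exp (Ef \<sigma> \<nu> (\<i> * of_real \<eta>))) \<le> exp (norm (Ef \<sigma> \<nu> (\<i> * of_real \<eta>)))"
    by (rule norm_exp)
  also have "\<dots> \<le> exp ((1 + B) * (\<bar>\<eta>\<bar> + \<bar>\<eta>\<bar>^2))"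
    using norm_Ef_le[OF assms, of "\<i> * of_real \<eta>"] by (simp add: norm_mult)
  finally have b: "norm (exp (Ef \<sigma> \<nu> (\<i> * of_real \<eta>))) \<le> exp ((1 + B) * (\<bar>\<eta>\<bar> + \<bar>\<eta>\<bar>^2))" .
  show ?thesis unfolding Zfun_eq norm_mult decay_def exp_add
    using mult_mono[OF a b] by simp
qed

lemma norm_inverse_Zfun_ray_le:
  assumes "dir d" "\<bar>\<sigma>\<bar> \<le> B" "\<bar>\<nu>\<bar> \<le> B"
  shows "norm (1 / Zfun n x A1 A2 \<sigma> \<nu> (of_real r * d)) \<le> decay \<beta> (1 + B) \<bar>r\<bar>"
proof -
  have "exp (r^4 / (32 * (1 + \<beta>^2 * r^2))) \<le> exp (\<Sum>j<n. (x j * r)^4 / (16 * (1 + (x j * r)^2)))"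
    using quartic_sum_ge[of r] by simp
  also have "\<dots> = (\<Prod>j<n. exp ((x j * r)^4 / (16 * (1 + (x j * r)^2))))"
    by (simp add: exp_sum)
  also have "\<dots> \<le> norm (Gf (of_real r * d))"
    unfolding Gf_def prod_norm[symmetric]
  proof (intro prod_mono conjI)
    fix j
    show "exp ((x j * r)^4 / (16 * (1 + (x j * r)^2))) \<le> norm ((1 + of_real (x j) * (of_real r * d)) *
        exp (- (of_real (x j) * (of_real r * d)) + (of_real (x j) * (of_real r * d))^2 / 2))"
      using norm_gauss_factor_ray_ge[OF assms(1), of "x j * r"] by (simp only: of_real_mult mult.assoc)
  qed simp
  finally have a: "exp (r^4 / (32 * (1 + \<beta>^2 * r^2))) \<le> norm (Gf (of_real r * d))" .
  have a': "inverse (norm (Gf (of_real r * d))) \<le> exp (- (r^4 / (32 * (1 + \<beta>^2 * r^2))))"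
    unfolding exp_minus by (rule le_imp_inverse_le[OF a]) simp
  have "norm (exp (- Ef \<sigma> \<nu> (of_real r * d))) \<le> exp (norm (- Ef \<sigma> \<nu> (of_real r * d)))"
    by (rule norm_exp)
  also have "\<dots> \<le> exp ((1 + B) * (\<bar>r\<bar> + \<bar>r\<bar>^2))"
    using norm_Ef_le[OF assms(2,3), of "of_real r * d"] dir_facts(1)[OF assms(1)] by (simp add: norm_mult)
  finally have b: "norm (exp (- Ef \<sigma> \<nu> (of_real r * d))) \<le> exp ((1 + B) * (\<bar>r\<bar> + \<bar>r\<bar>^2))" .
  have "1 / Zfun n x A1 A2 \<sigma> \<nu> (of_real r * d) = inverse (Gf (of_real r * d)) * exp (- Ef \<sigma> \<nu> (of_real r * d))"
    unfolding Zfun_eq by (simp add: exp_minus divide_inverse)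
  then show ?thesis unfolding norm_mult norm_inverse decay_def exp_add
    using mult_mono[OF a' b] by (simp add: norm_mult norm_inverse)
qed

text \<open>All \<bar>x j \<zeta>\<bar> are at most 1/2, so every factor has a principal logarithm
  close to its quartic Taylor polynomial. Summed over j, the four Taylor terms are the power sums,
  whose deviations are O(\<beta>). The factor exp(norm \<zeta>) merely stands for a polynomial of
  degree 5.\<close>

lemma Zfun_exp_form:
  assumes le: "\<beta> * norm \<zeta> \<le> 1/2"
    and "\<bar>\<sigma> - \<tau>\<bar> \<le> C * \<beta>" "\<bar>\<nu> - v\<bar> \<le> C * \<beta>"
  obtains L L' where "Zfun n x A1 A2 \<sigma> \<nu> \<zeta> = exp L" "Pfun \<tau> v \<zeta> = exp L'"
    "norm (L - L') \<le> 306 * C * \<beta> * exp (norm \<zeta>)"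
proof -
  define T where "T = (\<lambda>y::complex. y - y^2/2 + y^3/3 - y^4/4)"
  define Y where "Y = (\<lambda>j. of_real (x j) * \<zeta>)"
  have Y: "norm (Y j) \<le> 1/2" if "j < n" for j
    using mult_right_mono[OF x_le[OF that], of "norm \<zeta>"] le by (simp add: Y_def norm_mult)
  have ne: "1 + Y j \<noteq> 0" if "j < n" for j
  proof
    assume "1 + Y j = 0"
    then have "Y j = - 1" by (simp add: eq_neg_iff_add_eq_0 add.commute)
    then show False using Y[OF that] by simp
  qed
  define L where "L = (\<Sum>j<n. Ln (1 + Y j)) + (- of_real A1 * \<zeta> + of_real A2 * \<zeta>^2 / 2 - of_real \<sigma> * \<zeta>^2 / 2 - of_real \<nu> * \<zeta>)"
  define L' where "L' = - (\<zeta>^4) / 4 - of_real \<tau> * \<zeta>^2 / 2 - of_real v * \<zeta>"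
  have 1: "Zfun n x A1 A2 \<sigma> \<nu> \<zeta> = exp L"
    unfolding Zfun_def L_def exp_add exp_sum[OF finite_lessThan]
    using ne by (auto simp: Y_def intro!: prod.cong)
  have 2: "Pfun \<tau> v \<zeta> = exp L'" by (simp add: Pfun_def L'_def)
  have sT: "(\<Sum>j<n. T (Y j)) = of_real (\<Sum>j<n. x j) * \<zeta> - of_real (\<Sum>j<n. x j^2) * \<zeta>^2/2
      + of_real (\<Sum>j<n. x j^3) * \<zeta>^3/3 - of_real (\<Sum>j<n. x j^4) * \<zeta>^4/4"
    by (simp add: T_def Y_def sum.distrib sum_subtractf sum_distrib_right sum_divide_distrib power_mult_distrib)
  have eq: "L - L' = (\<Sum>j<n. Ln (1 + Y j) - T (Y j)) + of_real ((\<Sum>j<n. x j) - A1) * \<zeta>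
      - of_real ((\<Sum>j<n. x j^2) - A2) * \<zeta>^2/2 + of_real (\<Sum>j<n. x j^3) * \<zeta>^3/3
      - of_real ((\<Sum>j<n. x j^4) - 1) * \<zeta>^4/4 - of_real (\<sigma> - \<tau>) * \<zeta>^2/2 - of_real (\<nu> - v) * \<zeta>"
    unfolding sum_subtractf sT L_def L'_def
    by (simp add: algebra_simps diff_divide_distrib)
  let ?r = "norm \<zeta>"
  have "norm (L - L') \<le> norm (\<Sum>j<n. Ln (1 + Y j) - T (Y j)) + norm (of_real ((\<Sum>j<n. x j) - A1) * \<zeta>)
      + norm (of_real ((\<Sum>j<n. x j^2) - A2) * \<zeta>^2/2) + norm (of_real (\<Sum>j<n. x j^3) * \<zeta>^3/3)
      + norm (of_real ((\<Sum>j<n. x j^4) - 1) * \<zeta>^4/4) + norm (of_real (\<sigma> - \<tau>) * \<zeta>^2/2) + norm (of_real (\<nu> - v) * \<zeta>)"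
    unfolding eq by (intro order.trans[OF norm_triangle_ineq4] order.trans[OF norm_triangle_ineq] add_mono order.refl)
  also have "\<dots> = norm (\<Sum>j<n. Ln (1 + Y j) - T (Y j)) + \<bar>(\<Sum>j<n. x j) - A1\<bar> * ?r
      + \<bar>(\<Sum>j<n. x j^2) - A2\<bar> * ?r^2/2 + \<bar>\<Sum>j<n. x j^3\<bar> * ?r^3/3
      + \<bar>(\<Sum>j<n. x j^4) - 1\<bar> * ?r^4/4 + \<bar>\<sigma> - \<tau>\<bar> * ?r^2/2 + \<bar>\<nu> - v\<bar> * ?r"
    unfolding norm_mult norm_divide norm_power norm_of_real by simp
  also have "\<dots> \<le> 2 * \<beta> * ?r^5 + C * \<beta> * ?r + C * \<beta> * ?r^2/2 + C * \<beta> * ?r^3/3 + C * \<beta> * ?r^4/4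
       + C * \<beta> * ?r^2/2 + C * \<beta> * ?r"
  proof -
    have "norm (\<Sum>j<n. Ln (1 + Y j) - T (Y j)) \<le> (\<Sum>j<n. norm (Y j) ^ 5)"
      using Y Ln_one_plus_fourth_order unfolding T_def by (intro sum_norm_le) auto
    \<comment> \<open>One of the five powers is bounded by \<beta>, the other four sum to at most 2:
      this makes the remainder O(\<beta>) independently of the number of points.\<close>
    also have "\<dots> = (\<Sum>j<n. \<bar>x j\<bar> * (x j ^ 4 * ?r^5))"
      proof (intro sum.cong refl)
      fix j
      have "\<bar>x j\<bar>^5 = \<bar>x j\<bar> * x j ^ 4" using power_add[of "\<bar>x j\<bar>" 1 4] by simp
      then show "norm (Y j) ^ 5 = \<bar>x j\<bar> * (x j ^ 4 * ?r^5)"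
        unfolding Y_def norm_mult power_mult_distrib norm_of_real by (simp only: mult.assoc)
    qed
    also have "\<dots> \<le> (\<Sum>j<n. \<beta> * (x j ^ 4 * ?r^5))"
      using x_le by (intro sum_mono mult_right_mono) auto
    also have "\<dots> = \<beta> * (?r^5 * (\<Sum>j<n. x j ^ 4))" by (simp add: sum_distrib_left mult_ac)
    also have "\<dots> \<le> \<beta> * (?r^5 * 2)" using beta sum4_le by (intro mult_left_mono) auto
    finally have "norm (\<Sum>j<n. Ln (1 + Y j) - T (Y j)) \<le> 2 * \<beta> * ?r^5" by (simp add: mult_ac)
    then show ?thesis using assms S1 S2 S3 S4
      by (intro add_mono divide_right_mono mult_right_mono) auto
  qed
  also have "\<dots> \<le> 2 * C * \<beta> * (?r + ?r^2 + ?r^3 + ?r^4 + ?r^5)"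
  proof -
    have "2 * \<beta> * ?r^5 \<le> 2 * (C * \<beta>) * ?r^5" using C beta by (intro mult_right_mono mult_left_mono) auto
    moreover have "0 \<le> C * \<beta> * ?r^2" "0 \<le> C * \<beta> * ?r^3" "0 \<le> C * \<beta> * ?r^4" using C beta by auto
    ultimately show ?thesis by (simp add: algebra_simps)
  qed
  also have "\<dots> \<le> 2 * C * \<beta> * (153 * exp ?r)"
  proof (rule mult_left_mono)
    \<comment> \<open>153 = 1! + 2! + 3! + 4! + 5!.\<close>
    show "?r + ?r^2 + ?r^3 + ?r^4 + ?r^5 \<le> 153 * exp ?r"
    proof -
      have f: "fact 2 = (2::real)" "fact 3 = (6::real)" "fact 4 = (24::real)" "fact 5 = (120::real)"
        by (simp_all add: fact_numeral)
      then show ?thesis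
        using power_le_fact_exp[of ?r 1] power_le_fact_exp[of ?r 2] power_le_fact_exp[of ?r 3]
        power_le_fact_exp[of ?r 4] power_le_fact_exp[of ?r 5] norm_ge_zero[of \<zeta>]
        unfolding f power_one_right fact_1 by linarith
    qed
  qed (use C beta in auto)
  finally have 3: "norm (L - L') \<le> 306 * C * \<beta> * exp ?r" by simp
  show ?thesis using that 1 2 3 by blast
qed

text \<open>Beyond the range of the Taylor expansion one has 1 < 2\<beta>\<rho>, so the trivial
  bound 2m for the difference is already O(\<beta>\<rho>).\<close>

lemma large_case:
  assumes "\<not> \<beta> * \<rho> \<le> 1/2" "norm a \<le> m" "norm b \<le> m" "\<rho> \<ge> 0"
  shows "norm (a - b) \<le> m * (306 * C * \<beta> * exp \<rho>)"
proof -
  have m: "m \<ge> 0" using assms(2) norm_ge_zero order.trans by blast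
  have "norm (a - b) \<le> 2 * m" using assms norm_triangle_ineq4[of a b] by linarith
  also have "\<dots> \<le> m * (4 * \<beta> * \<rho>)" using assms m mult_left_mono[of 1 "2 * \<beta> * \<rho>" "2 * m"] by (simp add: algebra_simps)
  also have "\<dots> \<le> m * (306 * C * \<beta> * exp \<rho>)"
  proof (rule mult_left_mono[OF _ m])
    have "4 * \<beta> * \<rho> \<le> 306 * C * \<beta> * \<rho>"
      using C beta assms by (intro mult_right_mono) auto
    also have "\<dots> \<le> 306 * C * \<beta> * exp \<rho>"
      using C beta order.trans[OF _ exp_ge_add_one_self[of \<rho>], of \<rho>] by (intro mult_left_mono) auto
    finally show "4 * \<beta> * \<rho> \<le> 306 * C * \<beta> * exp \<rho>" .
  qed
  finally show ?thesis .
qed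

lemma norm_diff_imag_le:
  assumes "\<bar>\<sigma>\<bar> \<le> B" "\<bar>\<nu>\<bar> \<le> B" "\<bar>\<tau>\<bar> \<le> B" and c: "\<bar>\<sigma> - \<tau>\<bar> \<le> C * \<beta>" "\<bar>\<nu> - v\<bar> \<le> C * \<beta>"
  shows "norm (Zfun n x A1 A2 \<sigma> \<nu> (\<i> * of_real \<eta>) - Pfun \<tau> v (\<i> * of_real \<eta>))
    \<le> decay \<beta> (1 + B) \<bar>\<eta>\<bar> * (306 * C * \<beta> * exp \<bar>\<eta>\<bar>)"
proof (cases "\<beta> * \<bar>\<eta>\<bar> \<le> 1/2")
  case True
  then have "\<beta> * norm (\<i> * complex_of_real \<eta>) \<le> 1/2" by (simp add: norm_mult)
  from Zfun_exp_form[OF this c] obtain L L' where L: "Zfun n x A1 A2 \<sigma> \<nu> (\<i> * of_real \<eta>) = exp L"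
      "Pfun \<tau> v (\<i> * of_real \<eta>) = exp L'" "norm (L - L') \<le> 306 * C * \<beta> * exp (norm (\<i> * complex_of_real \<eta>))" by blast
  have "norm (exp L - exp L') \<le> decay \<beta> (1 + B) \<bar>\<eta>\<bar> * norm (L - L')"
    using norm_Zfun_imag_le[OF assms(1,2), of \<eta>] norm_Pfun_imag_le[OF assms(3), of v \<eta> \<beta>] L
    by (intro norm_exp_diff_le) auto
  also have "\<dots> \<le> decay \<beta> (1 + B) \<bar>\<eta>\<bar> * (306 * C * \<beta> * exp \<bar>\<eta>\<bar>)"
    using L(3) by (intro mult_left_mono) (auto simp: decay_def norm_mult)
  finally show ?thesis using L by simp
next
  case False
  then show ?thesis using norm_Zfun_imag_le[OF assms(1,2), of \<eta>] norm_Pfun_imag_le[OF assms(3), of v \<eta> \<beta>]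
    by (intro large_case) auto
qed

lemma norm_diff_ray_le:
  assumes d: "dir d" and "\<bar>\<sigma>\<bar> \<le> B" "\<bar>\<nu>\<bar> \<le> B" "\<bar>\<tau>\<bar> \<le> B" "\<bar>v\<bar> \<le> B"
    and c: "\<bar>\<sigma> - \<tau>\<bar> \<le> C * \<beta>" "\<bar>\<nu> - v\<bar> \<le> C * \<beta>"
  shows "norm (1 / Zfun n x A1 A2 \<sigma> \<nu> (of_real r * d) - 1 / Pfun \<tau> v (of_real r * d))
    \<le> decay \<beta> (1 + B) \<bar>r\<bar> * (306 * C * \<beta> * exp \<bar>r\<bar>)"
proof (cases "\<beta> * \<bar>r\<bar> \<le> 1/2")
  case True
  then have "\<beta> * norm (complex_of_real r * d) \<le> 1/2" using dir_facts(1)[OF d] by (simp add: norm_mult)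
  from Zfun_exp_form[OF this c] obtain L L' where L: "Zfun n x A1 A2 \<sigma> \<nu> (of_real r * d) = exp L"
      "Pfun \<tau> v (of_real r * d) = exp L'" "norm (L - L') \<le> 306 * C * \<beta> * exp (norm (complex_of_real r * d))" by blast
  have "norm (exp (- L) - exp (- L')) \<le> decay \<beta> (1 + B) \<bar>r\<bar> * norm (- L - - L')"
    using norm_inverse_Zfun_ray_le[OF assms(1-3), of r] norm_inverse_Pfun_ray_le[OF assms(1,4,5), of r \<beta>] L
    by (intro norm_exp_diff_le) (auto simp: exp_minus divide_inverse)
  also have "\<dots> \<le> decay \<beta> (1 + B) \<bar>r\<bar> * (306 * C * \<beta> * exp \<bar>r\<bar>)"
    using L(3) dir_facts(1)[OF d] by (intro mult_left_mono) (auto simp: decay_def norm_mult norm_minus_commute)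
  finally show ?thesis using L by (simp add: exp_minus divide_inverse)
next
  case False
  then show ?thesis using norm_inverse_Zfun_ray_le[OF assms(1-3), of r] norm_inverse_Pfun_ray_le[OF assms(1,4,5), of r \<beta>]
    by (intro large_case) auto
qed

definition Kc :: "real \<Rightarrow> real" where
  "Kc B = 306 * C * exp (64 * (B + 3)^2 + 2 * (B + 3))"

lemma Zfun_comparison:
  assumes B: "B \<ge> 0" "128 * (B + 3) * \<beta>^2 \<le> 1"
    and b: "\<bar>\<sigma>\<bar> \<le> B" "\<bar>\<nu>\<bar> \<le> B" "\<bar>\<tau>\<bar> \<le> B" "\<bar>v\<bar> \<le> B" and c: "\<bar>\<sigma> - \<tau>\<bar> \<le> C * \<beta>" "\<bar>\<nu> - v\<bar> \<le> C * \<beta>"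
  shows "norm (Zfun n x A1 A2 \<sigma> \<nu> (\<i> * of_real \<eta>)) \<le> Kc B * exp (- \<bar>\<eta>\<bar>)"
    and "norm (Pfun \<tau> v (\<i> * of_real \<eta>)) \<le> Kc B * exp (- \<bar>\<eta>\<bar>)"
    and "norm (Zfun n x A1 A2 \<sigma> \<nu> (\<i> * of_real \<eta>) - Pfun \<tau> v (\<i> * of_real \<eta>)) \<le> Kc B * \<beta> * exp (- \<bar>\<eta>\<bar>)"
    and "dir d \<Longrightarrow> norm (1 / Zfun n x A1 A2 \<sigma> \<nu> (of_real r * d)) \<le> Kc B * exp (- \<bar>r\<bar>)"
    and "dir d \<Longrightarrow> norm (1 / Pfun \<tau> v (of_real r * d)) \<le> Kc B * exp (- \<bar>r\<bar>)"
    and "dir d \<Longrightarrow> norm (1 / Zfun n x A1 A2 \<sigma> \<nu> (of_real r * d) - 1 / Pfun \<tau> v (of_real r * d)) \<le> Kc B * \<beta> * exp (- \<bar>r\<bar>)"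
proof -
  have dec: "decay \<beta> (1 + B) \<rho> \<le> exp (64 * (B + 3)^2 + 2 * (B + 3)) * exp (- 2 * \<rho>)" if "\<rho> \<ge> 0" for \<rho>
    using decay_le[of \<rho> "1 + B" \<beta>] that B beta by (simp add: algebra_simps)
  have d1: "decay \<beta> (1 + B) \<rho> \<le> Kc B * exp (- \<rho>)" if "\<rho> \<ge> 0" for \<rho>
  proof -
    have "exp (64 * (B + 3)^2 + 2 * (B + 3)) * exp (- 2 * \<rho>) \<le> Kc B * exp (- \<rho>)"
      unfolding Kc_def using that C by (intro mult_mono) auto
    then show ?thesis using dec[OF that] by linarith
  qed
  have d2: "decay \<beta> (1 + B) \<rho> * (306 * C * \<beta> * exp \<rho>) \<le> Kc B * \<beta> * exp (- \<rho>)" if "\<rho> \<ge> 0" for \<rho>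
  proof -
    have "decay \<beta> (1 + B) \<rho> * (306 * C * \<beta> * exp \<rho>)
       \<le> exp (64 * (B + 3)^2 + 2 * (B + 3)) * exp (- 2 * \<rho>) * (306 * C * \<beta> * exp \<rho>)"
      using dec[OF that] C beta by (intro mult_right_mono) auto
    also have "\<dots> = Kc B * \<beta> * (exp (- 2 * \<rho>) * exp \<rho>)" unfolding Kc_def by (simp only: mult_ac)
    also have "exp (- 2 * \<rho>) * exp \<rho> = exp (- \<rho>)" by (simp add: exp_add[symmetric])
    finally show ?thesis .
  qed
  note le = order.trans[OF _ d1[OF abs_ge_zero]] and le2 = order.trans[OF _ d2[OF abs_ge_zero]]
  show "norm (Zfun n x A1 A2 \<sigma> \<nu> (\<i> * of_real \<eta>)) \<le> Kc B * exp (- \<bar>\<eta>\<bar>)"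
    by (rule le[OF norm_Zfun_imag_le[OF b(1,2)]])
  show "norm (Pfun \<tau> v (\<i> * of_real \<eta>)) \<le> Kc B * exp (- \<bar>\<eta>\<bar>)"
    by (rule le[OF norm_Pfun_imag_le[OF b(3)]])
  show "norm (Zfun n x A1 A2 \<sigma> \<nu> (\<i> * of_real \<eta>) - Pfun \<tau> v (\<i> * of_real \<eta>)) \<le> Kc B * \<beta> * exp (- \<bar>\<eta>\<bar>)"
    by (rule le2[OF norm_diff_imag_le[OF b(1-3) c]])
  show "norm (1 / Zfun n x A1 A2 \<sigma> \<nu> (of_real r * d)) \<le> Kc B * exp (- \<bar>r\<bar>)" if "dir d"
    by (rule le[OF norm_inverse_Zfun_ray_le[OF that b(1,2)]])
  show "norm (1 / Pfun \<tau> v (of_real r * d)) \<le> Kc B * exp (- \<bar>r\<bar>)" if "dir d"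
    by (rule le[OF norm_inverse_Pfun_ray_le[OF that b(3,4)]])
  show "norm (1 / Zfun n x A1 A2 \<sigma> \<nu> (of_real r * d) - 1 / Pfun \<tau> v (of_real r * d)) \<le> Kc B * \<beta> * exp (- \<bar>r\<bar>)" if "dir d"
    by (rule le2[OF norm_diff_ray_le[OF that b c]])
qed

end

subsection \<open>Comparison of inverse moments\<close>

text \<open>\<open>inv_power k t\<close> is, for \<open>t > 0\<close>, the integral of \<open>tail_weight k\<close> over \<open>{t..}\<close>, so moments are integrals of distribution functions.\<close>
definition inv_power :: "nat \<Rightarrow> real \<Rightarrow> real" where
  "inv_power k t = (if t > 0 then 1 / t ^ k else 0)"

definition tail_weight :: "nat \<Rightarrow> real \<Rightarrow> real" where
  "tail_weight k r = (if r > 0 then real k / r ^ (k + 1) else 0)"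

lemma inv_power_nonneg: "inv_power k t \<ge> 0" and tail_weight_nonneg: "tail_weight k r \<ge> 0"
  by (simp_all add: inv_power_def tail_weight_def)

lemma borel_tail_weight [measurable]: "tail_weight k \<in> borel_measurable borel"
  and borel_inv_power [measurable]: "inv_power k \<in> borel_measurable borel"
  unfolding tail_weight_def[abs_def] inv_power_def[abs_def] by measurable

lemma nn_integral_tail_weight:
  assumes t: "t > 0" and k: "k \<ge> 1"
  shows "(\<integral>\<^sup>+ r. ennreal (tail_weight k r) * indicator {t..} r \<partial>lborel) = ennreal (1 / t ^ k)"
proof -
  have "(\<integral>\<^sup>+ r. ennreal (tail_weight k r) * indicator {t..} r \<partial>lborel) = ennreal (0 - (- (1 / t ^ k)))"
  proof (rule nn_integral_FTC_atLeast)
    show "tail_weight k \<in> borel_measurable borel" by simp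
    show "((\<lambda>r. - (1 / r ^ k)) has_real_derivative tail_weight k r) (at r)" if "t \<le> r" for r
    proof -
      have r: "r > 0" using that t by simp
      obtain m where m: "k = Suc m" using k by (cases k) auto
      have mm: "real m * r ^ (m - Suc 0) * r = real m * r ^ m" by (cases m) auto
      have "((\<lambda>r. - (1 / r ^ k)) has_real_derivative real k / r ^ (k + 1)) (at r)"
        using r by (auto intro!: derivative_eq_intros simp: m mm) (simp add: field_simps)
      then show ?thesis using r by (simp add: tail_weight_def)
    qed
    show "0 \<le> tail_weight k r" for r by (rule tail_weight_nonneg)
    have "((\<lambda>r::real. inverse (r ^ k)) \<longlongrightarrow> 0) at_top"
      by (rule tendsto_inverse_0_at_top[OF filterlim_pow_at_top[OF _ filterlim_ident]]) (use k in simp)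
    then have "((\<lambda>r::real. - inverse (r ^ k)) \<longlongrightarrow> - 0) at_top" by (rule tendsto_minus)
    then show "((\<lambda>r::real. - (1 / r ^ k)) \<longlongrightarrow> 0) at_top" by (simp add: divide_inverse)
  qed
  then show ?thesis by simp
qed

text \<open>The flag selects the closed or the open end: with half-open intervals \<open>{x<..y}\<close> on the distribution-function side,
  the two sides of \<open>xs\<close> require different ends.\<close>
definition near_set :: "bool \<Rightarrow> real \<Rightarrow> real \<Rightarrow> bool" where
  "near_set b t r \<longleftrightarrow> 0 < t \<and> (t < r \<or> (b \<and> t = r))"

text \<open>Tonelli, after writing the inverse power as an integral over radii. It holds for either
  flag, because the two versions of \<open>near_set\<close> differ only at r = t, a null set of
  radii.\<close>

lemma layer_cake_inv_power:
  fixes Y :: "'a \<Rightarrow> real"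
  assumes N: "prob_space N" and Y[measurable]: "Y \<in> borel_measurable N" and k: "k \<ge> 1"
  shows "(\<integral>\<^sup>+ s. ennreal (inv_power k (Y s)) \<partial>N)
     = (\<integral>\<^sup>+ r. ennreal (tail_weight k r * measure N {s \<in> space N. near_set b (Y s) r}) \<partial>lborel)"
proof -
  interpret prob_space N by (rule N)
  interpret P: pair_sigma_finite N lborel by standard
  have pw: "ennreal (inv_power k t) = (\<integral>\<^sup>+ r. ennreal (tail_weight k r) * indicator {r. near_set b t r} r \<partial>lborel)" for t
  proof (cases "t > 0")
    case True
    have "AE r in lborel. ennreal (tail_weight k r) * indicator {t..} r = ennreal (tail_weight k r) * indicator {r. near_set b t r} r"
    proof (rule AE_mp[OF AE_lborel_singleton[of t]], rule AE_I2, rule impI)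
      fix r :: real assume "r \<noteq> t"
      then have "r \<in> {t..} \<longleftrightarrow> r \<in> {r. near_set b t r}" using True by (auto simp: near_set_def)
      then show "ennreal (tail_weight k r) * indicator {t..} r = ennreal (tail_weight k r) * indicator {r. near_set b t r} r"
        by (simp only: indicator_def)
    qed
    then have "(\<integral>\<^sup>+ r. ennreal (tail_weight k r) * indicator {t..} r \<partial>lborel)
       = (\<integral>\<^sup>+ r. ennreal (tail_weight k r) * indicator {r. near_set b t r} r \<partial>lborel)"
      by (rule nn_integral_cong_AE)
    then show ?thesis using nn_integral_tail_weight[OF True k] True by (simp add: inv_power_def)
  next
    case False
    then show ?thesis by (simp add: inv_power_def near_set_def)
  qed
  have m: "(\<lambda>(s, r). ennreal (tail_weight k r) * indicator {r. near_set b (Y s) r} r) \<in> borel_measurable (N \<Otimes>\<^sub>M lborel)"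
    unfolding near_set_def indicator_def by measurable
  have "(\<integral>\<^sup>+ s. ennreal (inv_power k (Y s)) \<partial>N)
     = (\<integral>\<^sup>+ s. (\<integral>\<^sup>+ r. ennreal (tail_weight k r) * indicator {r. near_set b (Y s) r} r \<partial>lborel) \<partial>N)"
    by (simp only: pw)
  also have "\<dots> = (\<integral>\<^sup>+ r. (\<integral>\<^sup>+ s. ennreal (tail_weight k r) * indicator {r. near_set b (Y s) r} r \<partial>N) \<partial>lborel)"
    by (rule P.Fubini'[OF m, symmetric])
  also have "\<dots> = (\<integral>\<^sup>+ r. ennreal (tail_weight k r * measure N {s \<in> space N. near_set b (Y s) r}) \<partial>lborel)"
  proof (rule nn_integral_cong)
    fix r :: real
    have ms: "{s \<in> space N. near_set b (Y s) r} \<in> sets N" unfolding near_set_def by measurable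
    have "(\<integral>\<^sup>+ s. ennreal (tail_weight k r) * indicator {r. near_set b (Y s) r} r \<partial>N)
      = (\<integral>\<^sup>+ s. ennreal (tail_weight k r) * indicator {s \<in> space N. near_set b (Y s) r} s \<partial>N)"
      by (intro nn_integral_cong) (simp add: indicator_def)
    also have "\<dots> = ennreal (tail_weight k r) * emeasure N {s \<in> space N. near_set b (Y s) r}"
      by (rule nn_integral_cmult_indicator[OF ms])
    also have "\<dots> = ennreal (tail_weight k r * measure N {s \<in> space N. near_set b (Y s) r})"
      by (simp add: emeasure_eq_measure ennreal_mult tail_weight_nonneg)
    finally show "(\<integral>\<^sup>+ s. ennreal (tail_weight k r) * indicator {r. near_set b (Y s) r} r \<partial>N)
      = ennreal (tail_weight k r * measure N {s \<in> space N. near_set b (Y s) r})" .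
  qed
  finally show ?thesis .
qed

text \<open>The integrand is a multiple of r^(\<kappa> - k), integrable at 0 for all k \<le> 4
  precisely because \<kappa> > 3; the constant 4/(\<kappa> - 3) is the worst case k = 4.\<close>

lemma nn_integral_tail_weight_powr:
  fixes g \<kappa> D :: real
  assumes g: "g > 0" and k: "1 \<le> k" "k \<le> 4" and kap: "\<kappa> > 3" and D: "D \<ge> 0"
  shows "(\<integral>\<^sup>+ r. ennreal (tail_weight k r * (D * r powr (\<kappa> + 1))) * indicator {0..g} r \<partial>lborel)
     \<le> ennreal (4 * D / (\<kappa> - 3) * g powr (\<kappa> + 1) / g ^ k)"
proof -
  have ex: "\<kappa> - real k > -1" using k kap by linarith
  have eq: "tail_weight k r * (D * r powr (\<kappa> + 1)) = real k * D * r powr (\<kappa> - real k)" if "r \<ge> 0" for r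
  proof (cases "r = 0")
    case False
    then have r: "r > 0" using that by simp
    have "r powr (\<kappa> + 1) = r powr (\<kappa> - real k) * r powr (real (k + 1))"
      by (simp add: powr_add[symmetric])
    then have "r powr (\<kappa> + 1) = r powr (\<kappa> - real k) * r ^ (k + 1)"
      using r by (simp only: powr_realpow)
    then show ?thesis using r by (simp add: tail_weight_def)
  qed (simp add: tail_weight_def)
  have hi: "((\<lambda>r. real k * D * r powr (\<kappa> - real k)) has_integral real k * D * (g powr (\<kappa> - real k + 1) / (\<kappa> - real k + 1))) {0..g}"
    using has_integral_powr_from_0[OF ex, of g] g by (intro has_integral_mult_right) simp
  have "(\<integral>\<^sup>+ r. ennreal (tail_weight k r * (D * r powr (\<kappa> + 1))) * indicator {0..g} r \<partial>lborel)
     = (\<integral>\<^sup>+ r. ennreal (if r \<in> {0..g} then real k * D * r powr (\<kappa> - real k) else 0) \<partial>lborel)"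
    by (intro nn_integral_cong) (auto simp: indicator_def eq)
  also have "\<dots> = ennreal (real k * D * (g powr (\<kappa> - real k + 1) / (\<kappa> - real k + 1)))"
    by (rule nn_integral_has_integral_lborel[OF _ _ iffD2[OF has_integral_restrict_UNIV hi]]) (use D in auto)
  also have "\<dots> \<le> ennreal (4 * D / (\<kappa> - 3) * g powr (\<kappa> + 1) / g ^ k)"
  proof (rule ennreal_leI)
    have "g powr (\<kappa> + 1) = g powr (\<kappa> - real k + 1) * g powr (real k)" by (simp add: powr_add[symmetric])
    then have p: "g powr (\<kappa> + 1) / g ^ k = g powr (\<kappa> - real k + 1)" using g by (simp add: powr_realpow)
    have "real k * D * (g powr (\<kappa> - real k + 1) / (\<kappa> - real k + 1)) = real k / (\<kappa> - real k + 1) * (D * g powr (\<kappa> - real k + 1))"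
      by simp
    also have "\<dots> \<le> 4 / (\<kappa> - 3) * (D * g powr (\<kappa> - real k + 1))"
      using k kap D by (intro mult_right_mono frac_le) auto
    also have "\<dots> = 4 * D / (\<kappa> - 3) * g powr (\<kappa> + 1) / g ^ k" unfolding p[symmetric] by simp
    finally show "real k * D * (g powr (\<kappa> - real k + 1) / (\<kappa> - real k + 1)) \<le> 4 * D / (\<kappa> - 3) * g powr (\<kappa> + 1) / g ^ k" .
  qed
  finally show ?thesis .
qed

text \<open>\<open>N1\<close> stands for the empirical measure, with no mass within distance g, and
  \<open>N2\<close> for its limit. By the layer-cake formula radii above g contribute the
  discrepancy \<epsilon> integrated to \<epsilon> / g^k, while below g only \<open>N2\<close>
  contributes, through its small mass there. Working with nonnegative integrals allows
  \<open>I2\<close> to be infinite a priori; its finiteness is a consequence.\<close>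

lemma one_sided_moment_comparison:
  fixes Y1 :: "'a \<Rightarrow> real" and Y2 :: "'b \<Rightarrow> real" and g \<kappa> D \<epsilon> :: real
  assumes N1: "prob_space N1" and Y1: "Y1 \<in> borel_measurable N1"
    and N2: "prob_space N2" and Y2: "Y2 \<in> borel_measurable N2"
    and g: "g > 0" and k: "1 \<le> k" "k \<le> 4" and kap: "\<kappa> > 3" and D: "D \<ge> 0" and eps: "\<epsilon> \<ge> 0"
    and H1: "\<And>r. r > 0 \<Longrightarrow> \<bar>measure N1 {s \<in> space N1. near_set b (Y1 s) r} - measure N2 {s \<in> space N2. near_set b (Y2 s) r}\<bar> \<le> \<epsilon>"
    and H2: "\<And>r. 0 < r \<Longrightarrow> r < g \<Longrightarrow> measure N1 {s \<in> space N1. near_set b (Y1 s) r} = 0"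
    and H3: "\<And>r. 0 < r \<Longrightarrow> r < g \<Longrightarrow> measure N2 {s \<in> space N2. near_set b (Y2 s) r} \<le> D * r powr (\<kappa> + 1)"
  defines "I1 \<equiv> \<integral>\<^sup>+ s. ennreal (inv_power k (Y1 s)) \<partial>N1" and "I2 \<equiv> \<integral>\<^sup>+ s. ennreal (inv_power k (Y2 s)) \<partial>N2"
  shows "I1 \<le> I2 + ennreal (\<epsilon> / g ^ k)"
    and "I2 \<le> I1 + ennreal (\<epsilon> / g ^ k + 4 * D / (\<kappa> - 3) * g powr (\<kappa> + 1) / g ^ k)"
proof -
  define G1 where "G1 = (\<lambda>r. measure N1 {s \<in> space N1. near_set b (Y1 s) r})"
  define G2 where "G2 = (\<lambda>r. measure N2 {s \<in> space N2. near_set b (Y2 s) r})"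
  interpret A: prob_space N1 by (rule N1)
  interpret B: prob_space N2 by (rule N2)
  have g0: "G1 r \<ge> 0" "G2 r \<ge> 0" for r by (simp_all add: G1_def G2_def)
  have m1: "G1 \<in> borel_measurable lborel" and m2: "G2 \<in> borel_measurable lborel"
  proof -
    have mono: "mono G1" "mono G2" unfolding G1_def G2_def
      by (auto intro!: monoI A.finite_measure_mono B.finite_measure_mono simp: near_set_def Y1 Y2 intro!: sets.sets_Collect borel_measurable_less borel_measurable_eq)
        (use Y1 Y2 in measurable)
    then show "G1 \<in> borel_measurable lborel" "G2 \<in> borel_measurable lborel" by (auto intro: borel_measurable_mono)
  qed
  have I1: "I1 = (\<integral>\<^sup>+ r. ennreal (tail_weight k r * G1 r) \<partial>lborel)"
    unfolding I1_def G1_def by (rule layer_cake_inv_power[OF N1 Y1 k(1)])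
  have I2: "I2 = (\<integral>\<^sup>+ r. ennreal (tail_weight k r * G2 r) \<partial>lborel)"
    unfolding I2_def G2_def by (rule layer_cake_inv_power[OF N2 Y2 k(1)])
  have W: "(\<integral>\<^sup>+ r. ennreal (tail_weight k r * \<epsilon>) * indicator {g..} r \<partial>lborel) = ennreal (\<epsilon> / g ^ k)"
  proof -
    have "(\<integral>\<^sup>+ r. ennreal (tail_weight k r * \<epsilon>) * indicator {g..} r \<partial>lborel)
       = (\<integral>\<^sup>+ r. ennreal \<epsilon> * (ennreal (tail_weight k r) * indicator {g..} r) \<partial>lborel)"
      using eps by (intro nn_integral_cong) (simp add: ennreal_mult tail_weight_nonneg mult_ac)
    also have "\<dots> = ennreal \<epsilon> * (\<integral>\<^sup>+ r. ennreal (tail_weight k r) * indicator {g..} r \<partial>lborel)"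
      by (rule nn_integral_cmult) measurable
    also have "\<dots> = ennreal \<epsilon> * ennreal (1 / g ^ k)" by (simp only: nn_integral_tail_weight[OF g k(1)])
    also have "\<dots> = ennreal (\<epsilon> / g ^ k)" using g eps by (simp flip: ennreal_mult)
    finally show ?thesis .
  qed
  have tw0: "tail_weight k r = 0" if "r \<le> 0" for r using that by (simp add: tail_weight_def)
  have "I1 \<le> (\<integral>\<^sup>+ r. ennreal (tail_weight k r * G2 r) + ennreal (tail_weight k r * \<epsilon>) * indicator {g..} r \<partial>lborel)"
    unfolding I1
  proof (rule nn_integral_mono)
    fix r :: real
    consider "r \<le> 0" | "0 < r" "r < g" | "r > 0" "r \<ge> g" by linarith
    then show "ennreal (tail_weight k r * G1 r) \<le> ennreal (tail_weight k r * G2 r) + ennreal (tail_weight k r * \<epsilon>) * indicator {g..} r"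
    proof cases
      case 1
      then show ?thesis by (simp add: tw0)
    next
      case 2
      then show ?thesis using H2[of r] by (simp add: G1_def)
    next
      case 3
      have "G1 r \<le> G2 r + \<epsilon>" using H1[OF 3(1)] unfolding G1_def G2_def by linarith
      then have "tail_weight k r * G1 r \<le> tail_weight k r * G2 r + tail_weight k r * \<epsilon>"
        unfolding distrib_left[symmetric] by (rule mult_left_mono[OF _ tail_weight_nonneg])
      then have "ennreal (tail_weight k r * G1 r) \<le> ennreal (tail_weight k r * G2 r + tail_weight k r * \<epsilon>)" by (rule ennreal_leI)
      then show ?thesis using 3 g0 eps by (simp add: tail_weight_nonneg)
    qed
  qed
  also have "\<dots> = I2 + ennreal (\<epsilon> / g ^ k)"
    unfolding I2 W[symmetric] by (rule nn_integral_add) (use m2 in measurable)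
  finally show "I1 \<le> I2 + ennreal (\<epsilon> / g ^ k)" .
  have "I2 \<le> (\<integral>\<^sup>+ r. ennreal (tail_weight k r * G1 r) + (ennreal (tail_weight k r * \<epsilon>) * indicator {g..} r
       + ennreal (tail_weight k r * (D * r powr (\<kappa> + 1))) * indicator {0..g} r) \<partial>lborel)"
    unfolding I2
  proof (rule nn_integral_mono)
    fix r :: real
    consider "r \<le> 0" | "0 < r" "r < g" | "r > 0" "r \<ge> g" by linarith
    then show "ennreal (tail_weight k r * G2 r) \<le> ennreal (tail_weight k r * G1 r) + (ennreal (tail_weight k r * \<epsilon>) * indicator {g..} r
       + ennreal (tail_weight k r * (D * r powr (\<kappa> + 1))) * indicator {0..g} r)"
    proof cases
      case 1
      then show ?thesis by (simp add: tw0)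
    next
      case 2
      have "tail_weight k r * G2 r \<le> tail_weight k r * (D * r powr (\<kappa> + 1))"
        using H3[OF 2] unfolding G2_def by (rule mult_left_mono[OF _ tail_weight_nonneg])
      then have "ennreal (tail_weight k r * G2 r) \<le> ennreal (tail_weight k r * (D * r powr (\<kappa> + 1))) * indicator {0..g} r"
        using 2 by (simp add: ennreal_leI)
      then show ?thesis by (meson add_increasing zero_le)
    next
      case 3
      have "G2 r \<le> G1 r + \<epsilon>" using H1[OF 3(1)] unfolding G1_def G2_def by linarith
      then have "tail_weight k r * G2 r \<le> tail_weight k r * G1 r + tail_weight k r * \<epsilon>"
        unfolding distrib_left[symmetric] by (rule mult_left_mono[OF _ tail_weight_nonneg])
      then have "ennreal (tail_weight k r * G2 r) \<le> ennreal (tail_weight k r * G1 r + tail_weight k r * \<epsilon>)" by (rule ennreal_leI)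
      also have "\<dots> = ennreal (tail_weight k r * G1 r) + ennreal (tail_weight k r * \<epsilon>) * indicator {g..} r"
        using 3 g0 eps by (simp add: tail_weight_nonneg)
      also have "\<dots> \<le> ennreal (tail_weight k r * G1 r) + (ennreal (tail_weight k r * \<epsilon>) * indicator {g..} r
       + ennreal (tail_weight k r * (D * r powr (\<kappa> + 1))) * indicator {0..g} r)"
        by (intro add_left_mono) simp
      finally show ?thesis .
    qed
  qed
  also have "\<dots> = I1 + (ennreal (\<epsilon> / g ^ k) + (\<integral>\<^sup>+ r. ennreal (tail_weight k r * (D * r powr (\<kappa> + 1))) * indicator {0..g} r \<partial>lborel))"
    unfolding I1 W[symmetric] using m1 by (simp add: nn_integral_add)
  also have "\<dots> \<le> I1 + (ennreal (\<epsilon> / g ^ k) + ennreal (4 * D / (\<kappa> - 3) * g powr (\<kappa> + 1) / g ^ k))"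
    by (intro add_left_mono nn_integral_tail_weight_powr g k kap D)
  also have "\<dots> = I1 + ennreal (\<epsilon> / g ^ k + 4 * D / (\<kappa> - 3) * g powr (\<kappa> + 1) / g ^ k)"
    using eps g D kap by (simp add: ennreal_plus)
  finally show "I2 \<le> I1 + ennreal (\<epsilon> / g ^ k + 4 * D / (\<kappa> - 3) * g powr (\<kappa> + 1) / g ^ k)" .
qed

section \<open>Rate of convergence of the empirical inverse moments\<close>

locale regular_critical_point =
  fixes a :: "nat \<Rightarrow> nat \<Rightarrow> real" and mu :: "real measure" and psi :: "real \<Rightarrow> real" and xs c \<kappa> :: real
  assumes prob: "prob_space mu"
    and dens: "mu = density lborel (\<lambda>x. ennreal (psi x))"
    and meas: "psi \<in> borel_measurable borel"
    and psi_nonneg: "\<And>x. psi x \<ge> 0"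
    and c: "c > 0"
    and asym: "((\<lambda>x. psi x / (c * \<bar>x - xs\<bar> powr \<kappa>)) \<longlongrightarrow> 1) (at xs)"
    and cdf_close: "\<exists>M0 n0. \<forall>n\<ge>n0. \<forall>x. \<bar>emp_cdf a n x - measure mu {..x}\<bar> \<le> M0 / real n"
    and gap: "\<exists>m0>0. \<exists>n0. \<forall>n\<ge>n0. \<forall>j<n. \<bar>a n j - xs\<bar> > m0 * real n powr (- 1 / (\<kappa> + 1))"
    and kappa: "\<kappa> > 3"
begin

sublocale prob_space mu by (rule prob)

lemma sets_mu [simp, measurable_cong]: "sets mu = sets borel" and space_mu [simp]: "space mu = UNIV"
  unfolding dens by simp_all

lemma atom_free: "measure mu {x} = 0"
proof -
  have "emeasure mu {x} = (\<integral>\<^sup>+ y. ennreal (psi y) * indicator {x} y \<partial>lborel)"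
    unfolding dens using meas by (intro emeasure_density) auto
  also have "\<dots> = (\<integral>\<^sup>+ y. 0 \<partial>(lborel :: real measure))"
    by (rule nn_integral_cong_AE, rule AE_mp[OF AE_lborel_singleton[of x]], rule AE_I2) (auto simp: indicator_def)
  finally show ?thesis by (simp add: measure_def)
qed

lemma psi_bound: "\<exists>r0>0. \<forall>x. x \<noteq> xs \<and> \<bar>x - xs\<bar> < r0 \<longrightarrow> psi x \<le> 2 * c * \<bar>x - xs\<bar> powr \<kappa>"
proof -
  have "\<forall>\<^sub>F x in at xs. psi x / (c * \<bar>x - xs\<bar> powr \<kappa>) < 2"
    using asym by (rule order_tendstoD) simp
  then obtain r0 where r0: "r0 > 0" "\<And>x. x \<noteq> xs \<Longrightarrow> dist x xs < r0 \<Longrightarrow> psi x / (c * \<bar>x - xs\<bar> powr \<kappa>) < 2"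
    unfolding eventually_at by blast
  have "psi x \<le> 2 * c * \<bar>x - xs\<bar> powr \<kappa>" if "x \<noteq> xs" "\<bar>x - xs\<bar> < r0" for x
  proof -
    have "c * \<bar>x - xs\<bar> powr \<kappa> > 0" using that c by simp
    then show ?thesis using r0(2)[of x] that by (simp add: dist_real_def pos_divide_less_eq)
  qed
  then show ?thesis using r0(1) by blast
qed

text \<open>Supremum of the density times length. The point \<open>xs\<close> is excluded because
  the asymptotics says nothing about the value of \<open>psi\<close> there.\<close>

lemma interval_mass:
  assumes A: "A \<in> sets borel" "\<And>x. x \<in> A \<Longrightarrow> x \<noteq> xs \<and> \<bar>x - xs\<bar> \<le> r" and lA: "emeasure lborel A = ennreal r"
    and r: "0 < r" "r < r0" and r0: "\<forall>x. x \<noteq> xs \<and> \<bar>x - xs\<bar> < r0 \<longrightarrow> psi x \<le> 2 * c * \<bar>x - xs\<bar> powr \<kappa>"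
  shows "measure mu A \<le> 2 * c * r powr (\<kappa> + 1)"
proof -
  have "emeasure mu A = (\<integral>\<^sup>+ y. ennreal (psi y) * indicator A y \<partial>lborel)"
    unfolding dens using meas A by (intro emeasure_density) auto
  also have "\<dots> \<le> (\<integral>\<^sup>+ y. ennreal (2 * c * r powr \<kappa>) * indicator A y \<partial>lborel)"
  proof (rule nn_integral_mono)
    fix y
    show "ennreal (psi y) * indicator A y \<le> ennreal (2 * c * r powr \<kappa>) * indicator A y"
    proof (cases "y \<in> A")
      case True
      have "psi y \<le> 2 * c * \<bar>y - xs\<bar> powr \<kappa>" using A(2)[OF True] r r0 by auto
      also have "\<dots> \<le> 2 * c * r powr \<kappa>" using A(2)[OF True] c kappa by (intro mult_left_mono powr_mono2) auto
      finally show ?thesis using True by (simp add: ennreal_leI)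
    qed simp
  qed
  also have "\<dots> = ennreal (2 * c * r powr \<kappa>) * emeasure lborel A"
    using A by (intro nn_integral_cmult_indicator) auto
  also have "\<dots> = ennreal (2 * c * r powr (\<kappa> + 1))"
    unfolding lA using r c by (simp add: powr_add ennreal_mult[symmetric] mult.assoc)
  finally show ?thesis unfolding emeasure_eq_measure using c by (subst (asm) ennreal_le_iff) auto
qed

lemma emp_measure:
  assumes "n > 0"
  shows "measure (measure_pmf (pmf_of_set {..<n})) {j. P j} = real (card {j \<in> {..<n}. P j}) / real n"
  using assms measure_pmf_of_set[of "{..<n}" "{j. P j}"] by (auto simp: Int_def lessThan_empty_iff)

lemma emp_cdf_diff:
  assumes "n > 0" "x \<le> y"
  shows "real (card {j \<in> {..<n}. x < a n j \<and> a n j \<le> y}) / real n = emp_cdf a n y - emp_cdf a n x"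
proof -
  have "{j \<in> {..<n}. a n j \<le> y} = {j \<in> {..<n}. x < a n j \<and> a n j \<le> y} \<union> {j \<in> {..<n}. a n j \<le> x}"
    using assms by auto
  moreover have "card ({j \<in> {..<n}. x < a n j \<and> a n j \<le> y} \<union> {j \<in> {..<n}. a n j \<le> x})
    = card {j \<in> {..<n}. x < a n j \<and> a n j \<le> y} + card {j \<in> {..<n}. a n j \<le> x}"
    by (rule card_Un_disjoint) auto
  ultimately show ?thesis by (simp add: emp_cdf_def add_divide_distrib)
qed

lemma cdf_diff: "x \<le> y \<Longrightarrow> measure mu {x<..y} = measure mu {..y} - measure mu {..x}"
proof -
  assume "x \<le> y"
  have "{x<..y} = {..y} - {..x}" by auto
  then show ?thesis using \<open>x \<le> y\<close> by (simp add: finite_measure_Diff)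
qed

text \<open>The empirical measure is realised as the uniform distribution on indices. The mass near
  \<open>xs\<close> on one side is a difference of two values of the distribution function, hence
  the 2 in 2 M0/n; and 8 c is 4 times the constant 2 c bounding the density.\<close>

lemma one_sided_rate:
  fixes Y :: "real \<Rightarrow> real" and g r0 M0 :: real
  assumes Y: "(Y = (\<lambda>s. s - xs) \<and> b) \<or> (Y = (\<lambda>s. xs - s) \<and> \<not> b)"
    and n: "n > 0" and M0: "\<And>x. \<bar>emp_cdf a n x - measure mu {..x}\<bar> \<le> M0 / real n"
    and g: "g > 0" "\<And>j. j < n \<Longrightarrow> \<bar>a n j - xs\<bar> > g"
    and r0: "g < r0" "\<forall>x. x \<noteq> xs \<and> \<bar>x - xs\<bar> < r0 \<longrightarrow> psi x \<le> 2 * c * \<bar>x - xs\<bar> powr \<kappa>"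
    and k: "1 \<le> k" "k \<le> 4"
  shows "integrable mu (\<lambda>s. inv_power k (Y s))"
    and "\<bar>(\<Sum>j<n. inv_power k (Y (a n j))) / real n - (LINT s|mu. inv_power k (Y s))\<bar>
       \<le> (2 * M0 / real n + 8 * c / (\<kappa> - 3) * g powr (\<kappa> + 1)) / g ^ k"
proof -
  let ?N = "measure_pmf (pmf_of_set {..<n})"
  define \<epsilon> where "\<epsilon> = 2 * M0 / real n"
  have M0': "M0 / real n \<ge> 0" using order.trans[OF abs_ge_zero M0[of 0]] .
  have eps: "\<epsilon> \<ge> 0" using M0' by (simp add: \<epsilon>_def)
  have Ym: "Y \<in> borel_measurable borel" using Y by auto
  have ne: "a n j \<noteq> xs" if "j < n" for j using g that by force
  have mu_near: "measure mu {s \<in> space mu. near_set b (Y s) r} = measure mu (if b then {xs<..xs+r} else {xs-r<..xs})"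
    "measure ?N {s \<in> space ?N. near_set b (Y (a n s)) r} = (if b then emp_cdf a n (xs + r) - emp_cdf a n xs else emp_cdf a n xs - emp_cdf a n (xs - r))"
    if r: "r > 0" for r
  proof -
    show "measure mu {s \<in> space mu. near_set b (Y s) r} = measure mu (if b then {xs<..xs+r} else {xs-r<..xs})"
    proof (cases b)
      case True
      then have "{s \<in> space mu. near_set b (Y s) r} = {xs<..xs+r}" using Y by (auto simp: near_set_def)
      then show ?thesis using True by simp
    next
      case False
      \<comment> \<open>On the left the far end is open, as in the half-open interval, but
        \<open>xs\<close> itself must be removed, being at distance 0; it carries no mass.\<close>
      then have "{s \<in> space mu. near_set b (Y s) r} = {xs-r<..xs} - {xs}" using Y r by (auto simp: near_set_def)
      also have "measure mu \<dots> = measure mu {xs-r<..xs} - measure mu {xs}" using r by (intro finite_measure_Diff) auto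
      finally show ?thesis using False atom_free by simp
    qed
    show "measure ?N {s \<in> space ?N. near_set b (Y (a n s)) r} = (if b then emp_cdf a n (xs + r) - emp_cdf a n xs else emp_cdf a n xs - emp_cdf a n (xs - r))"
    proof (cases b)
      case True
      have "{j \<in> {..<n}. near_set b (Y (a n j)) r} = {j \<in> {..<n}. xs < a n j \<and> a n j \<le> xs + r}"
        using Y True by (auto simp: near_set_def)
      then show ?thesis using emp_measure[OF n, of "\<lambda>s. near_set b (Y (a n s)) r"] emp_cdf_diff[OF n, of xs "xs + r"] r True by simp
    next
      case False
      have "{j \<in> {..<n}. near_set b (Y (a n j)) r} = {j \<in> {..<n}. xs - r < a n j \<and> a n j \<le> xs}"
        using Y False ne by (force simp: near_set_def)
      then show ?thesis using emp_measure[OF n, of "\<lambda>s. near_set b (Y (a n s)) r"] emp_cdf_diff[OF n, of "xs - r" xs] r False by simp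
    qed
  qed
  have cmp: "(\<integral>\<^sup>+ s. ennreal (inv_power k (Y (a n s))) \<partial>?N) \<le> (\<integral>\<^sup>+ s. ennreal (inv_power k (Y s)) \<partial>mu) + ennreal (\<epsilon> / g ^ k)"
    "(\<integral>\<^sup>+ s. ennreal (inv_power k (Y s)) \<partial>mu) \<le> (\<integral>\<^sup>+ s. ennreal (inv_power k (Y (a n s))) \<partial>?N)
      + ennreal (\<epsilon> / g ^ k + 4 * (2 * c) / (\<kappa> - 3) * g powr (\<kappa> + 1) / g ^ k)"
  proof -
    have H1: "\<bar>measure ?N {s \<in> space ?N. near_set b (Y (a n s)) r} - measure mu {s \<in> space mu. near_set b (Y s) r}\<bar> \<le> \<epsilon>"
      if r: "r > 0" for r
    proof (cases b)
      case True
      have "\<epsilon> = M0 / real n + M0 / real n" by (simp add: \<epsilon>_def)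
      then show ?thesis unfolding mu_near[OF r] using True cdf_diff[of xs "xs + r"] r M0[of "xs + r"] M0[of xs] by (simp only: if_True)
    next
      case False
      have "\<epsilon> = M0 / real n + M0 / real n" by (simp add: \<epsilon>_def)
      then show ?thesis unfolding mu_near[OF r] using False cdf_diff[of "xs - r" xs] r M0[of "xs - r"] M0[of xs] by (simp only: if_False)
    qed
    have H2: "measure ?N {s \<in> space ?N. near_set b (Y (a n s)) r} = 0" if r: "0 < r" "r < g" for r
    proof -
      have "{j \<in> {..<n}. near_set b (Y (a n j)) r} = {}"
      proof -
        have "\<not> near_set b (Y (a n j)) r" if "j < n" for j
          using g(2)[OF that] r Y by (auto simp: near_set_def)
        then show ?thesis by auto
      qed
      then show ?thesis using emp_measure[OF n, of "\<lambda>s. near_set b (Y (a n s)) r"] by simp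
    qed
    have H3: "measure mu {s \<in> space mu. near_set b (Y s) r} \<le> 2 * c * r powr (\<kappa> + 1)" if r: "0 < r" "r < g" for r
    proof (cases b)
      case True
      have "measure mu {xs<..xs+r} \<le> 2 * c * r powr (\<kappa> + 1)"
        by (rule interval_mass[OF _ _ _ r(1) _ r0(2)]) (use r r0 in auto)
      then show ?thesis unfolding mu_near[OF r(1)] using True by simp
    next
      case False
      have "measure mu {s \<in> space mu. near_set b (Y s) r} = measure mu {xs - r<..<xs}"
        using Y False by (intro arg_cong[where f = "measure mu"]) (auto simp: near_set_def)
      also have "\<dots> \<le> 2 * c * r powr (\<kappa> + 1)" by (rule interval_mass[OF _ _ _ r(1) _ r0(2)]) (use r r0 in auto)
      finally show ?thesis .
    qed
    note L = one_sided_moment_comparison[of ?N "\<lambda>s. Y (a n s)" mu Y g k \<kappa> "2 * c" \<epsilon> b]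
    show "(\<integral>\<^sup>+ s. ennreal (inv_power k (Y (a n s))) \<partial>?N) \<le> (\<integral>\<^sup>+ s. ennreal (inv_power k (Y s)) \<partial>mu) + ennreal (\<epsilon> / g ^ k)"
      by (rule L(1)) (use prob Ym g k kappa c eps H1 H2 H3 in \<open>auto intro: measure_pmf.prob_space_axioms\<close>)
    show "(\<integral>\<^sup>+ s. ennreal (inv_power k (Y s)) \<partial>mu) \<le> (\<integral>\<^sup>+ s. ennreal (inv_power k (Y (a n s))) \<partial>?N)
      + ennreal (\<epsilon> / g ^ k + 4 * (2 * c) / (\<kappa> - 3) * g powr (\<kappa> + 1) / g ^ k)"
      by (rule L(2)) (use prob Ym g k kappa c eps H1 H2 H3 in \<open>auto intro: measure_pmf.prob_space_axioms\<close>)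
  qed
  define E where "E = (\<Sum>j<n. inv_power k (Y (a n j))) / real n"
  have E0: "E \<ge> 0" unfolding E_def by (intro divide_nonneg_nonneg sum_nonneg inv_power_nonneg) auto
  have E: "(\<integral>\<^sup>+ s. ennreal (inv_power k (Y (a n s))) \<partial>?N) = ennreal E"
  proof -
    have "(\<integral>\<^sup>+ s. ennreal (inv_power k (Y (a n s))) \<partial>?N) = ennreal (LINT s|?N. inv_power k (Y (a n s)))"
      by (rule nn_integral_eq_integral) (use n inv_power_nonneg in \<open>auto intro!: integrable_measure_pmf_finite simp: lessThan_empty_iff\<close>)
    also have "(LINT s|?N. inv_power k (Y (a n s))) = E"
      unfolding E_def using n by (subst integral_pmf_of_set) (auto simp: lessThan_empty_iff)
    finally show ?thesis .
  qed
  \<comment> \<open>Finiteness of the inverse moment of \<open>mu\<close> is deduced from that of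
    the empirical one, which is a finite sum.\<close>
  have fin: "(\<integral>\<^sup>+ s. ennreal (inv_power k (Y s)) \<partial>mu) < \<infinity>"
    using cmp(2) unfolding E by (rule le_less_trans) (simp only: ennreal_add_less_top ennreal_less_top infinity_ennreal_def simp_thms)
  have bm: "(\<lambda>s. inv_power k (Y s)) \<in> borel_measurable mu" using Ym by measurable
  show int: "integrable mu (\<lambda>s. inv_power k (Y s))"
    using fin by (intro integrableI_nonneg bm) (auto simp: inv_power_nonneg)
  define J where "J = (LINT s|mu. inv_power k (Y s))"
  have J0: "J \<ge> 0" unfolding J_def by (intro Bochner_Integration.integral_nonneg inv_power_nonneg)
  have J: "(\<integral>\<^sup>+ s. ennreal (inv_power k (Y s)) \<partial>mu) = ennreal J"
    unfolding J_def by (rule nn_integral_eq_integral[OF int]) (simp add: inv_power_nonneg)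
  have x0: "\<epsilon> / g ^ k \<ge> 0" "4 * (2 * c) / (\<kappa> - 3) * g powr (\<kappa> + 1) / g ^ k \<ge> 0"
    using eps g c kappa by simp_all
  have "ennreal E \<le> ennreal (J + \<epsilon> / g ^ k)" using cmp(1) J0 x0 unfolding E J by simp
  then have 1: "E \<le> J + \<epsilon> / g ^ k" using J0 x0 by (subst (asm) ennreal_le_iff) auto
  have "ennreal J \<le> ennreal (E + (\<epsilon> / g ^ k + 4 * (2 * c) / (\<kappa> - 3) * g powr (\<kappa> + 1) / g ^ k))"
    using cmp(2) E0 x0 unfolding E J by (simp only: ennreal_plus add_nonneg_nonneg)
  then have 2: "J \<le> E + (\<epsilon> / g ^ k + 4 * (2 * c) / (\<kappa> - 3) * g powr (\<kappa> + 1) / g ^ k)"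
    using E0 x0 by (subst (asm) ennreal_le_iff) auto
  have "\<bar>E - J\<bar> \<le> \<epsilon> / g ^ k + 4 * (2 * c) / (\<kappa> - 3) * g powr (\<kappa> + 1) / g ^ k"
    using 1 2 x0 by linarith
  also have "\<dots> = (2 * M0 / real n + 8 * c / (\<kappa> - 3) * g powr (\<kappa> + 1)) / g ^ k"
    by (simp add: \<epsilon>_def add_divide_distrib)
  finally show "\<bar>(\<Sum>j<n. inv_power k (Y (a n j))) / real n - (LINT s|mu. inv_power k (Y s))\<bar>
       \<le> (2 * M0 / real n + 8 * c / (\<kappa> - 3) * g powr (\<kappa> + 1)) / g ^ k" unfolding E_def J_def .
qed

text \<open>At \<open>s = xs\<close> both sides are 0 by division by zero, which requires k \<ge>
  1.\<close>

lemma inverse_power_split: "1 / (xs - s) ^ k = inv_power k (xs - s) + (- 1) ^ k * inv_power k (s - xs)" if "k \<ge> 1"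
proof -
  consider "s < xs" | "s = xs" | "s > xs" by linarith
  then show ?thesis
  proof cases
    case 3
    have "(xs - s) ^ k = (- 1) ^ k * (s - xs) ^ k" by (simp add: power_mult_distrib[symmetric])
    then show ?thesis using 3 by (cases "even k") (simp_all add: inv_power_def)
  qed (use that in \<open>auto simp: inv_power_def\<close>)
qed

lemma moment_rate:
  obtains C m0 n1 where "C > 0" "m0 > 0" "\<And>k. 1 \<le> k \<Longrightarrow> k \<le> 4 \<Longrightarrow> integrable mu (\<lambda>s. 1 / (xs - s) ^ k)"
    "\<And>n j. n \<ge> n1 \<Longrightarrow> j < n \<Longrightarrow> \<bar>a n j - xs\<bar> > m0 * real n powr (- 1 / (\<kappa> + 1))"
    "\<And>n k. n \<ge> n1 \<Longrightarrow> 1 \<le> k \<Longrightarrow> k \<le> 4 \<Longrightarrow>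
       \<bar>(\<Sum>j<n. 1 / (xs - a n j) ^ k) / real n - (LINT s|mu. 1 / (xs - s) ^ k)\<bar> \<le> C / (real n * (m0 * real n powr (- 1 / (\<kappa> + 1))) ^ k)"
proof -
  from cdf_close obtain M0 n0 where M0': "\<forall>n\<ge>n0. \<forall>x. \<bar>emp_cdf a n x - measure mu {..x}\<bar> \<le> M0 / real n"
    by (elim exE)
  have M0: "\<bar>emp_cdf a n x - measure mu {..x}\<bar> \<le> M0 / real n" if "n \<ge> n0" for n x
    by (rule M0'[rule_format, OF that])
  from gap obtain m0 n2 where m0': "m0 > 0" "\<forall>n\<ge>n2. \<forall>j<n. \<bar>a n j - xs\<bar> > m0 * real n powr (- 1 / (\<kappa> + 1))"
    by (elim exE conjE)
  note m0 = m0'(1) m0'(2)[rule_format]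
  from psi_bound obtain r0 where r0: "r0 > 0" "\<forall>x. x \<noteq> xs \<and> \<bar>x - xs\<bar> < r0 \<longrightarrow> psi x \<le> 2 * c * \<bar>x - xs\<bar> powr \<kappa>"
    by (elim exE conjE)
  define g where "g = (\<lambda>n::nat. m0 * real n powr (- 1 / (\<kappa> + 1)))"
  have "((\<lambda>n. real n powr (- 1 / (\<kappa> + 1))) \<longlongrightarrow> 0) sequentially"
    by (rule tendsto_neg_powr[OF _ filterlim_real_sequentially]) (rule divide_neg_pos, use kappa in auto)
  then have "g \<longlonglongrightarrow> m0 * 0" unfolding g_def by (rule tendsto_mult[OF tendsto_const])
  then have "\<forall>\<^sub>F n in sequentially. g n < r0" by (rule order_tendstoD(2)) (use r0(1) in simp)
  then obtain n3 where n3': "\<forall>n\<ge>n3. g n < r0" unfolding eventually_sequentially by (elim exE)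
  define n1 where "n1 = max (max n0 n2) (max n3 1)"
  define B where "B = 2 * M0 + 8 * c / (\<kappa> - 3) * m0 powr (\<kappa> + 1)"
  have fin: "n > 0" "g n > 0" "\<And>x. \<bar>emp_cdf a n x - measure mu {..x}\<bar> \<le> M0 / real n" "\<And>j. j < n \<Longrightarrow> \<bar>a n j - xs\<bar> > g n" "g n < r0"
    if n: "n \<ge> n1" for n
  proof -
    have ns: "n \<ge> n0" "n \<ge> n2" "n \<ge> n3" "n \<ge> 1" using n unfolding n1_def by linarith+
    show "n > 0" using ns by linarith
    then show "g n > 0" unfolding g_def using m0(1) by (intro mult_pos_pos) simp_all
    show "\<And>x. \<bar>emp_cdf a n x - measure mu {..x}\<bar> \<le> M0 / real n" by (rule M0[OF ns(1)])
    show "\<And>j. j < n \<Longrightarrow> \<bar>a n j - xs\<bar> > g n" unfolding g_def by (rule m0(2)[OF ns(2)])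
    show "g n < r0" by (rule n3'[rule_format, OF ns(3)])
  qed
  \<comment> \<open>The gap g of order n^(-1/(\<kappa> + 1)) makes g^(\<kappa> + 1) of order 1/n,
    the same as the distance of the distribution functions, so both errors merge into B/n.\<close>
  have gk: "(2 * M0 / real n + 8 * c / (\<kappa> - 3) * g n powr (\<kappa> + 1)) = B / real n" if n: "n > 0" for n
  proof -
    have "g n powr (\<kappa> + 1) = m0 powr (\<kappa> + 1) * (real n powr (- 1 / (\<kappa> + 1))) powr (\<kappa> + 1)"
      unfolding g_def using m0(1) by (simp add: powr_mult)
    also have "(real n powr (- 1 / (\<kappa> + 1))) powr (\<kappa> + 1) = real n powr (- 1)"
      unfolding powr_powr using kappa by simp
    also have "\<dots> = 1 / real n" using n by (simp add: powr_minus_divide)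
    finally show ?thesis unfolding B_def by (simp add: add_divide_distrib)
  qed
  have R: "integrable mu (\<lambda>s. inv_power k (s - xs))" "integrable mu (\<lambda>s. inv_power k (xs - s))"
     "\<bar>(\<Sum>j<n. inv_power k (a n j - xs)) / real n - (LINT s|mu. inv_power k (s - xs))\<bar> \<le> B / real n / g n ^ k"
     "\<bar>(\<Sum>j<n. inv_power k (xs - a n j)) / real n - (LINT s|mu. inv_power k (xs - s))\<bar> \<le> B / real n / g n ^ k"
    if n: "n \<ge> n1" and k: "1 \<le> k" "k \<le> 4" for n k
    using one_sided_rate[of "\<lambda>s. s - xs" True n M0 "g n" r0 k] one_sided_rate[of "\<lambda>s. xs - s" False n M0 "g n" r0 k]
      fin[OF n] r0(2) k gk[OF fin(1)[OF n]] by auto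
  have int: "integrable mu (\<lambda>s. 1 / (xs - s) ^ k)" if k: "1 \<le> k" "k \<le> 4" for k
    unfolding inverse_power_split[OF k(1)] using R(1,2)[OF order.refl k] by (intro Bochner_Integration.integrable_add integrable_mult_right) auto
  have bound: "\<bar>(\<Sum>j<n. 1 / (xs - a n j) ^ k) / real n - (LINT s|mu. 1 / (xs - s) ^ k)\<bar> \<le> (2 * \<bar>B\<bar> + 1) / (real n * g n ^ k)"
    if n: "n \<ge> n1" and k: "1 \<le> k" "k \<le> 4" for n k
  proof -
    let ?e1 = "(\<Sum>j<n. inv_power k (xs - a n j)) / real n" and ?e2 = "(\<Sum>j<n. inv_power k (a n j - xs)) / real n"
    let ?i1 = "LINT s|mu. inv_power k (xs - s)" and ?i2 = "LINT s|mu. inv_power k (s - xs)"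
    have s: "(\<Sum>j<n. 1 / (xs - a n j) ^ k) / real n = ?e1 + (- 1) ^ k * ?e2"
      unfolding inverse_power_split[OF k(1)] by (simp add: sum.distrib add_divide_distrib sum_distrib_left)
    have i: "(LINT s|mu. 1 / (xs - s) ^ k) = ?i1 + (- 1) ^ k * ?i2"
      unfolding inverse_power_split[OF k(1)] using R(1,2)[OF n k] by simp
    have e: "(\<Sum>j<n. 1 / (xs - a n j) ^ k) / real n - (LINT s|mu. 1 / (xs - s) ^ k) = (?e1 - ?i1) + (- 1) ^ k * (?e2 - ?i2)"
    proof -
      have "p + q * r - (p' + q * r') = (p - p') + q * (r - r')" for p q r p' r' :: real
        by (simp add: algebra_simps)
      then show ?thesis unfolding s i .
    qed
    have f: "\<bar>(- 1) ^ k * (?e2 - ?i2)\<bar> = \<bar>?e2 - ?i2\<bar>"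
      by (simp only: abs_mult power_abs abs_minus_cancel abs_one power_one mult_1_left)
    have "\<bar>(\<Sum>j<n. 1 / (xs - a n j) ^ k) / real n - (LINT s|mu. 1 / (xs - s) ^ k)\<bar> \<le> B / real n / g n ^ k + B / real n / g n ^ k"
      unfolding e by (rule order.trans[OF abs_triangle_ineq], unfold f, rule add_mono[OF R(4)[OF n k] R(3)[OF n k]])
    also have "\<dots> = (2 * B) / (real n * g n ^ k)" by (simp only: divide_divide_eq_left mult_2 add_divide_distrib)
    also have "\<dots> \<le> (2 * \<bar>B\<bar> + 1) / (real n * g n ^ k)" using fin(1,2)[OF n] by (intro divide_right_mono) auto
    finally show ?thesis .
  qed
  show ?thesis
  proof (rule that[of "2 * \<bar>B\<bar> + 1" m0 n1])
    show "m0 * real n powr (- 1 / (\<kappa> + 1)) < \<bar>a n j - xs\<bar>" if "n \<ge> n1" "j < n" for n j using fin(4)[OF that(1)] that(2) unfolding g_def by blast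
    show "\<bar>(\<Sum>j<n. 1 / (xs - a n j) ^ k) / real n - (LINT s|mu. 1 / (xs - s) ^ k)\<bar> \<le> (2 * \<bar>B\<bar> + 1) / (real n * (m0 * real n powr (- 1 / (\<kappa> + 1))) ^ k)"
      if "n \<ge> n1" "1 \<le> k" "k \<le> 4" for n k using bound[OF that] unfolding g_def .
  qed (use m0 int in auto)
qed

lemma even_moment_pos:
  assumes "integrable mu (\<lambda>s. 1 / (xs - s) ^ k)" "even k"
  shows "(LINT s|mu. 1 / (xs - s) ^ k) > 0"
proof -
  have nn: "0 \<le> 1 / (xs - s) ^ k" for s using assms(2) by (simp add: zero_le_even_power)
  have "(LINT s|mu. 1 / (xs - s) ^ k) \<noteq> 0"
  proof
    assume "(LINT s|mu. 1 / (xs - s) ^ k) = 0"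
    then have "AE s in mu. 1 / (xs - s) ^ k = 0"
      using integral_nonneg_eq_0_iff_AE[OF assms(1)] nn by auto
    \<comment> \<open>The integrand can vanish only at \<open>s = xs\<close>, where it does so by
      division by zero.\<close>
    then have "AE s in mu. s \<in> {xs}" by (rule AE_mp) (auto simp: )
    then have "measure mu {xs} = 1" by (subst (asm) AE_in_set_eq_1) auto
    then show False using atom_free by simp
  qed
  moreover have "(LINT s|mu. 1 / (xs - s) ^ k) \<ge> 0" by (intro Bochner_Integration.integral_nonneg nn)
  ultimately show ?thesis by linarith
qed

end

subsection \<open>Deformation of the contours\<close>

lemma contour_integral_linepath_ray:
  fixes c d :: complex
  assumes R: "R \<ge> 0" and int: "set_integrable lborel {0..R} (\<lambda>r. f (c + of_real r * d) * d)"
  shows "contour_integral (linepath c (c + of_real R * d)) f = (LINT r:{0..R}|lborel. f (c + of_real r * d) * d)"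
proof (cases "R = 0")
  case True
  have "(LINT r:{0..0::real}|lborel. f (c + of_real r * d) * d) = 0"
    using set_borel_integral_eq_integral(2)[OF int] True by simp
  then show ?thesis using True by simp
next
  case False
  then have "R > 0" using R by simp
  have "((\<lambda>r. f (c + of_real r * d) * d) has_integral (LINT r:{0..R}|lborel. f (c + of_real r * d) * d)) (cbox 0 R)"
    unfolding set_borel_integral_eq_integral(2)[OF int] cbox_interval
    by (rule integrable_integral[OF set_borel_integral_eq_integral(1)[OF int]])
  from has_integral_affinity[OF this, of R 0] \<open>R > 0\<close>
  have "((\<lambda>r. f (c + of_real (R * r) * d) * d) has_integral
     (1 / R) *\<^sub>R (LINT r:{0..R}|lborel. f (c + of_real r * d) * d)) ((\<lambda>x. x / R) ` {0..R})"
    by simp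
  moreover have "(\<lambda>x. x / R) ` {0..R} = {0..1}"
  proof
    show "(\<lambda>x. x / R) ` {0..R} \<subseteq> {0..1}" using \<open>R > 0\<close> by auto
    show "{0..1} \<subseteq> (\<lambda>x. x / R) ` {0..R}"
    proof
      fix x :: real assume "x \<in> {0..1}"
      then show "x \<in> (\<lambda>x. x / R) ` {0..R}" using \<open>R > 0\<close>
        by (intro image_eqI[of _ _ "x * R"]) (auto simp: mult_le_cancel_right1)
    qed
  qed
  ultimately have "((\<lambda>r. f (c + of_real (R * r) * d) * d) has_integral
     (1 / R) *\<^sub>R (LINT r:{0..R}|lborel. f (c + of_real r * d) * d)) {0..1}" by simp
  from has_integral_cmul[OF this, of R] \<open>R > 0\<close>
  have "((\<lambda>r. R *\<^sub>R (f (c + of_real (R * r) * d) * d)) has_integral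
     (LINT r:{0..R}|lborel. f (c + of_real r * d) * d)) {0..1}" by simp
  then have "(f has_contour_integral (LINT r:{0..R}|lborel. f (c + of_real r * d) * d)) (linepath c (c + of_real R * d))"
    unfolding has_contour_integral_linepath
    by (rule has_integral_eq[rotated]) (auto simp: linepath_def scaleR_conv_of_real algebra_simps)
  then show ?thesis by (rule contour_integral_unique)
qed

lemma contour_integral_ray_tendsto:
  fixes c d :: complex
  assumes int: "set_integrable lborel {0..} (\<lambda>r. f (c + of_real r * d) * d)"
  shows "((\<lambda>R. contour_integral (linepath c (c + of_real R * d)) f) \<longlongrightarrow>
     (LINT r:{0..}|lborel. f (c + of_real r * d) * d)) at_top"
proof -
  have "((\<lambda>R. LINT r:{0..R}|lborel. f (c + of_real r * d) * d) \<longlongrightarrow>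
     (LINT r:{0..}|lborel. f (c + of_real r * d) * d)) at_top"
    by (rule tendsto_set_lebesgue_integral_at_top[OF _ int]) auto
  then show ?thesis
  proof (rule Lim_transform_eventually)
    show "\<forall>\<^sub>F R in at_top. (LINT r:{0..R}|lborel. f (c + of_real r * d) * d)
        = contour_integral (linepath c (c + of_real R * d)) f"
      using eventually_ge_at_top[of 0]
    proof eventually_elim
      case (elim R)
      have "set_integrable lborel {0..R} (\<lambda>r. f (c + of_real r * d) * d)"
        by (rule set_integrable_subset[OF int]) auto
      then show ?case using contour_integral_linepath_ray[OF elim] by metis
    qed
  qed
qed

text \<open>A primitive exists on the convex set, so the integrals around a quadrilateral telescope;
  its far side vanishes in the limit. This serves both for shifting parallel half-lines and for
  rotating rays with a common origin.\<close>

lemma ray_deformation: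
  fixes c1 d1 c2 d2 :: complex
  assumes S: "convex S" "open S" "f holomorphic_on S"
    and in1: "\<And>r. r \<ge> 0 \<Longrightarrow> c1 + of_real r * d1 \<in> S" and in2: "\<And>r. r \<ge> 0 \<Longrightarrow> c2 + of_real r * d2 \<in> S"
    and int1: "set_integrable lborel {0..} (\<lambda>r. f (c1 + of_real r * d1) * d1)"
    and int2: "set_integrable lborel {0..} (\<lambda>r. f (c2 + of_real r * d2) * d2)"
    and lim: "((\<lambda>R. contour_integral (linepath (c1 + of_real R * d1) (c2 + of_real R * d2)) f) \<longlongrightarrow> 0) at_top"
  shows "(LINT r:{0..}|lborel. f (c1 + of_real r * d1) * d1) - (LINT r:{0..}|lborel. f (c2 + of_real r * d2) * d2)
    = contour_integral (linepath c1 c2) f"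
proof -
  obtain F where F: "\<And>x. x \<in> S \<Longrightarrow> (F has_field_derivative f x) (at x within S)"
    using holomorphic_convex_primitive'[OF S] by blast
  have prim: "contour_integral (linepath a b) f = F b - F a" if "a \<in> S" "b \<in> S" for a b
  proof -
    have "path_image (linepath a b) \<subseteq> S" using that S(1) by (simp add: closed_segment_subset)
    from contour_integral_primitive[OF F valid_path_linepath this] show ?thesis
      by (simp add: contour_integral_unique)
  qed
  have c: "c1 \<in> S" "c2 \<in> S" using in1[of 0] in2[of 0] by simp_all
  have "((\<lambda>R. contour_integral (linepath c1 (c1 + of_real R * d1)) f - contour_integral (linepath c2 (c2 + of_real R * d2)) f
      + contour_integral (linepath (c1 + of_real R * d1) (c2 + of_real R * d2)) f) \<longlongrightarrow>
     (LINT r:{0..}|lborel. f (c1 + of_real r * d1) * d1) - (LINT r:{0..}|lborel. f (c2 + of_real r * d2) * d2) + 0) at_top"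
    by (intro tendsto_intros contour_integral_ray_tendsto int1 int2 lim)
  moreover have "((\<lambda>R. contour_integral (linepath c1 (c1 + of_real R * d1)) f - contour_integral (linepath c2 (c2 + of_real R * d2)) f
      + contour_integral (linepath (c1 + of_real R * d1) (c2 + of_real R * d2)) f) \<longlongrightarrow> contour_integral (linepath c1 c2) f) at_top"
  proof (rule tendsto_eventually)
    show "\<forall>\<^sub>F R in at_top. contour_integral (linepath c1 (c1 + of_real R * d1)) f - contour_integral (linepath c2 (c2 + of_real R * d2)) f
      + contour_integral (linepath (c1 + of_real R * d1) (c2 + of_real R * d2)) f = contour_integral (linepath c1 c2) f"
      using eventually_ge_at_top[of 0] by eventually_elim (use prim c in1 in2 in simp)
  qed
  ultimately show ?thesis using tendsto_unique trivial_limit_at_top_linorder by fastforce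
qed

lemma exp_neg_times_tendsto_0:
  fixes g :: "real \<Rightarrow> complex"
  assumes "\<forall>\<^sub>F R in at_top. norm (g R) \<le> K * exp (- R) * (A + B * R)"
  shows "(g \<longlongrightarrow> 0) at_top"
proof (rule Lim_null_comparison[OF assms])
  have "((\<lambda>R::real. exp (- R)) \<longlongrightarrow> 0) at_top" "((\<lambda>R::real. R * exp (- R)) \<longlongrightarrow> 0) at_top"
    by real_asymp+
  then have "((\<lambda>R. K * A * exp (- R) + K * B * (R * exp (- R))) \<longlongrightarrow> K * A * 0 + K * B * 0) at_top"
    by (intro tendsto_intros)
  then show "((\<lambda>R. K * exp (- R) * (A + B * R)) \<longlongrightarrow> 0) at_top" by (simp add: algebra_simps)
qed

lemma set_integrable_exp_neg: "set_integrable lborel {0..} (\<lambda>r::real. exp (- r))"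
proof -
  have "(\<lambda>r::real. exp (- 1 * r)) integrable_on {0..}"
    using integrable_on_exp_minus_to_infinity[of 1 0] by simp
  then have "(\<lambda>r::real. exp (- 1 * r)) absolutely_integrable_on {0..}"
    by (intro nonnegative_absolutely_integrable_1) auto
  then show ?thesis
    unfolding set_integrable_def by (subst (asm) integrable_completion) auto
qed

lemma set_integrable_exp_bound:
  fixes f :: "real \<Rightarrow> complex"
  assumes "continuous_on {0..} f" "\<And>r. r \<ge> 0 \<Longrightarrow> norm (f r) \<le> K * exp (- r)"
  shows "set_integrable lborel {0..} f"
proof (rule set_integrable_bound[where f = "\<lambda>r. K * exp (- r)"])
  show "set_integrable lborel {0..} (\<lambda>r. K * exp (- r))" using set_integrable_exp_neg by simp
  show "set_borel_measurable lborel {0..} f"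
    using borel_measurable_continuous_on_indicator[OF _ assms(1)] by (simp add: set_borel_measurable_def)
  show "AE x in lborel. x \<in> {0..} \<longrightarrow> norm (f x) \<le> norm (K * exp (- x))"
    using assms(2) by (intro AE_I2 impI) (auto intro: order.trans[OF _ abs_ge_self])
qed

lemma line_integral_split:
  fixes f :: "real \<Rightarrow> complex"
  assumes "continuous_on UNIV f" "\<And>r. norm (f r) \<le> K * exp (- \<bar>r\<bar>)"
  shows "integrable lborel f"
    and "(LINT \<eta>|lborel. f \<eta>) = (LINT r:{0..}|lborel. f r) + (LINT r:{0..}|lborel. f (- r))"
proof -
  have i1: "set_integrable lborel {0..} f"
    using assms by (intro set_integrable_exp_bound[of _ K]) (auto intro: continuous_on_subset simp: order.trans[OF assms(2)])
  have i2: "set_integrable lborel {0..} (\<lambda>r. f (- r))"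
  proof (rule set_integrable_exp_bound[of _ K])
    show "continuous_on {0..} (\<lambda>r. f (- r))"
      by (rule continuous_on_compose2[OF assms(1)]) (auto intro!: continuous_intros)
    show "norm (f (- r)) \<le> K * exp (- r)" if "r \<ge> 0" for r using assms(2)[of "- r"] that by simp
  qed
  have i3: "set_integrable lborel {..0} f"
    using i2 lborel_integrable_real_affine[of "\<lambda>x. indicat_real {0..} x *\<^sub>R f (- x)" "-1" 0]
    by (auto simp: set_integrable_def indicator_def cong: if_cong)
  have e3: "(LINT r:{..0}|lborel. f r) = (LINT r:{0..}|lborel. f (- r))"
    unfolding set_lebesgue_integral_def
    by (subst lborel_integral_real_affine[of "-1" _ 0]) (auto simp: indicator_def intro!: Bochner_Integration.integral_cong)
  have i4: "set_integrable lborel {0<..} f" by (rule set_integrable_subset[OF i1]) auto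
  have "set_integrable lborel ({..0} \<union> {0<..}) f" by (rule set_integrable_Un[OF i3 i4]) auto
  moreover have "{..0} \<union> {0<..} = (UNIV :: real set)" by auto
  ultimately show "integrable lborel f" by (simp add: set_integrable_def)
  have "(LINT r:{..0} \<union> {0<..}|lborel. f r) = (LINT r:{..0}|lborel. f r) + (LINT r:{0<..}|lborel. f r)"
    by (rule set_integral_Un[OF _ i3 i4]) auto
  also have "(LINT r:{0<..}|lborel. f r) = (LINT r:{0..}|lborel. f r)"
    unfolding set_lebesgue_integral_def
    by (rule integral_cong_AE)
       (use i1 i4 AE_lborel_singleton[of "0::real"] in \<open>auto simp: set_integrable_def indicator_def elim!: eventually_mono\<close>)
  finally show "(LINT \<eta>|lborel. f \<eta>) = (LINT r:{0..}|lborel. f r) + (LINT r:{0..}|lborel. f (- r))"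
    using \<open>{..0} \<union> {0<..} = UNIV\<close> e3 by (simp add: set_lebesgue_integral_def)
qed

text \<open>Upper and lower half-lines are moved separately. Each move leaves behind the integral
  over the segment from x0 to x1, and these two contributions cancel in the difference.\<close>

lemma vertical_line_shift:
  fixes f :: "complex \<Rightarrow> complex"
  assumes hol: "f holomorphic_on UNIV"
    and bnd: "\<And>z. Re z \<in> closed_segment x0 x1 \<Longrightarrow> norm (f z) \<le> K * exp (- \<bar>Im z\<bar>)"
  shows "integrable lborel (\<lambda>\<eta>. f (Complex x0 \<eta>))" "integrable lborel (\<lambda>\<eta>. f (Complex x1 \<eta>))"
    and "(LINT \<eta>|lborel. f (Complex x0 \<eta>)) = (LINT \<eta>|lborel. f (Complex x1 \<eta>))"
proof -
  have cont: "continuous_on UNIV f" using hol by (rule holomorphic_on_imp_continuous_on)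
  have Cx: "Complex x \<eta> = of_real x + of_real \<eta> * \<i>" for x \<eta> by (simp add: complex_eq_iff)
  have cx: "continuous_on A (\<lambda>\<eta>. f (Complex x \<eta>))" for x A
    unfolding Cx by (rule continuous_on_compose2[OF cont]) (auto intro!: continuous_intros)
  have bx: "norm (f (Complex x \<eta>)) \<le> K * exp (- \<bar>\<eta>\<bar>)" if "x = x0 \<or> x = x1" for x \<eta>
    using bnd[of "Complex x \<eta>"] that by auto
  show "integrable lborel (\<lambda>\<eta>. f (Complex x0 \<eta>))" "integrable lborel (\<lambda>\<eta>. f (Complex x1 \<eta>))"
    using line_integral_split(1)[OF cx bx] by auto
  have K: "K \<ge> 0" using order.trans[OF norm_ge_zero bx[of x0 0]] by simp
  have half: "(LINT r:{0..}|lborel. f (of_real x0 + of_real r * d) * d) - (LINT r:{0..}|lborel. f (of_real x1 + of_real r * d) * d)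
     = contour_integral (linepath (of_real x0) (of_real x1)) f" if d: "d = \<i> \<or> d = - \<i>" for d
  proof (rule ray_deformation[of UNIV])
    have ex: "of_real x + of_real r * d = Complex x (if d = \<i> then r else - r)" for x r
      using d by (auto simp: complex_eq_iff)
    have int: "set_integrable lborel {0..} (\<lambda>r. f (of_real x + of_real r * d) * d)" if "x = x0 \<or> x = x1" for x
    proof (rule set_integrable_exp_bound[of _ K])
      show "continuous_on {0..} (\<lambda>r. f (of_real x + of_real r * d) * d)"
        by (intro continuous_intros continuous_on_compose2[OF cont]) auto
      show "norm (f (of_real x + of_real r * d) * d) \<le> K * exp (- r)" if "r \<ge> 0" for r
        using bx[OF \<open>x = x0 \<or> x = x1\<close>, of "if d = \<i> then r else - r"] d that unfolding ex norm_mult by auto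
    qed
    show "set_integrable lborel {0..} (\<lambda>r. f (of_real x0 + of_real r * d) * d)"
      "set_integrable lborel {0..} (\<lambda>r. f (of_real x1 + of_real r * d) * d)" using int by auto
    show "((\<lambda>R. contour_integral (linepath (of_real x0 + of_real R * d) (of_real x1 + of_real R * d)) f) \<longlongrightarrow> 0) at_top"
    proof (rule exp_neg_times_tendsto_0[where K = K and A = "\<bar>x1 - x0\<bar>" and B = 0])
      show "\<forall>\<^sub>F R in at_top. norm (contour_integral (linepath (of_real x0 + of_real R * d) (of_real x1 + of_real R * d)) f)
          \<le> K * exp (- R) * (\<bar>x1 - x0\<bar> + 0 * R)"
        using eventually_ge_at_top[of 0]
      proof eventually_elim
        case (elim R)
        have "norm (contour_integral (linepath (of_real x0 + of_real R * d) (of_real x1 + of_real R * d)) f)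
           \<le> K * exp (- R) * norm ((of_real x1 + of_real R * d) - (of_real x0 + of_real R * d))"
        proof (rule contour_integral_bound_linepath)
          show "f contour_integrable_on linepath (of_real x0 + of_real R * d) (of_real x1 + of_real R * d)"
            by (rule contour_integrable_continuous_linepath) (rule continuous_on_subset[OF cont], simp)
          show "0 \<le> K * exp (- R)" using K by simp
          fix z assume "z \<in> closed_segment (of_real x0 + of_real R * d) (of_real x1 + of_real R * d)"
          then obtain u where u: "0 \<le> u" "u \<le> 1" "z = (1 - u) *\<^sub>R (of_real x0 + of_real R * d) + u *\<^sub>R (of_real x1 + of_real R * d)"
            by (auto simp: in_segment)
          have "Re z = (1 - u) * x0 + u * x1" "\<bar>Im z\<bar> = R"
            unfolding u(3) using d elim by (auto simp: algebra_simps)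
          then show "norm (f z) \<le> K * exp (- R)" using bnd[of z] u by (auto simp: in_segment)
        qed
        also have "norm ((of_real x1 + of_real R * d) - (of_real x0 + of_real R * d)) = \<bar>x1 - x0\<bar>"
          by (simp flip: of_real_diff)
        finally show ?case by simp
      qed
    qed
  qed (use hol in auto)
  have m: "(LINT r:{0..}|lborel. g r * (- \<i>)) = (LINT r:{0..}|lborel. g r) * (- \<i>)"
    and m': "(LINT r:{0..}|lborel. g r * \<i>) = (LINT r:{0..}|lborel. g r) * \<i>" for g :: "real \<Rightarrow> complex"
    by (rule set_integral_mult_left)+
  have sp: "(LINT \<eta>|lborel. f (Complex x \<eta>)) * \<i> = (LINT r:{0..}|lborel. f (of_real x + of_real r * \<i>) * \<i>)
      - (LINT r:{0..}|lborel. f (of_real x + of_real r * (- \<i>)) * (- \<i>))" if "x = x0 \<or> x = x1" for x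
    using line_integral_split(2)[OF cx bx[OF that]] unfolding m m'
    by (simp add: Cx distrib_right)
  have "(LINT \<eta>|lborel. f (Complex x0 \<eta>)) * \<i> = (LINT \<eta>|lborel. f (Complex x1 \<eta>)) * \<i>"
    using sp[of x0] sp[of x1] half[of \<i>] half[of "- \<i>"] by (simp only: simp_thms) (metis (no_types, lifting) diff_eq_eq add_diff_cancel_left' diff_add_eq diff_diff_eq2 add.commute)
  then show "(LINT \<eta>|lborel. f (Complex x0 \<eta>)) = (LINT \<eta>|lborel. f (Complex x1 \<eta>))" by simp
qed

text \<open>The angle is \<open>\<pi>/6\<close>.\<close>
definition d0 :: complex where "d0 = Complex (sqrt 3 / 2) (1/2)"

section \<open>Triangles with a vertex at the critical point\<close>

lemma dir_d0: "dir d0" "dir (cnj d0)"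
  by (simp_all add: dir_def d0_def complex_eq_iff)

text \<open>The closed sector with apex \<open>xs\<close> and half-opening \<pi>/6 around the
  direction s = 1 or s = -1. The vertical line through \<open>xs\<close> meets it only at the
  apex.\<close>

definition wedge :: "real \<Rightarrow> real \<Rightarrow> complex set" where
  "wedge xs s = {z. sqrt 3 * \<bar>Im z\<bar> \<le> s * (Re z - xs)}"

text \<open>The factor s = -1 is a rotation by \<pi>, not a reflection, so both triangles are
  positively oriented.\<close>

definition tri :: "real \<Rightarrow> real \<Rightarrow> real \<Rightarrow> real \<Rightarrow> complex" where
  "tri xs s R = linepath (of_real xs) (of_real xs + of_real R * (of_real s * cnj d0)) +++
     linepath (of_real xs + of_real R * (of_real s * cnj d0)) (of_real xs + of_real R * (of_real s * d0)) +++
     linepath (of_real xs + of_real R * (of_real s * d0)) (of_real xs)"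

lemma convex_wedge: "convex (wedge xs s)"
proof (rule convexI)
  fix x y :: complex and u v :: real
  assume a: "x \<in> wedge xs s" "y \<in> wedge xs s" "0 \<le> u" "0 \<le> v" "u + v = 1"
  have "sqrt 3 * \<bar>u * Im x + v * Im y\<bar> \<le> sqrt 3 * (u * \<bar>Im x\<bar> + v * \<bar>Im y\<bar>)"
    using a abs_triangle_ineq[of "u * Im x" "v * Im y"] by (intro mult_left_mono) (auto simp: abs_mult)
  also have "\<dots> = u * (sqrt 3 * \<bar>Im x\<bar>) + v * (sqrt 3 * \<bar>Im y\<bar>)" by (simp add: algebra_simps)
  also have "\<dots> \<le> u * (s * (Re x - xs)) + v * (s * (Re y - xs))"
    using a by (intro add_mono mult_left_mono) (auto simp: wedge_def)
  also have "\<dots> = s * (u * Re x + v * Re y - (u + v) * xs)" by (simp add: algebra_simps)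
  finally show "u *\<^sub>R x + v *\<^sub>R y \<in> wedge xs s" using a by (simp add: wedge_def)
qed

lemma ray_in_wedge:
  assumes "dir d" "s = 1 \<or> s = -1" "r \<ge> 0"
  shows "of_real xs + of_real r * (of_real s * d) \<in> wedge xs s"
  using assms(2,3) by (auto simp: wedge_def abs_mult dir_facts(2,5)[OF assms(1)])

lemma valid_tri: "valid_path (tri xs s R)" "pathfinish (tri xs s R) = pathstart (tri xs s R)"
  by (auto simp: tri_def intro!: valid_path_join)

lemma path_image_tri:
  "path_image (tri xs s R) = closed_segment (of_real xs) (of_real xs + of_real R * (of_real s * cnj d0)) \<union>
     closed_segment (of_real xs + of_real R * (of_real s * cnj d0)) (of_real xs + of_real R * (of_real s * d0)) \<union>
     closed_segment (of_real xs + of_real R * (of_real s * d0)) (of_real xs)"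
  by (simp add: tri_def path_image_join Un_assoc)

lemma path_image_tri_subset:
  assumes "s = 1 \<or> s = -1" "R \<ge> 0"
  shows "path_image (tri xs s R) \<subseteq> wedge xs s"
proof -
  have "of_real xs \<in> wedge xs s" by (simp add: wedge_def)
  then show ?thesis unfolding path_image_tri
    using ray_in_wedge[OF dir_d0(1) assms] ray_in_wedge[OF dir_d0(2) assms] convex_wedge
    by (intro Un_least closed_segment_subset) auto
qed

lemma tri_winding_outside:
  assumes "s = 1 \<or> s = -1" "R \<ge> 0" "z \<notin> wedge xs s"
  shows "winding_number (tri xs s R) z = 0"
  using winding_number_zero_outside[OF valid_path_imp_path[OF valid_tri(1)] convex_wedge valid_tri(2) assms(3)
      path_image_tri_subset[OF assms(1,2)]] .

lemma tri_winding_inside: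
  assumes s: "s = 1 \<or> s = -1" and R: "R > 0" and b: "0 < s * (b - xs)" "s * (b - xs) < R * (sqrt 3 / 2)"
  shows "winding_number (tri xs s R) (of_real b) = 1" "of_real b \<notin> path_image (tri xs s R)"
proof -
  let ?a = "of_real xs :: complex" and ?p = "of_real xs + of_real R * (of_real s * cnj d0)"
    and ?q = "of_real xs + of_real R * (of_real s * d0)"
  have n1: "of_real b \<notin> closed_segment ?a (?a + of_real R * (of_real s * d))" if d: "dir d" for d
  proof
    assume "of_real b \<in> closed_segment ?a (?a + of_real R * (of_real s * d))"
    then obtain u where u: "of_real b = (1 - u) *\<^sub>R ?a + u *\<^sub>R (?a + of_real R * (of_real s * d))"
      by (auto simp: in_segment)
    from arg_cong[OF u, of Im] have "u * (R * (s * Im d)) = 0" by simp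
    then have "u = 0" using R s dir_facts(5)[OF d] by auto
    then show False using u b by simp
  qed
  have n2: "of_real b \<notin> closed_segment ?p ?q"
  proof
    assume "of_real b \<in> closed_segment ?p ?q"
    then obtain u where u: "of_real b = (1 - u) *\<^sub>R ?p + u *\<^sub>R ?q" by (auto simp: in_segment)
    from arg_cong[OF u, of Re] have "b = xs + R * (s * (sqrt 3 / 2))" by (simp add: d0_def algebra_simps)
    then show False using b s by auto
  qed
  show npi: "of_real b \<notin> path_image (tri xs s R)"
    using n1[OF dir_d0(2)] n1[OF dir_d0(1)] n2 unfolding path_image_tri by (simp add: closed_segment_commute)
  have "of_real b \<in> convex hull {?a, ?p, ?q}"
  proof -
    \<comment> \<open>\<open>t\<close> is the position of \<open>b\<close> on the axis of the
      triangle, 0 at the vertex and 1 at the opposite side; by symmetry the other two vertices get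
      barycentric weight t/2 each.\<close>
    define t where "t = s * (b - xs) / (R * (sqrt 3 / 2))"
    have t: "0 < t" "t < 1" using b R by (simp_all add: t_def)
    have "t * (R * (sqrt 3 / 2)) = s * (b - xs)" using R by (simp add: t_def)
    then have "t * (R * (s * (sqrt 3 / 2))) = b - xs" using s by auto
    then have "(1 - t) *\<^sub>R ?a + (t / 2) *\<^sub>R ?p + (t / 2) *\<^sub>R ?q = of_real b"
      by (simp add: complex_eq_iff d0_def algebra_simps)
    then show ?thesis unfolding convex_hull_3 using t
      by (intro CollectI exI[of _ "1 - t"] exI[of _ "t / 2"] conjI) auto
  qed
  then have "of_real b \<in> interior (convex hull {?a, ?p, ?q})"
    using npi unfolding interior_of_triangle[OF DIM_complex] path_image_tri by blast
  from winding_number_triangle[OF this]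
  have "winding_number (tri xs s R) (of_real b) = (if 0 < Im ((?p - ?a) * cnj (?p - of_real b)) then 1 else - 1)"
    unfolding tri_def .
  moreover have "0 < Im ((?p - ?a) * cnj (?p - of_real b))"
  proof -
    have "Im ((?p - ?a) * cnj (?p - of_real b)) = R * (s * (b - xs)) / 2"
      by (simp add: d0_def algebra_simps)
    also have "\<dots> > 0" using R b by simp
    finally show ?thesis .
  qed
  ultimately show "winding_number (tri xs s R) (of_real b) = 1" by (simp only: if_True)
qed

text \<open>All poles are real and different from \<open>xs\<close>, so each lies inside exactly one
  of the two large triangles. Both sides are therefore the full sum of residues.\<close>

lemma contour_integral_split_triangles:
  fixes B :: "real set"
  assumes B: "finite B" and hol: "f holomorphic_on (UNIV - of_real ` B)"
    and g: "valid_path g" "pathfinish g = pathstart g"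
    and gB: "\<And>b. b \<in> B \<Longrightarrow> of_real b \<notin> path_image g \<and> winding_number g (of_real b) = 1"
    and R: "R > 0" "\<And>b. b \<in> B \<Longrightarrow> b \<noteq> xs \<and> \<bar>b - xs\<bar> < R * (sqrt 3 / 2)"
  shows "contour_integral g f = contour_integral (tri xs 1 R) f + contour_integral (tri xs (-1) R) f"
proof -
  have res: "contour_integral p f = 2 * pi * \<i> * (\<Sum>w\<in>of_real ` B. winding_number p w * residue f w)"
    if "valid_path p" "pathfinish p = pathstart p" "\<And>b. b \<in> B \<Longrightarrow> of_real b \<notin> path_image p" for p
    using that B hol by (intro Residue_theorem[of UNIV]) auto
  have out: "of_real b \<notin> path_image (tri xs s R)" "winding_number (tri xs s R) (of_real b) = 0"
    if "s = 1 \<or> s = -1" "s * (b - xs) < 0" for s b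
  proof -
    have "of_real b \<notin> wedge xs s" using that by (simp add: wedge_def)
    then show "of_real b \<notin> path_image (tri xs s R)" "winding_number (tri xs s R) (of_real b) = 0"
      using path_image_tri_subset[of s R xs] tri_winding_outside[of s R "of_real b" xs] that R by auto
  qed
  have w: "of_real b \<notin> path_image (tri xs 1 R)" "of_real b \<notin> path_image (tri xs (-1) R)"
      "winding_number (tri xs 1 R) (of_real b) + winding_number (tri xs (-1) R) (of_real b) = 1" if bB: "b \<in> B" for b
  proof -
    consider "b > xs" | "b < xs" using R(2)[OF bB] by linarith
    then have "of_real b \<notin> path_image (tri xs 1 R) \<and> of_real b \<notin> path_image (tri xs (-1) R) \<and>
      winding_number (tri xs 1 R) (of_real b) + winding_number (tri xs (-1) R) (of_real b) = 1"
    proof cases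
      case 1
      then show ?thesis using out[of "-1" b] tri_winding_inside[of 1 R b xs] R(2)[OF bB] R(1) by auto
    next
      case 2
      then show ?thesis using out[of 1 b] tri_winding_inside[of "-1" R b xs] R(2)[OF bB] R(1) by auto
    qed
    then show "of_real b \<notin> path_image (tri xs 1 R)" "of_real b \<notin> path_image (tri xs (-1) R)"
      "winding_number (tri xs 1 R) (of_real b) + winding_number (tri xs (-1) R) (of_real b) = 1" by auto
  qed
  have "(\<Sum>w\<in>of_real ` B. winding_number g w * residue f w) = (\<Sum>w\<in>of_real ` B. residue f w)"
    by (intro sum.cong) (use gB in auto)
  then have "contour_integral g f = 2 * pi * \<i> * (\<Sum>w\<in>of_real ` B. residue f w)"
    using res[OF g] gB by simp
  moreover have "contour_integral (tri xs 1 R) f + contour_integral (tri xs (-1) R) f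
     = 2 * pi * \<i> * (\<Sum>z\<in>of_real ` B. (winding_number (tri xs 1 R) z + winding_number (tri xs (-1) R) z) * residue f z)"
    using res[OF valid_tri, of xs 1 R] res[OF valid_tri, of xs "-1" R] w by (simp add: sum.distrib distrib_left distrib_right)
  moreover have "(\<Sum>z\<in>of_real ` B. (winding_number (tri xs 1 R) z + winding_number (tri xs (-1) R) z) * residue f z)
     = (\<Sum>z\<in>of_real ` B. residue f z)"
    using w(3) by (intro sum.cong) auto
  ultimately show ?thesis by simp
qed

section \<open>The inner integral as an entire function of z\<close>

lemma prod_minus_prod_eq:
  fixes z w :: complex
  shows "(\<Prod>j<n. z - b j) - (\<Prod>j<n. w - b j) = (z - w) * (\<Sum>i<n. (\<Prod>j\<in>{Suc i..<n}. z - b j) * (\<Prod>j<i. w - b j))"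
proof (induction n)
  case (Suc n)
  have "(\<Sum>i<Suc n. (\<Prod>j\<in>{Suc i..<Suc n}. z - b j) * (\<Prod>j<i. w - b j))
     = (\<Sum>i<n. (\<Prod>j\<in>{Suc i..<n}. z - b j) * (\<Prod>j<i. w - b j)) * (z - b n) + (\<Prod>j<n. w - b j)"
    by (simp add: sum_distrib_left sum_distrib_right mult_ac)
  moreover have "P * (z - b n) - Q * (w - b n) = (z - w) * (S * (z - b n) + Q)" if "P - Q = (z - w) * S" for P Q S
  proof -
    have "P * (z - b n) - Q * (w - b n) = (P - Q) * (z - b n) + (z - w) * Q" by (simp add: algebra_simps)
    then show ?thesis unfolding that by (simp add: algebra_simps)
  qed
  ultimately show ?case using Suc.IH unfolding prod.lessThan_Suc by simp
qed simp

text \<open>With q(w) the product in the denominator, q(z)/(z - w) is split into (q(z) - q(w))/(z -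
  w), a polynomial, and q(w)/(z - w). In the second part q(w) cancels and Cauchy's formula gives 0,
  since the path does not wind around z. The right-hand side is a polynomial in z times A, hence
  meaningful also for z on or inside the path.\<close>

lemma contour_integral_rational_kernel:
  fixes b :: "nat \<Rightarrow> complex"
  assumes h: "h holomorphic_on UNIV" and g: "valid_path g" "pathfinish g = pathstart g"
    and gb: "\<And>j. j < n \<Longrightarrow> b j \<notin> path_image g"
    and z: "z \<notin> path_image g" "winding_number g z = 0"
  shows "contour_integral g (\<lambda>w. A * (\<Prod>j<n. z - b j) * (h w / (\<Prod>j<n. w - b j)) / (z - w))
     = A * (\<Sum>i<n. (\<Prod>j\<in>{Suc i..<n}. z - b j) * contour_integral g (\<lambda>w. (\<Prod>j<i. w - b j) * (h w / (\<Prod>j<n. w - b j))))"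
proof -
  let ?q = "\<lambda>w. \<Prod>j<n. w - b j"
  let ?c = "\<lambda>i w. (\<Prod>j<i. w - b j) * (h w / ?q w)"
  have q0: "?q w \<noteq> 0" if "w \<in> - (b ` {..<n})" for w using that by auto
  have opn: "open (- (b ` {..<n}))" by (simp add: finite_imp_closed open_Compl)
  have sub: "path_image g \<subseteq> - (b ` {..<n})" using gb by auto
  have ci: "(\<lambda>w. ?c i w) contour_integrable_on g" for i
    by (rule contour_integrable_holomorphic_simple[OF _ opn g(1) sub])
       (use q0 in \<open>auto intro!: holomorphic_intros holomorphic_on_subset[OF h]\<close>)
  have C: "((\<lambda>w. h w / (w - z)) has_contour_integral (2 * pi * \<i> * winding_number g z * h z)) g"
    using Cauchy_integral_formula_convex_simple[OF convex_UNIV h _ g(1) _ g(2), of z] z by auto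
  then have C0: "((\<lambda>w. - (h w / (w - z))) has_contour_integral 0) g"
    using has_contour_integral_neg[OF C] z by simp
  have "((\<lambda>w. (\<Sum>i<n. (\<Prod>j\<in>{Suc i..<n}. z - b j) * ?c i w) + - (h w / (w - z))) has_contour_integral
     (\<Sum>i<n. (\<Prod>j\<in>{Suc i..<n}. z - b j) * contour_integral g (?c i)) + 0) g"
    by (intro has_contour_integral_add C0 has_contour_integral_sum has_contour_integral_lmul
        has_contour_integral_integral ci) auto
  then have "((\<lambda>w. ?q z * (h w / ?q w) / (z - w)) has_contour_integral
     (\<Sum>i<n. (\<Prod>j\<in>{Suc i..<n}. z - b j) * contour_integral g (?c i)) + 0) g"
  proof (rule has_contour_integral_eq)
    fix w assume w: "w \<in> path_image g"
    then have ne: "?q w \<noteq> 0" "z - w \<noteq> 0" using q0 sub z by auto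
    have "(\<Sum>i<n. (\<Prod>j\<in>{Suc i..<n}. z - b j) * ?c i w)
      = (\<Sum>i<n. (\<Prod>j\<in>{Suc i..<n}. z - b j) * (\<Prod>j<i. w - b j)) * (h w / ?q w)"
      by (simp add: sum_distrib_right sum_distrib_left sum_divide_distrib mult.assoc)
    also have "(\<Sum>i<n. (\<Prod>j\<in>{Suc i..<n}. z - b j) * (\<Prod>j<i. w - b j)) = (?q z - ?q w) / (z - w)"
      using prod_minus_prod_eq[of z b n w] ne by simp
    finally have "(\<Sum>i<n. (\<Prod>j\<in>{Suc i..<n}. z - b j) * ?c i w) = (?q z - ?q w) / (z - w) * (h w / ?q w)" .
    moreover have "(Q - q) / e * (H / q) + - (H / - e) = Q * (H / q) / e" if "q \<noteq> 0" "e \<noteq> 0" for Q q H e :: complex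
      using that by (simp add: field_simps)
    note this[OF ne, of "?q z" "h w"]
    ultimately show "(\<Sum>i<n. (\<Prod>j\<in>{Suc i..<n}. z - b j) * ?c i w) + - (h w / (w - z)) = ?q z * (h w / ?q w) / (z - w)"
      by (simp only: minus_diff_eq)
  qed
  then have "((\<lambda>w. A * (?q z * (h w / ?q w) / (z - w))) has_contour_integral
     A * (\<Sum>i<n. (\<Prod>j\<in>{Suc i..<n}. z - b j) * contour_integral g (?c i))) g"
    by (simp only: add_0_right has_contour_integral_lmul)
  then show ?thesis by (simp add: contour_integral_unique mult.assoc)
qed

section \<open>Opening the triangles to four rays\<close>

definition rayd :: "complex \<Rightarrow> (complex \<Rightarrow> complex) \<Rightarrow> complex" where
  "rayd d f = (LINT r:{0..}|lborel. f (of_real r * d) * d)"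

text \<open>The signs come from the triangles: each is left along the ray of \<open>cnj d0\<close>
  (or its opposite) and re-entered along that of \<open>d0\<close>.\<close>

definition four_rays :: "(complex \<Rightarrow> complex) \<Rightarrow> complex" where
  "four_rays f = rayd (cnj d0) f - rayd d0 f + (rayd (- cnj d0) f - rayd (- d0) f)"

text \<open>With \<rho> = s (Re w - xs), the wedge gives 3 (Im w)^2 \<le> \<rho>^2, so Re ((w -
  x)^2) is at least 2/3 \<rho>^2 up to a linear term; \<open>m^2 * 3 / (8 * a)\<close> is the
  maximum of m \<rho> - (2a/3) \<rho>^2. The rate 2 is chosen because \<rho> = r sqrt 3 / 2 on the
  rays, whence 2\<rho> \<ge> r.\<close>

lemma wedge_gauss_bound:
  fixes a x xs s :: real
  assumes a: "a > 0" and s: "s = 1 \<or> s = -1"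
  obtains K where "K > 0" "\<And>w. w \<in> wedge xs s \<Longrightarrow> norm (exp (- of_real a * (w - of_real x)^2)) \<le> K * exp (- (2 * (s * (Re w - xs))))"
proof -
  define D where "D = \<bar>xs - x\<bar>"
  define m where "m = 2 * a * D + 2"
  define K where "K = exp (m^2 * 3 / (8 * a))"
  have "norm (exp (- of_real a * (w - of_real x)^2)) \<le> K * exp (- (2 * (s * (Re w - xs))))" if w: "w \<in> wedge xs s" for w
  proof -
    define \<rho> where "\<rho> = s * (Re w - xs)"
    have "sqrt 3 * \<bar>Im w\<bar> \<le> \<rho>" using w by (simp add: wedge_def \<rho>_def)
    moreover then have \<rho>: "0 \<le> \<rho>" by (rule order.trans[rotated]) simp
    ultimately have "(sqrt 3 * \<bar>Im w\<bar>)^2 \<le> \<rho>^2" by (intro power_mono) auto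
    then have im: "3 * (Im w)^2 \<le> \<rho>^2" by (simp add: power_mult_distrib)
    have re: "Re w - x = s * \<rho> + (xs - x)" using s by (auto simp: \<rho>_def)
    have "(Re w - x)^2 \<ge> \<rho>^2 - 2 * \<rho> * D"
    proof -
      have "(Re w - x)^2 = \<rho>^2 + 2 * (s * \<rho> * (xs - x)) + (xs - x)^2"
        unfolding re using s by (auto simp: power2_eq_square algebra_simps)
      moreover have "\<bar>s * \<rho> * (xs - x)\<bar> = \<rho> * D" using s \<rho> by (auto simp: D_def abs_mult)
      moreover have "(xs - x)^2 \<ge> 0" by simp
      ultimately show ?thesis by linarith
    qed
    then have "(Re w - x)^2 - (Im w)^2 \<ge> 2/3 * \<rho>^2 - 2 * \<rho> * D" using im by linarith
    then have "a * (2/3 * \<rho>^2 - 2 * \<rho> * D) \<le> a * ((Re w - x)^2 - (Im w)^2)" using a by (intro mult_left_mono) auto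
    then have "- (a * ((Re w - x)^2 - (Im w)^2)) \<le> - (2 * a / 3 * \<rho>^2) + 2 * a * D * \<rho>"
      by (simp add: algebra_simps)
    also have "\<dots> \<le> m^2 * 3 / (8 * a) - 2 * \<rho>"
    proof -
      have "0 \<le> 2 * a / 3 * (\<rho> - 3 * m / (4 * a))^2" using a by simp
      also have "\<dots> = 2 * a / 3 * \<rho>^2 - m * \<rho> + m^2 * 3 / (8 * a)"
        using a by (simp add: power2_eq_square field_simps)
      finally show ?thesis by (simp add: m_def algebra_simps)
    qed
    finally have "- (a * ((Re w - x)^2 - (Im w)^2)) \<le> m^2 * 3 / (8 * a) - 2 * \<rho>" .
    then have "exp (- (a * ((Re w - x)^2 - (Im w)^2))) \<le> K * exp (- (2 * \<rho>))"
      unfolding K_def exp_add[symmetric] by simp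
    moreover have "norm (exp (- of_real a * (w - of_real x)^2)) = exp (- (a * ((Re w - x)^2 - (Im w)^2)))"
      by (simp add: norm_exp_eq_Re power2_eq_square)
    ultimately show ?thesis by (simp only: \<rho>_def)
  qed
  then show ?thesis using that[of K] by (simp add: K_def)
qed

text \<open>The two sides at the apex become rays, and the third side has length R while the
  integrand on it is at most K exp(-R).\<close>

lemma triangle_integral_tendsto:
  fixes f :: "complex \<Rightarrow> complex"
  assumes cont: "continuous_on U f"
    and rayU: "\<And>d r. dir d \<Longrightarrow> r \<ge> 0 \<Longrightarrow> of_real xs + of_real r * (of_real s * d) \<in> U"
    and s: "s = 1 \<or> s = -1"
    and ray: "\<And>d r. dir d \<Longrightarrow> r \<ge> 0 \<Longrightarrow> norm (f (of_real xs + of_real r * (of_real s * d))) \<le> K * exp (- r)"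
    and chord: "\<And>R w. R \<ge> Rm \<Longrightarrow> w \<in> closed_segment (of_real xs + of_real R * (of_real s * cnj d0)) (of_real xs + of_real R * (of_real s * d0))
        \<Longrightarrow> w \<in> U \<and> norm (f w) \<le> K * exp (- R)"
  shows "((\<lambda>R. contour_integral (tri xs s R) f) \<longlongrightarrow>
     rayd (of_real s * cnj d0) (\<lambda>\<omega>. f (of_real xs + \<omega>)) - rayd (of_real s * d0) (\<lambda>\<omega>. f (of_real xs + \<omega>))) at_top"
proof -
  let ?e = "\<lambda>R d. of_real xs + of_real R * (of_real s * d) :: complex"
  have K: "K \<ge> 0" using order.trans[OF norm_ge_zero ray[OF dir_d0(1), of 0]] by simp
  have nd: "norm (of_real s * d) = 1" if "dir d" for d using s dir_facts(1)[OF that] by (auto simp: norm_mult)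
  have int: "set_integrable lborel {0..} (\<lambda>r. f (?e r d) * (of_real s * d))" if d: "dir d" for d
  proof (rule set_integrable_exp_bound[of _ K])
    show "continuous_on {0..} (\<lambda>r. f (?e r d) * (of_real s * d))"
      by (intro continuous_intros continuous_on_compose2[OF cont]) (use rayU[OF d] in auto)
    show "norm (f (?e r d) * (of_real s * d)) \<le> K * exp (- r)" if "r \<ge> 0" for r
      unfolding norm_mult[of "f _"] nd[OF d] using ray[OF d that] by simp
  qed
  have lim: "((\<lambda>R. contour_integral (linepath (of_real xs) (?e R d)) f) \<longlongrightarrow>
     rayd (of_real s * d) (\<lambda>\<omega>. f (of_real xs + \<omega>))) at_top" if d: "dir d" for d
    unfolding rayd_def by (rule contour_integral_ray_tendsto[OF int[OF d]])
  have ch: "((\<lambda>R. contour_integral (linepath (?e R (cnj d0)) (?e R d0)) f) \<longlongrightarrow> 0) at_top"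
  proof (rule exp_neg_times_tendsto_0[where K = K and A = 0 and B = 1])
    show "\<forall>\<^sub>F R in at_top. norm (contour_integral (linepath (?e R (cnj d0)) (?e R d0)) f) \<le> K * exp (- R) * (0 + 1 * R)"
      using eventually_ge_at_top[of "max Rm 0"]
    proof eventually_elim
      case (elim R)
      have "norm (contour_integral (linepath (?e R (cnj d0)) (?e R d0)) f) \<le> K * exp (- R) * norm (?e R d0 - ?e R (cnj d0))"
      proof (rule contour_integral_bound_linepath)
        show "f contour_integrable_on linepath (?e R (cnj d0)) (?e R d0)"
          by (rule contour_integrable_continuous_linepath, rule continuous_on_subset[OF cont])
             (use chord[of R] elim in auto)
      qed (use K chord[of R] elim in auto)
      also have "?e R d0 - ?e R (cnj d0) = of_real (R * s) * \<i>" by (simp add: d0_def complex_eq_iff)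
      also have "norm (of_real (R * s) * \<i>) = R" using s elim by (auto simp: norm_mult)
      finally show ?case by simp
    qed
  qed
  have "((\<lambda>R. contour_integral (linepath (of_real xs) (?e R (cnj d0))) f
      + contour_integral (linepath (?e R (cnj d0)) (?e R d0)) f - contour_integral (linepath (of_real xs) (?e R d0)) f) \<longlongrightarrow>
     rayd (of_real s * cnj d0) (\<lambda>\<omega>. f (of_real xs + \<omega>)) + 0 - rayd (of_real s * d0) (\<lambda>\<omega>. f (of_real xs + \<omega>))) at_top"
    by (intro tendsto_intros lim ch dir_d0)
  then have L: "((\<lambda>R. contour_integral (linepath (of_real xs) (?e R (cnj d0))) f
      + contour_integral (linepath (?e R (cnj d0)) (?e R d0)) f - contour_integral (linepath (of_real xs) (?e R d0)) f) \<longlongrightarrow>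
     rayd (of_real s * cnj d0) (\<lambda>\<omega>. f (of_real xs + \<omega>)) - rayd (of_real s * d0) (\<lambda>\<omega>. f (of_real xs + \<omega>))) at_top"
    by simp
  show ?thesis
  proof (rule Lim_transform_eventually[OF L])
    show "\<forall>\<^sub>F R in at_top. contour_integral (linepath (of_real xs) (?e R (cnj d0))) f
      + contour_integral (linepath (?e R (cnj d0)) (?e R d0)) f - contour_integral (linepath (of_real xs) (?e R d0)) f
      = contour_integral (tri xs s R) f"
      using eventually_ge_at_top[of "max Rm 0"]
    proof eventually_elim
      case (elim R)
      have seg: "continuous_on (closed_segment (of_real xs) (?e R d)) f" if d: "dir d" for d
      proof (rule continuous_on_subset[OF cont], rule subsetI)
        fix w assume "w \<in> closed_segment (of_real xs) (?e R d)"
        then obtain u where u: "0 \<le> u" "w = (1 - u) *\<^sub>R of_real xs + u *\<^sub>R ?e R d" by (auto simp: in_segment)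
        have "w = ?e (u * R) d" unfolding u(2) by (simp add: scaleR_conv_of_real algebra_simps)
        then show "w \<in> U" using rayU[OF d, of "u * R"] u elim by simp
      qed
      have i1: "f contour_integrable_on linepath (of_real xs) (?e R (cnj d0))"
        by (rule contour_integrable_continuous_linepath[OF seg[OF dir_d0(2)]])
      have i2: "f contour_integrable_on linepath (?e R (cnj d0)) (?e R d0)"
        by (rule contour_integrable_continuous_linepath, rule continuous_on_subset[OF cont]) (use chord[of R] elim in auto)
      have i3: "f contour_integrable_on linepath (?e R d0) (of_real xs)"
        by (rule contour_integrable_continuous_linepath) (use seg[OF dir_d0(1)] in \<open>simp add: closed_segment_commute\<close>)
      have "contour_integral (tri xs s R) f = contour_integral (linepath (of_real xs) (?e R (cnj d0))) f
         + (contour_integral (linepath (?e R (cnj d0)) (?e R d0)) f + contour_integral (linepath (?e R d0) (of_real xs)) f)"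
        unfolding tri_def using i1 i2 i3
        by (subst contour_integral_join contour_integral_join; (intro valid_path_join valid_path_linepath contour_integrable_joinI)?; simp)+
      also have "contour_integral (linepath (?e R d0) (of_real xs)) f = - contour_integral (linepath (of_real xs) (?e R d0)) f"
        using contour_integral_reverse_linepath[OF seg[OF dir_d0(1)]] by simp
      finally show ?case by simp
    qed
  qed
qed

text \<open>The exponential has modulus exp(p ((Re z - y)^2 - (Im z)^2)), so it decays like a
  Gaussian vertically. This beats the linear factors, each bounded by exp(M + \<bar>Im z\<bar>); the
  constant comes from completing the square.\<close>

lemma gauss_polynomial_strip_bound:
  fixes p y x0 x1 :: real and b :: "nat \<Rightarrow> real"
  assumes "p > 0" "finite J"
  shows "\<exists>K. \<forall>z. Re z \<in> closed_segment x0 x1 \<longrightarrow>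
     norm (exp (of_real p * (z - of_real y)^2) * (\<Prod>j\<in>J. z - of_real (b j))) \<le> K * exp (- \<bar>Im z\<bar>)"
proof (intro exI allI impI)
  define L where "L = \<bar>x0 - y\<bar> + \<bar>x1 - y\<bar>"
  define M where "M = \<bar>x0\<bar> + \<bar>x1\<bar> + (\<Sum>j\<in>J. \<bar>b j\<bar>)"
  define m where "m = real (card J)"
  fix z assume "Re z \<in> closed_segment x0 x1"
  then have r: "x0 \<le> Re z \<and> Re z \<le> x1 \<or> x1 \<le> Re z \<and> Re z \<le> x0"
    by (auto simp: closed_segment_eq_real_ivl split: if_splits)
  have "\<bar>Re z - y\<bar> \<le> L" using r unfolding L_def by linarith
  then have l: "(Re z - y)^2 \<le> L^2" by (metis abs_ge_zero power2_abs power_mono)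
  have "norm (exp (of_real p * (z - of_real y)^2)) = exp (p * ((Re z - y)^2 - (Im z)^2))"
    by (simp add: norm_exp_eq_Re power2_eq_square)
  also have "\<dots> \<le> exp (p * (L^2 - (Im z)^2))"
    unfolding exp_le_cancel_iff using l assms by (intro mult_left_mono) auto
  finally have 1: "norm (exp (of_real p * (z - of_real y)^2)) \<le> exp (p * (L^2 - (Im z)^2))" .
  have "norm (\<Prod>j\<in>J. z - of_real (b j)) \<le> (\<Prod>j\<in>J. exp (M + \<bar>Im z\<bar>))"
    unfolding prod_norm[symmetric]
  proof (intro prod_mono conjI norm_ge_zero)
    fix j assume j: "j \<in> J"
    have "\<bar>b j\<bar> \<le> (\<Sum>j\<in>J. \<bar>b j\<bar>)" using j assms by (intro member_le_sum) auto
    moreover have "norm (z - of_real (b j)) \<le> \<bar>Re z - b j\<bar> + \<bar>Im z\<bar>"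
      using cmod_le[of "z - of_real (b j)"] by simp
    ultimately have "norm (z - of_real (b j)) \<le> M + \<bar>Im z\<bar>" using r unfolding M_def by linarith
    also have "\<dots> \<le> exp (M + \<bar>Im z\<bar>)" using exp_ge_add_one_self[of "M + \<bar>Im z\<bar>"] by linarith
    finally show "norm (z - of_real (b j)) \<le> exp (M + \<bar>Im z\<bar>)" .
  qed
  also have "\<dots> = exp (m * (M + \<bar>Im z\<bar>))" by (simp add: m_def exp_of_nat_mult[symmetric])
  finally have 2: "norm (\<Prod>j\<in>J. z - of_real (b j)) \<le> exp (m * (M + \<bar>Im z\<bar>))" .
  have "p * (L^2 - (Im z)^2) + m * (M + \<bar>Im z\<bar>) \<le> p * L^2 + m * M + (m + 1)^2 / (4 * p) - \<bar>Im z\<bar>"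
  proof -
    have "0 \<le> p * (\<bar>Im z\<bar> - (m + 1) / (2 * p))^2" using assms by simp
    also have "\<dots> = p * (\<bar>Im z\<bar>^2) - (m + 1) * \<bar>Im z\<bar> + (m + 1)^2 / (4 * p)"
      using assms by (simp add: power2_eq_square field_simps)
    finally show ?thesis by (simp add: algebra_simps)
  qed
  then have "exp (p * (L^2 - (Im z)^2)) * exp (m * (M + \<bar>Im z\<bar>)) \<le> exp (p * L^2 + m * M + (m + 1)^2 / (4 * p)) * exp (- \<bar>Im z\<bar>)"
    unfolding exp_add[symmetric] by simp
  then show "norm (exp (of_real p * (z - of_real y)^2) * (\<Prod>j\<in>J. z - of_real (b j))) \<le> exp (p * L^2 + m * M + (m + 1)^2 / (4 * p)) * exp (- \<bar>Im z\<bar>)"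
    unfolding norm_mult using mult_mono[OF 1 2] by simp
qed

text \<open>The line is connected, avoids the path and is unbounded, so the winding number on it is
  the one at infinity.\<close>

lemma winding_number_line_zero:
  assumes g: "valid_path g" "pathfinish g = pathstart g" and line: "\<And>\<eta>. Complex x0 \<eta> \<notin> path_image g"
  shows "winding_number g (Complex x0 \<eta>) = 0"
proof -
  obtain B where B: "\<And>z. B \<le> norm z \<Longrightarrow> winding_number g z = 0"
    using winding_number_zero_at_infinity[OF valid_path_imp_path[OF g(1)] g(2)] by blast
  have "{z. Re z = x0} = Complex x0 ` UNIV" by (auto simp: image_iff) (metis complex.collapse)
  then have "{z. Re z = x0} \<inter> path_image g = {}" using line by auto
  moreover have "connected {z. Re z = x0}"
    by (intro convex_connected) (simp add: convex_def algebra_simps flip: distrib_right distrib_left)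
  ultimately have "winding_number g (Complex x0 \<eta>) = winding_number g (Complex x0 B)"
    using winding_number_eq[OF valid_path_imp_path[OF g(1)] g(2), of "Complex x0 \<eta>" "{z. Re z = x0}" "Complex x0 B"] by simp
  also have "\<dots> = 0" using B[of "Complex x0 B"] abs_Im_le_cmod[of "Complex x0 B"] by simp
  finally show ?thesis .
qed

text \<open>Distances to the whole line carrying the ray, by completing the square in r. The first
  is \<bar>b - xs\<bar> sin(\<pi>/6); the second, \<bar>\<eta>\<bar> sin(\<pi>/3), is weakened to
  \<bar>\<eta>\<bar>/2.\<close>

lemma norm_ge_on_ray:
  assumes d: "dir d" and s: "s = 1 \<or> s = -1"
  shows "norm (of_real xs + of_real r * (of_real s * d) - of_real b) \<ge> \<bar>b - xs\<bar> / 2"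
    and "norm (Complex xs \<eta> - (of_real xs + of_real r * (of_real s * d))) \<ge> \<bar>\<eta>\<bar> / 2"
proof -
  have im: "(Im d)^2 = 1/4" using d by (auto simp: dir_def power_divide)
  have s2: "s^2 = 1" using s by auto
  have "(norm (of_real xs + of_real r * (of_real s * d) - of_real b))^2 = (r * s * (sqrt 3 / 2) - (b - xs))^2 + (r * s * Im d)^2"
    unfolding cmod_power2 by (simp add: dir_facts(2)[OF d] algebra_simps)
  also have "\<dots> = (r - sqrt 3 / 2 * s * (b - xs))^2 + (b - xs)^2 / 4"
    unfolding power_mult_distrib im s2 power2_diff by (simp add: power_mult_distrib s2 power_divide field_simps)
  also have "\<dots> \<ge> (\<bar>b - xs\<bar> / 2)^2" by (simp add: power_divide)
  finally show "norm (of_real xs + of_real r * (of_real s * d) - of_real b) \<ge> \<bar>b - xs\<bar> / 2"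
    by (rule power2_le_imp_le) simp
  have "(norm (Complex xs \<eta> - (of_real xs + of_real r * (of_real s * d))))^2 = (r * s * (sqrt 3 / 2))^2 + (\<eta> - r * s * Im d)^2"
    unfolding cmod_power2 by (simp add: dir_facts(2)[OF d] algebra_simps)
  also have "\<dots> = (r - \<eta> * s * Im d)^2 + 3 / 4 * \<eta>^2"
    unfolding power2_diff by (simp add: power_mult_distrib im s2 power_divide field_simps)
  also have "\<dots> \<ge> (\<bar>\<eta>\<bar> / 2)^2" by (simp add: power_divide)
  finally show "norm (Complex xs \<eta> - (of_real xs + of_real r * (of_real s * d))) \<ge> \<bar>\<eta>\<bar> / 2"
    by (rule power2_le_imp_le) simp
qed

lemma kernel_triangle_tendsto:
  fixes b :: "nat \<Rightarrow> real" and a x xs s :: real and A :: complex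
  assumes a: "a > 0" and s: "s = 1 \<or> s = -1" and b: "\<And>j. j < n \<Longrightarrow> b j \<noteq> xs" and eta: "\<eta> \<noteq> 0"
  defines "f \<equiv> \<lambda>w. A * (exp (- of_real a * (w - of_real x)^2) / (\<Prod>j<n. w - of_real (b j))) / (Complex xs \<eta> - w)"
  shows "((\<lambda>R. contour_integral (tri xs s R) f) \<longlongrightarrow>
     rayd (of_real s * cnj d0) (\<lambda>\<omega>. f (of_real xs + \<omega>)) - rayd (of_real s * d0) (\<lambda>\<omega>. f (of_real xs + \<omega>))) at_top"
proof -
  obtain K where K: "K > 0" "\<And>w. w \<in> wedge xs s \<Longrightarrow> norm (exp (- of_real a * (w - of_real x)^2)) \<le> K * exp (- (2 * (s * (Re w - xs))))"
    using wedge_gauss_bound[OF a s] by blast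
  define m where "m = (\<Prod>j<n. \<bar>b j - xs\<bar> / 2) * (\<bar>\<eta>\<bar> / 2)"
  have m: "m > 0" unfolding m_def using b eta by (intro mult_pos_pos prod_pos) auto
  define K' where "K' = norm A * K * max 1 (1 / m)"
  have s3: "sqrt 3 \<ge> (1::real)" by simp
  define S where "S = (\<Sum>j<n. \<bar>b j - xs\<bar>)"
  \<comment> \<open>On the third side \<bar>Re w - xs\<bar> is at least R/2, so this choice keeps it
    at distance at least 1 from every pole.\<close>
  define R0 where "R0 = 2 + 2 * \<bar>\<eta>\<bar> + 2 * S"
  have R0: "R0 \<ge> 2" unfolding R0_def S_def by (simp add: sum_nonneg)
  show ?thesis
  proof (rule triangle_integral_tendsto[where U = "{w. (\<forall>j<n. w \<noteq> of_real (b j)) \<and> w \<noteq> Complex xs \<eta>}" and K = K' and Rm = R0])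
    show "continuous_on {w. (\<forall>j<n. w \<noteq> of_real (b j)) \<and> w \<noteq> Complex xs \<eta>} f"
      unfolding f_def by (intro continuous_intros) auto
    show "of_real xs + of_real r * (of_real s * d) \<in> {w. (\<forall>j<n. w \<noteq> of_real (b j)) \<and> w \<noteq> Complex xs \<eta>}"
      if "dir d" "r \<ge> 0" for d r
    proof (intro CollectI conjI allI impI notI)
      fix j assume "j < n" and eq: "of_real xs + of_real r * (of_real s * d) = of_real (b j)"
      then show False using norm_ge_on_ray(1)[OF that(1) s, where xs = xs and r = r and b = "b j"] b unfolding eq by simp
    next
      assume eq: "of_real xs + of_real r * (of_real s * d) = Complex xs \<eta>"
      then show False using norm_ge_on_ray(2)[OF that(1) s, where xs = xs and r = r and \<eta> = \<eta>] eta unfolding eq by simp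
    qed
    show "norm (f (of_real xs + of_real r * (of_real s * d))) \<le> K' * exp (- r)" if d: "dir d" and r: "r \<ge> 0" for d r
    proof -
      define w where "w = of_real xs + of_real r * (of_real s * d)"
      have w: "w \<in> wedge xs s" unfolding w_def by (rule ray_in_wedge[OF d s r])
      have "s * (Re w - xs) = r * (sqrt 3 / 2)" using s by (auto simp: w_def dir_facts(2)[OF d])
      then have "2 * (s * (Re w - xs)) = r * sqrt 3" by simp
      moreover have "r * 1 \<le> r * sqrt 3" using r s3 by (rule mult_left_mono[rotated])
      ultimately have e: "norm (exp (- of_real a * (w - of_real x)^2)) \<le> K * exp (- r)"
        using order.trans[OF K(2)[OF w], of "K * exp (- r)"] K(1) by simp
      have "m \<le> norm (\<Prod>j<n. w - of_real (b j)) * norm (Complex xs \<eta> - w)"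
        unfolding m_def prod_norm[symmetric] w_def
        by (intro mult_mono prod_mono conjI norm_ge_on_ray[OF d s] prod_nonneg) auto
      then have q: "inverse (norm (\<Prod>j<n. w - of_real (b j)) * norm (Complex xs \<eta> - w)) \<le> inverse m"
        using m by (rule le_imp_inverse_le)
      have "norm (f w) = norm A * norm (exp (- of_real a * (w - of_real x)^2)) * inverse (norm (\<Prod>j<n. w - of_real (b j)) * norm (Complex xs \<eta> - w))"
        unfolding f_def norm_mult norm_divide by (simp add: divide_inverse)
      also have "\<dots> \<le> norm A * (K * exp (- r)) * inverse m"
        using e q K(1) by (intro mult_mono) auto
      also have "\<dots> = norm A * K * (1 / m) * exp (- r)" by (simp add: divide_inverse)
      also have "\<dots> \<le> K' * exp (- r)" unfolding K'_def using K(1) by (intro mult_right_mono mult_left_mono) auto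
      finally show ?thesis by (simp add: w_def)
    qed
    show "w \<in> {w. (\<forall>j<n. w \<noteq> of_real (b j)) \<and> w \<noteq> Complex xs \<eta>} \<and> norm (f w) \<le> K' * exp (- R)"
      if R: "R \<ge> R0" and w: "w \<in> closed_segment (of_real xs + of_real R * (of_real s * cnj d0)) (of_real xs + of_real R * (of_real s * d0))" for R w
    proof -
      have Rp: "R \<ge> 0" using R R0 by simp
      have ww: "w \<in> wedge xs s"
        using w closed_segment_subset[OF ray_in_wedge[OF dir_d0(2) s Rp] ray_in_wedge[OF dir_d0(1) s Rp] convex_wedge] by blast
      from w obtain u where u: "w = (1 - u) *\<^sub>R (of_real xs + of_real R * (of_real s * cnj d0)) + u *\<^sub>R (of_real xs + of_real R * (of_real s * d0))"
        by (auto simp: in_segment)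
      have re: "Re w - xs = s * (R * (sqrt 3 / 2))" unfolding u by (simp add: d0_def algebra_simps)
      have "s * (Re w - xs) = R * (sqrt 3 / 2)" unfolding re using s by auto
      then have "2 * (s * (Re w - xs)) = R * sqrt 3" by simp
      moreover have "R * 1 \<le> R * sqrt 3" using Rp s3 by (rule mult_left_mono[rotated])
      ultimately have e: "norm (exp (- of_real a * (w - of_real x)^2)) \<le> K * exp (- R)"
        using order.trans[OF K(2)[OF ww], of "K * exp (- R)"] K(1) by simp
      have rebig: "\<bar>Re w - xs\<bar> \<ge> R / 2"
        using mult_left_mono[OF s3, of "R/2"] Rp s unfolding re by (auto simp: abs_mult)
      have qj: "norm (w - of_real (b j)) \<ge> 1" if "j < n" for j
      proof -
        have "\<bar>b j - xs\<bar> \<le> S" unfolding S_def using that by (intro member_le_sum) auto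
        then have "\<bar>Re w - b j\<bar> \<ge> 1" using rebig R unfolding R0_def by linarith
        then show ?thesis using abs_Re_le_cmod[of "w - of_real (b j)"] by simp
      qed
      have qz: "norm (Complex xs \<eta> - w) \<ge> 1"
        using abs_Re_le_cmod[of "Complex xs \<eta> - w"] rebig R R0 by (simp add: abs_minus_commute[of xs])
      have "1 \<le> norm (\<Prod>j<n. w - of_real (b j)) * norm (Complex xs \<eta> - w)"
      proof -
        have "(\<Prod>j<n. (1::real)) \<le> norm (\<Prod>j<n. w - of_real (b j))"
          unfolding prod_norm[symmetric] by (intro prod_mono) (use qj in auto)
        then show ?thesis using mult_mono[of 1 "norm (\<Prod>j<n. w - of_real (b j))" 1, OF _ qz] by simp
      qed
      then have q: "inverse (norm (\<Prod>j<n. w - of_real (b j)) * norm (Complex xs \<eta> - w)) \<le> 1"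
        by (rule inverse_le_1_iff[THEN iffD2, OF disjI2])
      have "norm (f w) = norm A * norm (exp (- of_real a * (w - of_real x)^2)) * inverse (norm (\<Prod>j<n. w - of_real (b j)) * norm (Complex xs \<eta> - w))"
        unfolding f_def norm_mult norm_divide by (simp add: divide_inverse)
      also have "\<dots> \<le> norm A * (K * exp (- R)) * 1"
        using e q K(1) by (intro mult_mono) auto
      also have "\<dots> = norm A * K * 1 * exp (- R)" by simp
      also have "\<dots> \<le> K' * exp (- R)" unfolding K'_def using K(1) by (intro mult_right_mono mult_left_mono) auto
      finally have "norm (f w) \<le> K' * exp (- R)" .
      moreover have "w \<noteq> of_real (b j)" if "j < n" for j using qj[OF that] by auto
      moreover have "w \<noteq> Complex xs \<eta>" using qz by auto
      ultimately show ?thesis by auto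
    qed
  qed (rule s)
qed

text \<open>For z not encircled by the path, the inner integral equals \<Phi>, which is entire in z
  and decays in vertical strips; hence the line can be moved to \<open>xs\<close> even across the
  path. There \<Phi> of the path splits by residues into \<Phi> of two large triangles, and since
  these do not wind around the points of the new line, \<Phi> turns back into Cauchy integrals,
  which converge to ray integrals.\<close>

lemma kernel_deformation:
  fixes b :: "nat \<Rightarrow> real" and p a x y x0 xs :: real and g :: "real \<Rightarrow> complex"
  assumes p: "p > 0" and a: "a > 0" and b: "\<And>j. j < n \<Longrightarrow> b j \<noteq> xs"
    and g: "valid_path g" "pathfinish g = pathstart g"
    and gb: "\<And>j. j < n \<Longrightarrow> of_real (b j) \<notin> path_image g \<and> winding_number g (of_real (b j)) = 1"
    and line: "\<And>\<eta>. Complex x0 \<eta> \<notin> path_image g"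
  defines "E \<equiv> \<lambda>z. exp (of_real p * (z - of_real y)^2) * (\<Prod>j<n. z - of_real (b j))"
    and "H \<equiv> \<lambda>w. exp (- of_real a * (w - of_real x)^2) / (\<Prod>j<n. w - of_real (b j))"
  shows "(LINT \<eta>|lborel. \<i> * contour_integral g (\<lambda>w. E (Complex x0 \<eta>) * H w / (Complex x0 \<eta> - w)))
     = (LINT \<eta>|lborel. \<i> * four_rays (\<lambda>\<omega>. E (Complex xs \<eta>) * H (of_real xs + \<omega>) / (Complex xs \<eta> - (of_real xs + \<omega>))))"
proof -
  define c where "c = (\<lambda>g i. contour_integral g (\<lambda>w. (\<Prod>j<i. w - of_real (b j)) * H w))"
  define Q where "Q = (\<lambda>i z. exp (of_real p * (z - of_real y)^2) * (\<Prod>j\<in>{Suc i..<n}. z - of_real (b j)) :: complex)"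
  define \<Phi> where "\<Phi> = (\<lambda>g z. \<Sum>i<n. c g i * Q i z)"
  have rat: "contour_integral \<gamma> (\<lambda>w. E z * H w / (z - w)) = \<Phi> \<gamma> z"
    if "valid_path \<gamma>" "pathfinish \<gamma> = pathstart \<gamma>" "\<And>j. j < n \<Longrightarrow> of_real (b j) \<notin> path_image \<gamma>"
      "z \<notin> path_image \<gamma>" "winding_number \<gamma> z = 0" for \<gamma> z
  proof -
    have hol: "(\<lambda>w. exp (- of_real a * (w - of_real x)^2)) holomorphic_on UNIV" by (intro holomorphic_intros)
    show ?thesis
      using contour_integral_rational_kernel[OF hol that(1,2), of n "\<lambda>j. of_real (b j)" z "exp (of_real p * (z - of_real y)^2)"] that(3-5)
      unfolding E_def H_def \<Phi>_def c_def Q_def by (simp add: sum_distrib_left mult_ac)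
  qed
  have hol: "\<Phi> \<gamma> holomorphic_on UNIV" for \<gamma> unfolding \<Phi>_def Q_def by (intro holomorphic_intros)
  have "\<exists>K. \<forall>z. Re z \<in> closed_segment x0 xs \<longrightarrow> norm (\<Phi> g z) \<le> K * exp (- \<bar>Im z\<bar>)"
  proof -
    have "\<forall>i. \<exists>K. \<forall>z. Re z \<in> closed_segment x0 xs \<longrightarrow> norm (Q i z) \<le> K * exp (- \<bar>Im z\<bar>)"
      unfolding Q_def by (intro allI gauss_polynomial_strip_bound[OF p]) auto
    then obtain K where K: "\<And>i z. Re z \<in> closed_segment x0 xs \<Longrightarrow> norm (Q i z) \<le> K i * exp (- \<bar>Im z\<bar>)" by metis
    show ?thesis
    proof (intro exI allI impI)
      fix z assume z: "Re z \<in> closed_segment x0 xs"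
      have "norm (\<Phi> g z) \<le> (\<Sum>i<n. norm (c g i) * (K i * exp (- \<bar>Im z\<bar>)))"
        unfolding \<Phi>_def using K[OF z] by (intro sum_norm_le) (auto simp: norm_mult mult_left_mono)
      also have "\<dots> = (\<Sum>i<n. norm (c g i) * K i) * exp (- \<bar>Im z\<bar>)" by (simp add: sum_distrib_right mult.assoc)
      finally show "norm (\<Phi> g z) \<le> (\<Sum>i<n. norm (c g i) * K i) * exp (- \<bar>Im z\<bar>)" .
    qed
  qed
  then obtain K where K: "\<And>z. Re z \<in> closed_segment x0 xs \<Longrightarrow> norm (\<Phi> g z) \<le> K * exp (- \<bar>Im z\<bar>)" by blast
  note shift = vertical_line_shift[OF hol K]
  have "(LINT \<eta>|lborel. \<i> * contour_integral g (\<lambda>w. E (Complex x0 \<eta>) * H w / (Complex x0 \<eta> - w))) = (LINT \<eta>|lborel. \<i> * \<Phi> g (Complex x0 \<eta>))"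
    using rat[OF g, of "Complex x0 _"] gb line winding_number_line_zero[OF g line] by simp
  also have "\<dots> = (LINT \<eta>|lborel. \<i> * \<Phi> g (Complex xs \<eta>))" using shift(3) by simp
  also have "\<dots> = (LINT \<eta>|lborel. \<i> * four_rays (\<lambda>\<omega>. E (Complex xs \<eta>) * H (of_real xs + \<omega>) / (Complex xs \<eta> - (of_real xs + \<omega>))))"
  proof -
    let ?F = "\<lambda>\<eta>. four_rays (\<lambda>\<omega>. E (Complex xs \<eta>) * H (of_real xs + \<omega>) / (Complex xs \<eta> - (of_real xs + \<omega>)))"
    \<comment> \<open>At \<eta> = 0 the line passes through the common vertex of the triangles; this
      single point does not affect the outer integral.\<close>
    have eq: "\<Phi> g (Complex xs \<eta>) = ?F \<eta>" if eta: "\<eta> \<noteq> 0" for \<eta>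
    proof -
      let ?z = "Complex xs \<eta>"
      let ?f = "\<lambda>w. E ?z * H w / (?z - w)"
      have zw: "?z \<notin> wedge xs s" for s using eta by (simp add: wedge_def mult_le_0_iff)
      have ztri: "?z \<notin> path_image (tri xs s R)" "winding_number (tri xs s R) ?z = 0" if "s = 1 \<or> s = -1" "R \<ge> 0" for s R
        using tri_winding_outside[OF that zw] path_image_tri_subset[OF that] zw by auto
      define S where "S = (\<Sum>j<n. \<bar>b j - xs\<bar>)"
      define R0 where "R0 = 2 + 2 * S"
      have big: "\<bar>b j - xs\<bar> < R * (sqrt 3 / 2)" "R > 0" if "R \<ge> R0" "j < n" for R j
      proof -
        have "\<bar>b j - xs\<bar> \<le> S" unfolding S_def using that by (intro member_le_sum) auto
        then have *: "\<bar>b j - xs\<bar> < R / 2" using that unfolding R0_def by linarith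
        then show "R > 0" by linarith
        then have "R / 2 * 1 \<le> R / 2 * sqrt 3" by (intro mult_left_mono) auto
        then show "\<bar>b j - xs\<bar> < R * (sqrt 3 / 2)" using * by simp
      qed
      have btri: "of_real (b j) \<notin> path_image (tri xs s R)" if "s = 1 \<or> s = -1" "R \<ge> R0" "j < n" for s R j
      proof (cases "s * (b j - xs) > 0")
        case True
        then have "s * (b j - xs) = \<bar>b j - xs\<bar>" using that(1) by auto
        then show ?thesis using tri_winding_inside(2)[OF that(1) big(2)[OF that(2,3)] True] big(1)[OF that(2,3)] by simp
      next
        case False
        then have "s * (b j - xs) < 0" using b[OF that(3)] that(1) by auto
        then have "of_real (b j) \<notin> wedge xs s" by (simp add: wedge_def)
        then show ?thesis using path_image_tri_subset[OF that(1), of R xs] big(2)[OF that(2,3)] by auto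
      qed
      have R0: "R0 > 0" unfolding R0_def S_def by (simp add: sum_nonneg add_pos_nonneg)
      have ev: "contour_integral (tri xs 1 R) ?f + contour_integral (tri xs (-1) R) ?f = \<Phi> g ?z" if R: "R \<ge> R0" for R
      proof -
        have 1: "contour_integral (tri xs s R) ?f = \<Phi> (tri xs s R) ?z" if "s = 1 \<or> s = -1" for s
          using R R0 by (intro rat valid_tri btri[OF that R] ztri[OF that]) auto
        have "c g i = c (tri xs 1 R) i + c (tri xs (-1) R) i" for i
          unfolding c_def
        proof (rule contour_integral_split_triangles[of "b ` {..<n}"])
          show "(\<lambda>w. (\<Prod>j<i. w - of_real (b j)) * H w) holomorphic_on UNIV - of_real ` b ` {..<n}"
            unfolding H_def by (intro holomorphic_intros) auto
          show "R > 0" using R R0 by simp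
        qed (use g gb b big[OF R] in auto)
        then have "\<Phi> (tri xs 1 R) ?z + \<Phi> (tri xs (-1) R) ?z = \<Phi> g ?z"
          unfolding \<Phi>_def by (simp add: sum.distrib distrib_right)
        then show ?thesis using 1 by simp
      qed
      have t: "((\<lambda>R. contour_integral (tri xs s R) ?f) \<longlongrightarrow>
        rayd (of_real s * cnj d0) (\<lambda>\<omega>. ?f (of_real xs + \<omega>)) - rayd (of_real s * d0) (\<lambda>\<omega>. ?f (of_real xs + \<omega>))) at_top"
        if "s = 1 \<or> s = -1" for s
        using kernel_triangle_tendsto[OF a that b eta, where x = x and A = "E ?z"] unfolding H_def .
      have "((\<lambda>R. contour_integral (tri xs 1 R) ?f + contour_integral (tri xs (-1) R) ?f) \<longlongrightarrow> ?F \<eta>) at_top"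
        using tendsto_add[OF t[of 1] t[of "-1"]] unfolding four_rays_def by simp
      moreover have "((\<lambda>R. contour_integral (tri xs 1 R) ?f + contour_integral (tri xs (-1) R) ?f) \<longlongrightarrow> \<Phi> g ?z) at_top"
        by (rule tendsto_eventually, rule eventually_mono[OF eventually_ge_at_top[of R0]]) (rule ev)
      ultimately show ?thesis using tendsto_unique trivial_limit_at_top_linorder by blast
    qed
    have m: "(\<lambda>\<eta>. \<Phi> g (Complex xs \<eta>)) \<in> borel_measurable lborel" using shift(2) by auto
    \<comment> \<open>Measurability of the ray integral in \<eta> is inherited from the entire
      function, from which it differs at most at 0.\<close>
    have "?F = (\<lambda>\<eta>. if \<eta> = 0 then ?F 0 else \<Phi> g (Complex xs \<eta>))" using eq by auto
    also have "\<dots> \<in> borel_measurable lborel" using m by measurable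
    finally have m2: "?F \<in> borel_measurable lborel" .
    show ?thesis
      by (rule integral_cong_AE) (use m m2 AE_lborel_singleton[of "0::real"] eq in \<open>auto elim!: eventually_mono\<close>)
  qed
  finally show ?thesis .
qed

subsection \<open>Double integrals over a line and four rays\<close>

definition wt :: "real \<Rightarrow> real" where "wt t = exp (- \<bar>t\<bar>) / sqrt \<bar>t\<bar>"

lemma powr_minus_half_div_exp: "t powr (1/2 - 1) / exp t = wt t" if "t \<ge> 0" for t :: real
proof -
  have "t powr (1/2 - 1) = t powr (- (1/2))" by simp
  also have "\<dots> = inverse (sqrt t)" using that by (simp only: powr_minus powr_half_sqrt)
  finally show ?thesis using that by (simp only: wt_def abs_of_nonneg exp_minus divide_inverse mult.commute)
qed

text \<open>On each half-line this is the integrand of Euler's integral for Gamma(1/2).\<close>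

lemma integrable_wt: "integrable lborel wt"
proof -
  define v where "v = (\<lambda>t::real. indicat_real {0..} t *\<^sub>R (t powr (1/2 - 1) / exp t))"
  have x1: "((\<lambda>t. t powr (1/2 - 1) / exp t) has_integral Gamma (1/2::real)) {0..}"
    by (rule Gamma_integral_real) simp
  have x2: "(\<lambda>t::real. t powr (1/2 - 1) / exp t) absolutely_integrable_on {0..}"
    by (rule nonnegative_absolutely_integrable_1[OF has_integral_integrable[OF x1]])
       (simp only: divide_nonneg_pos powr_ge_zero exp_gt_zero)
  have "(\<lambda>t::real. indicat_real {0..} t *\<^sub>R (t powr (1/2 - 1) / exp t)) \<in> borel_measurable lborel"
    by measurable
  from integrable_completion[OF this] have v: "integrable lborel v"
    using x2 unfolding v_def set_integrable_def by (simp only:)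
  have v': "integrable lborel (\<lambda>t. v (- t))"
    using lborel_integrable_real_affine[OF v, of "-1" 0] by simp
  have w: "wt = (\<lambda>t. v t + v (- t))"
  proof
    fix t :: real
    consider "t = 0" | "t > 0" | "t < 0" by linarith
    then show "wt t = v t + v (- t)"
    proof cases
      case 1
      then show ?thesis by (simp add: wt_def v_def)
    next
      case 2
      then have "v t = wt t" "v (- t) = 0" unfolding v_def using powr_minus_half_div_exp[of t] by simp_all
      then show ?thesis by simp
    next
      case 3
      then have "v (- t) = wt (- t)" "v t = 0" unfolding v_def using powr_minus_half_div_exp[of "- t"] by simp_all
      moreover have "wt (- t) = wt t" by (simp add: wt_def)
      ultimately show ?thesis by simp
    qed
  qed
  show ?thesis unfolding w by (rule Bochner_Integration.integrable_add[OF v v'])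
qed

lemma wt_nonneg: "wt t \<ge> 0"
  by (simp add: wt_def)

definition wt_const :: real where "wt_const = (LINT t|lborel. wt t)^2"

lemma integrable_wt_prod: "integrable (lborel \<Otimes>\<^sub>M lborel) (\<lambda>(\<eta>, r). wt \<eta> * wt r)"
  and integral_wt_prod: "(LINT z|(lborel \<Otimes>\<^sub>M lborel). (case z of (\<eta>, r) \<Rightarrow> wt \<eta> * wt r)) = wt_const"
proof -
  have m: "wt \<in> borel_measurable lborel" using integrable_wt by simp
  show i: "integrable (lborel \<Otimes>\<^sub>M lborel) (\<lambda>(\<eta>, r). wt \<eta> * wt r)"
  proof (rule lborel_pair.Fubini_integrable)
    show "(\<lambda>(\<eta>, r). wt \<eta> * wt r) \<in> borel_measurable (lborel \<Otimes>\<^sub>M lborel)" using m by measurable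
    show "integrable lborel (\<lambda>x. LINT y|lborel. norm (case (x, y) of (\<eta>, r) \<Rightarrow> wt \<eta> * wt r))"
      using integrable_wt by (simp add: abs_mult wt_nonneg)
    show "AE x in lborel. integrable lborel (\<lambda>y. case (x, y) of (\<eta>, r) \<Rightarrow> wt \<eta> * wt r)"
      using integrable_wt by simp
  qed
  show "(LINT z|(lborel \<Otimes>\<^sub>M lborel). (case z of (\<eta>, r) \<Rightarrow> wt \<eta> * wt r)) = wt_const"
    using lborel_pair.integral_fst'[OF i] by (simp add: wt_const_def power2_eq_square)
qed

text \<open>The four unit vectors at angle \<pi>/6 to the real axis, that is \<open>dir\<close>
  together with the opposite directions.\<close>

definition sdir :: "complex \<Rightarrow> bool" where
  "sdir e \<longleftrightarrow> norm e = 1 \<and> \<bar>Im e\<bar> = 1/2"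

text \<open>This is why the weight \<open>exp (- \<bar>t\<bar>) / sqrt \<bar>t\<bar>\<close> in each variable dominates the integrand with its Cauchy kernel.\<close>
lemma norm_diff_sdir_ge:
  assumes e: "sdir e" and r: "r \<ge> 0"
  shows "sqrt \<bar>\<eta>\<bar> * sqrt r \<le> norm (\<i> * of_real \<eta> - of_real r * e)"
proof -
  have ne: "(Re e)^2 + (Im e)^2 = 1" using e cmod_power2[of e] by (simp add: sdir_def)
  have "(norm (\<i> * of_real \<eta> - of_real r * e))^2 = r^2 * ((Re e)^2 + (Im e)^2) + \<eta>^2 - 2 * (\<eta> * r * Im e)"
    unfolding cmod_power2 by (simp add: power2_diff power_mult_distrib algebra_simps)
  also have "\<dots> \<ge> r^2 + \<eta>^2 - \<bar>\<eta>\<bar> * r"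
  proof -
    have "\<bar>\<eta> * r * Im e\<bar> = \<bar>\<eta>\<bar> * r * (1/2)" using e r by (simp add: abs_mult sdir_def)
    then show ?thesis unfolding ne by linarith
  qed
  finally have a: "r^2 + \<eta>^2 - \<bar>\<eta>\<bar> * r \<le> (norm (\<i> * of_real \<eta> - of_real r * e))^2" .
  have "2 * \<bar>\<eta>\<bar> * r \<le> \<bar>\<eta>\<bar>^2 + r^2" by (rule sum_squares_bound)
  then have "\<bar>\<eta>\<bar> * r \<le> (norm (\<i> * of_real \<eta> - of_real r * e))^2"
    using a unfolding power2_abs mult.assoc by linarith
  then have "sqrt (\<bar>\<eta>\<bar> * r) \<le> norm (\<i> * of_real \<eta> - of_real r * e)" by (rule real_le_lsqrt[OF norm_ge_zero])
  then show ?thesis by (simp add: real_sqrt_mult)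
qed

section \<open>Absolute convergence on line times ray\<close>

definition kern :: "complex \<Rightarrow> (real \<Rightarrow> complex) \<Rightarrow> (real \<Rightarrow> complex) \<Rightarrow> real \<times> real \<Rightarrow> complex" where
  "kern e f g = (\<lambda>(\<eta>, r). indicator {0..} r *\<^sub>R (f \<eta> * g r / (\<i> * of_real \<eta> - of_real r * e) * e))"

lemma kern_integrable:
  assumes e: "sdir e"
    and f: "f \<in> borel_measurable borel" "\<And>\<eta>. norm (f \<eta>) \<le> p * exp (- \<bar>\<eta>\<bar>)"
    and g: "continuous_on {0..} g" "\<And>r. r \<ge> 0 \<Longrightarrow> norm (g r) \<le> q * exp (- r)"
  shows "integrable (lborel \<Otimes>\<^sub>M lborel) (kern e f g)"
    and "norm (LINT z|(lborel \<Otimes>\<^sub>M lborel). kern e f g z) \<le> p * q * wt_const"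
proof -
  have p: "p \<ge> 0" using order.trans[OF norm_ge_zero f(2)[of 0]] by simp
  have q: "q \<ge> 0" using order.trans[OF norm_ge_zero g(2)[of 0]] by simp
  have gm: "(\<lambda>r. indicator {0..} r *\<^sub>R g r) \<in> borel_measurable borel"
    by (rule borel_measurable_continuous_on_indicator[OF _ g(1)]) simp
  have "kern e f g = (\<lambda>(\<eta>, r). f \<eta> * (indicator {0..} r *\<^sub>R g r) / (\<i> * of_real \<eta> - of_real r * e) * e)"
    by (auto simp: kern_def fun_eq_iff split: split_indicator)
  moreover have "\<dots> \<in> borel_measurable (lborel \<Otimes>\<^sub>M lborel)"
    using f(1) gm by measurable
  ultimately have m: "kern e f g \<in> borel_measurable (lborel \<Otimes>\<^sub>M lborel)" by simp
  have le: "norm (kern e f g z) \<le> (p * q) * (case z of (\<eta>, r) \<Rightarrow> wt \<eta> * wt r)" if "fst z \<noteq> 0" "snd z \<noteq> 0" for z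
  proof (cases z)
    case (Pair \<eta> r)
    show ?thesis
    proof (cases "r > 0")
      case False
      then show ?thesis using that Pair p q wt_nonneg by (auto simp: kern_def)
    next
      case r: True
      have s: "0 < sqrt \<bar>\<eta>\<bar> * sqrt r" using that Pair r by simp
      have ind: "indicat_real {0..} r = 1" using r by simp
      have le: "inverse (norm (\<i> * of_real \<eta> - of_real r * e)) \<le> inverse (sqrt \<bar>\<eta>\<bar> * sqrt r)"
        by (rule le_imp_inverse_le[OF norm_diff_sdir_ge[OF e less_imp_le[OF r]] s])
      have "norm (kern e f g z) = norm (f \<eta>) * norm (g r) * inverse (norm (\<i> * of_real \<eta> - of_real r * e))"
        by (simp only: kern_def Pair prod.case ind scaleR_one norm_mult norm_divide e[unfolded sdir_def, THEN conjunct1]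
            mult_1_right divide_inverse norm_inverse)
      also have "\<dots> \<le> (p * exp (- \<bar>\<eta>\<bar>)) * (q * exp (- r)) * inverse (sqrt \<bar>\<eta>\<bar> * sqrt r)"
        by (rule mult_mono[OF mult_mono[OF f(2) g(2)[OF less_imp_le[OF r]] mult_nonneg_nonneg[OF p exp_ge_zero] norm_ge_zero] le
              mult_nonneg_nonneg[OF mult_nonneg_nonneg[OF p exp_ge_zero] mult_nonneg_nonneg[OF q exp_ge_zero]]
              inverse_nonnegative_iff_nonnegative[THEN iffD2, OF norm_ge_zero]])
      also have "\<dots> = (p * q) * (wt \<eta> * wt r)"
        by (simp only: wt_def abs_of_pos[OF r] divide_inverse inverse_mult_distrib mult_ac)
      finally show ?thesis by (simp only: Pair prod.case)
    qed
  qed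
  \<comment> \<open>On the coordinate axes \<open>wt\<close> is 0 by division by zero and the bound
    may fail; the axes form a null set.\<close>
  have AE: "AE z in lborel \<Otimes>\<^sub>M lborel. norm (kern e f g z) \<le> (p * q) * (case z of (\<eta>, r) \<Rightarrow> wt \<eta> * wt r)"
  proof -
    have "AE z in lborel \<Otimes>\<^sub>M (lborel :: real measure). fst z \<noteq> (0::real) \<and> snd z \<noteq> (0::real)"
    proof (rule lborel_pair.AE_pair_measure)
      show "{z \<in> space (lborel \<Otimes>\<^sub>M lborel). fst z \<noteq> (0::real) \<and> snd z \<noteq> (0::real)} \<in> sets (lborel \<Otimes>\<^sub>M lborel)"
        by measurable
      show "AE x in lborel. AE y in lborel. fst (x, y) \<noteq> (0::real) \<and> snd (x, y) \<noteq> (0::real)"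
        using AE_lborel_singleton[of "0::real"] by (auto elim!: eventually_mono)
    qed
    then show ?thesis by eventually_elim (use le in blast)
  qed
  have i: "integrable (lborel \<Otimes>\<^sub>M lborel) (\<lambda>z. (p * q) * (case z of (\<eta>, r) \<Rightarrow> wt \<eta> * wt r))"
    using integrable_wt_prod by (intro integrable_mult_right) simp
  show int: "integrable (lborel \<Otimes>\<^sub>M lborel) (kern e f g)"
    by (rule Bochner_Integration.integrable_bound[OF i m]) (use AE in \<open>auto elim!: eventually_mono\<close>)
  have "norm (LINT z|(lborel \<Otimes>\<^sub>M lborel). kern e f g z) \<le> (LINT z|(lborel \<Otimes>\<^sub>M lborel). (p * q) * (case z of (\<eta>, r) \<Rightarrow> wt \<eta> * wt r))"
    by (rule order.trans[OF integral_norm_bound integral_mono_AE[OF integrable_norm[OF int] i AE]])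
  also have "\<dots> = p * q * wt_const" using integral_wt_prod by simp
  finally show "norm (LINT z|(lborel \<Otimes>\<^sub>M lborel). kern e f g z) \<le> p * q * wt_const" .
qed

lemma rayd_kern:
  assumes "integrable (lborel \<Otimes>\<^sub>M lborel) (kern e f (\<lambda>r. S (of_real r * e)))"
  shows "integrable lborel (\<lambda>\<eta>. rayd e (\<lambda>\<omega>. f \<eta> * S \<omega> / (\<i> * of_real \<eta> - \<omega>)))"
    and "(LINT \<eta>|lborel. rayd e (\<lambda>\<omega>. f \<eta> * S \<omega> / (\<i> * of_real \<eta> - \<omega>))) = (LINT z|(lborel \<Otimes>\<^sub>M lborel). kern e f (\<lambda>r. S (of_real r * e)) z)"
  using lborel_pair.integrable_fst'[OF assms] lborel_pair.integral_fst'[OF assms]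
  by (simp_all add: rayd_def kern_def set_lebesgue_integral_def)

definition double_integral :: "(real \<Rightarrow> complex) \<Rightarrow> (complex \<Rightarrow> complex) \<Rightarrow> complex" where
  "double_integral f S = (LINT \<eta>|lborel. \<i> * four_rays (\<lambda>\<omega>. f \<eta> * S \<omega> / (\<i> * of_real \<eta> - \<omega>)))"

lemma sdir_d0: "sdir (cnj d0)" "sdir d0" "sdir (- cnj d0)" "sdir (- d0)"
  by (simp_all only: sdir_def complex_mod_cnj norm_minus_cancel complex_cnj uminus_complex.sel cnj.sel abs_minus_cancel dir_facts[OF dir_d0(1)] simp_thms)

definition ray_decay :: "real \<Rightarrow> (complex \<Rightarrow> complex) \<Rightarrow> bool" where
  "ray_decay q S \<longleftrightarrow> (\<forall>d r. dir d \<longrightarrow> norm (S (of_real r * d)) \<le> q * exp (- \<bar>r\<bar>))"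

definition ray_cont :: "(complex \<Rightarrow> complex) \<Rightarrow> bool" where
  "ray_cont S \<longleftrightarrow> (\<forall>d. dir d \<longrightarrow> continuous_on UNIV (\<lambda>r. S (of_real r * d)))"

lemma four_directions:
  assumes "e \<in> {cnj d0, d0, - cnj d0, - d0}"
  shows "sdir e" and "ray_decay q S \<Longrightarrow> r \<ge> 0 \<Longrightarrow> norm (S (of_real r * e)) \<le> q * exp (- r)"
    and "ray_cont S \<Longrightarrow> continuous_on {0..} (\<lambda>r. S (of_real r * e))"
proof -
  show "sdir e" using assms by (elim insertE emptyE) (simp_all only: sdir_d0)
  have "\<exists>s d. e = of_real s * d \<and> dir d \<and> (s = 1 \<or> s = (-1::real))" using assms
  proof (elim insertE emptyE)
    assume "e = cnj d0"
    then have "e = of_real (1) * cnj d0" by simp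
    moreover have "(1) = (1::real) \<or> (1) = (-1::real)" by simp
    ultimately show ?thesis using dir_d0(2) by (intro exI conjI)
  next
    assume "e = d0"
    then have "e = of_real (1) * d0" by simp
    moreover have "(1) = (1::real) \<or> (1) = (-1::real)" by simp
    ultimately show ?thesis using dir_d0(1) by (intro exI conjI)
  next
    assume "e = - cnj d0"
    then have "e = of_real (-1) * cnj d0" by simp
    moreover have "(-1) = (1::real) \<or> (-1) = (-1::real)" by simp
    ultimately show ?thesis using dir_d0(2) by (intro exI conjI)
  next
    assume "e = - d0"
    then have "e = of_real (-1) * d0" by simp
    moreover have "(-1) = (1::real) \<or> (-1) = (-1::real)" by simp
    ultimately show ?thesis using dir_d0(1) by (intro exI conjI)
  qed
  then obtain s d where e: "e = of_real s * d" "dir d" "s = 1 \<or> s = -1"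
    by (elim exE conjE)
  have eq: "of_real r * e = of_real (r * s) * d" for r unfolding e(1) by simp
  show "norm (S (of_real r * e)) \<le> q * exp (- r)" if "ray_decay q S" "r \<ge> 0"
    using that(1)[unfolded ray_decay_def, rule_format, OF e(2), of "r * s"] that(2) e(3) unfolding eq by (auto simp: abs_mult)
  show "continuous_on {0..} (\<lambda>r. S (of_real r * e))" if "ray_cont S"
    unfolding eq using that[unfolded ray_cont_def, rule_format, OF e(2)]
    by (rule continuous_on_compose2[where g = "\<lambda>r. S (of_real r * d)"]) (auto intro!: continuous_intros)
qed

definition rint :: "complex \<Rightarrow> (real \<Rightarrow> complex) \<Rightarrow> (complex \<Rightarrow> complex) \<Rightarrow> complex" where
  "rint e f S = (LINT z|(lborel \<Otimes>\<^sub>M lborel). kern e f (\<lambda>r. S (of_real r * e)) z)"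

text \<open>Fubini turns each iterated integral into an absolutely convergent planar integral, to
  which norm bounds and linearity apply directly.\<close>

lemma double_integral_eq:
  assumes f: "f \<in> borel_measurable borel" "\<And>\<eta>. norm (f \<eta>) \<le> p * exp (- \<bar>\<eta>\<bar>)"
    and S: "ray_cont S" "ray_decay q S"
  shows "double_integral f S = \<i> * (rint (cnj d0) f S - rint d0 f S + (rint (- cnj d0) f S - rint (- d0) f S))"
proof -
  have i: "integrable (lborel \<Otimes>\<^sub>M lborel) (kern e f (\<lambda>r. S (of_real r * e)))" if "e \<in> {cnj d0, d0, - cnj d0, - d0}" for e
    by (rule kern_integrable(1)[OF four_directions(1)[OF that] f four_directions(3)[OF that S(1)] four_directions(2)[OF that S(2)]])
  define F where "F = (\<lambda>e \<eta>. rayd e (\<lambda>\<omega>. f \<eta> * S \<omega> / (\<i> * of_real \<eta> - \<omega>)))"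
  have F: "integrable lborel (F e)" "(LINT \<eta>|lborel. F e \<eta>) = rint e f S" if "e \<in> {cnj d0, d0, - cnj d0, - d0}" for e
    unfolding F_def rint_def by (rule rayd_kern[OF i[OF that]])+
  have mem: "cnj d0 \<in> {cnj d0, d0, - cnj d0, - d0}" "d0 \<in> {cnj d0, d0, - cnj d0, - d0}"
      "- cnj d0 \<in> {cnj d0, d0, - cnj d0, - d0}" "- d0 \<in> {cnj d0, d0, - cnj d0, - d0}"
    by (rule insertI1 insertI2)+
  have "double_integral f S = (LINT \<eta>|lborel. \<i> * (F (cnj d0) \<eta> - F d0 \<eta> + (F (- cnj d0) \<eta> - F (- d0) \<eta>)))"
    unfolding double_integral_def four_rays_def F_def ..
  also have "\<dots> = \<i> * (LINT \<eta>|lborel. (F (cnj d0) \<eta> - F d0 \<eta> + (F (- cnj d0) \<eta> - F (- d0) \<eta>)))"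
    by (rule integral_mult_right_zero)
  also have "(LINT \<eta>|lborel. (F (cnj d0) \<eta> - F d0 \<eta> + (F (- cnj d0) \<eta> - F (- d0) \<eta>)))
     = (LINT \<eta>|lborel. F (cnj d0) \<eta> - F d0 \<eta>) + (LINT \<eta>|lborel. F (- cnj d0) \<eta> - F (- d0) \<eta>)"
    by (rule Bochner_Integration.integral_add; rule Bochner_Integration.integrable_diff; rule F(1), rule mem)
  also have "(LINT \<eta>|lborel. F (cnj d0) \<eta> - F d0 \<eta>) = rint (cnj d0) f S - rint d0 f S"
    unfolding Bochner_Integration.integral_diff[OF F(1)[OF mem(1)] F(1)[OF mem(2)]] F(2)[OF mem(1)] F(2)[OF mem(2)] ..
  also have "(LINT \<eta>|lborel. F (- cnj d0) \<eta> - F (- d0) \<eta>) = rint (- cnj d0) f S - rint (- d0) f S"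
    unfolding Bochner_Integration.integral_diff[OF F(1)[OF mem(3)] F(1)[OF mem(4)]] F(2)[OF mem(3)] F(2)[OF mem(4)] ..
  finally show ?thesis .
qed

lemma norm_double_integral_le:
  assumes f: "f \<in> borel_measurable borel" "\<And>\<eta>. norm (f \<eta>) \<le> p * exp (- \<bar>\<eta>\<bar>)"
    and S: "ray_cont S" "ray_decay q S"
  shows "norm (double_integral f S) \<le> 4 * (p * q * wt_const)"
proof -
  have b: "norm (rint e f S) \<le> p * q * wt_const" if "e \<in> {cnj d0, d0, - cnj d0, - d0}" for e
    unfolding rint_def
    by (rule kern_integrable(2)[OF four_directions(1)[OF that] f four_directions(3)[OF that S(1)] four_directions(2)[OF that S(2)]])
  have "norm (double_integral f S) = norm (rint (cnj d0) f S - rint d0 f S + (rint (- cnj d0) f S - rint (- d0) f S))"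
    unfolding double_integral_eq[OF assms] by (simp add: norm_mult)
  also have "\<dots> \<le> (norm (rint (cnj d0) f S) + norm (rint d0 f S)) + (norm (rint (- cnj d0) f S) + norm (rint (- d0) f S))"
    by (intro order.trans[OF norm_triangle_ineq] add_mono norm_triangle_ineq4)
  finally show ?thesis using b[of "cnj d0", OF insertI1] b[of d0, OF insertI2[OF insertI1]]
      b[of "- cnj d0", OF insertI2[OF insertI2[OF insertI1]]] b[of "- d0", OF insertI2[OF insertI2[OF insertI2[OF insertI1]]]]
    by linarith
qed

lemma mult_telescope: "a * b * q - a' * b' * q = (a - a') * b * q + a' * (b - b') * q" for a b a' b' q :: complex
  by (simp add: algebra_simps)

lemma mult_divide_telescope:
  "a * b / D * e - a' * b' / D * e = (a - a') * b / D * e + a' * (b - b') / D * e" for a b a' b' D :: complex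
  using mult_telescope[of a b "e / D" a' b'] by (simp only: times_divide_eq_right times_divide_eq_left)

lemma kern_diff:
  "kern e f1 g1 z - kern e f2 g2 z = kern e (\<lambda>\<eta>. f1 \<eta> - f2 \<eta>) g1 z + kern e f2 (\<lambda>r. g1 r - g2 r) z"
proof (cases z)
  case (Pair \<eta> r)
  show ?thesis unfolding Pair kern_def prod.case scaleR_right_diff_distrib[symmetric] scaleR_right_distrib[symmetric]
    by (rule arg_cong[where f = "\<lambda>w. indicat_real {0..} r *\<^sub>R w"], rule mult_divide_telescope)
qed

text \<open>Bilinearity: f1 S1 - f2 S2 = (f1 - f2) S1 + f2 (S1 - S2) under the common Cauchy kernel,
  and each part has the norm bound.\<close>

lemma double_integral_diff:
  assumes f1: "f1 \<in> borel_measurable borel" "\<And>\<eta>. norm (f1 \<eta>) \<le> p * exp (- \<bar>\<eta>\<bar>)"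
    and f2: "f2 \<in> borel_measurable borel" "\<And>\<eta>. norm (f2 \<eta>) \<le> p * exp (- \<bar>\<eta>\<bar>)"
    and f12: "\<And>\<eta>. norm (f1 \<eta> - f2 \<eta>) \<le> p' * exp (- \<bar>\<eta>\<bar>)"
    and S1: "ray_cont S1" "ray_decay q S1"
    and S2: "ray_cont S2" "ray_decay q S2"
    and S12: "ray_decay q' (\<lambda>\<omega>. S1 \<omega> - S2 \<omega>)"
  shows "norm (double_integral f1 S1 - double_integral f2 S2) \<le> 4 * ((p' * q + p * q') * wt_const)"
proof -
  have S: "ray_cont (\<lambda>\<omega>. S1 \<omega> - S2 \<omega>)" using S1(1) S2(1) unfolding ray_cont_def by (auto intro!: continuous_intros)
  have f: "(\<lambda>\<eta>. f1 \<eta> - f2 \<eta>) \<in> borel_measurable borel" using f1(1) f2(1) by measurable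
  have lin: "rint e f1 S1 - rint e f2 S2 = rint e (\<lambda>\<eta>. f1 \<eta> - f2 \<eta>) S1 + rint e f2 (\<lambda>\<omega>. S1 \<omega> - S2 \<omega>)"
    if that: "e \<in> {cnj d0, d0, - cnj d0, - d0}" for e
  proof -
    note k = kern_integrable(1)[OF four_directions(1)[OF that]]
    have "rint e f1 S1 - rint e f2 S2 = (LINT z|(lborel \<Otimes>\<^sub>M lborel). kern e f1 (\<lambda>r. S1 (of_real r * e)) z - kern e f2 (\<lambda>r. S2 (of_real r * e)) z)"
      unfolding rint_def
      by (intro Bochner_Integration.integral_diff[symmetric] k[OF f1 four_directions(3)[OF that S1(1)] four_directions(2)[OF that S1(2)]]
          k[OF f2 four_directions(3)[OF that S2(1)] four_directions(2)[OF that S2(2)]])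
    also have "\<dots> = (LINT z|(lborel \<Otimes>\<^sub>M lborel). kern e (\<lambda>\<eta>. f1 \<eta> - f2 \<eta>) (\<lambda>r. S1 (of_real r * e)) z
        + kern e f2 (\<lambda>r. S1 (of_real r * e) - S2 (of_real r * e)) z)"
      by (simp only: kern_diff)
    also have "\<dots> = rint e (\<lambda>\<eta>. f1 \<eta> - f2 \<eta>) S1 + rint e f2 (\<lambda>\<omega>. S1 \<omega> - S2 \<omega>)"
      unfolding rint_def
      by (intro Bochner_Integration.integral_add k[OF f f12 four_directions(3)[OF that S1(1)] four_directions(2)[OF that S1(2)]]
          k[OF f2 four_directions(3)[OF that S] four_directions(2)[OF that S12]])
    finally show ?thesis .
  qed
  have alg: "\<i> * (a - b + (c - d)) - \<i> * (a' - b' + (c' - d')) = \<i> * (a1 - b1 + (c1 - d1)) + \<i> * (a2 - b2 + (c2 - d2))"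
    if "a - a' = a1 + a2" "b - b' = b1 + b2" "c - c' = c1 + c2" "d - d' = d1 + d2"
    for a b c d a' b' c' d' a1 b1 c1 d1 a2 b2 c2 d2 :: complex
    using that by algebra
  have "double_integral f1 S1 - double_integral f2 S2 = double_integral (\<lambda>\<eta>. f1 \<eta> - f2 \<eta>) S1 + double_integral f2 (\<lambda>\<omega>. S1 \<omega> - S2 \<omega>)"
    unfolding double_integral_eq[OF f1 S1] double_integral_eq[OF f2 S2] double_integral_eq[OF f f12 S1] double_integral_eq[OF f2 S S12]
    by (rule alg; rule lin; rule insertI1 insertI2[OF insertI1] insertI2[OF insertI2[OF insertI1]] insertI2[OF insertI2[OF insertI2[OF insertI1]]])
  then have "norm (double_integral f1 S1 - double_integral f2 S2) \<le> norm (double_integral (\<lambda>\<eta>. f1 \<eta> - f2 \<eta>) S1) + norm (double_integral f2 (\<lambda>\<omega>. S1 \<omega> - S2 \<omega>))"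
    by (simp only: norm_triangle_ineq)
  also have "\<dots> \<le> 4 * (p' * q * wt_const) + 4 * (p * q' * wt_const)"
    by (intro add_mono norm_double_integral_le[OF f f12 S1] norm_double_integral_le[OF f2 S S12])
  also have "\<dots> = 4 * ((p' * q + p * q') * wt_const)" by (simp only: distrib_left distrib_right)
  finally show ?thesis .
qed

subsection \<open>Rotation of the Pearcey contour\<close>

text \<open>For signs a and b, the closed sector between the angles \<pi>/6 and \<pi>/4, reflected
  into the quadrant where Re has sign a and Im has sign b. It is swept by the rotating ray.\<close>

definition sector_region :: "real \<Rightarrow> real \<Rightarrow> complex set" where
  "sector_region a b = {\<omega>. b * Im \<omega> \<le> a * Re \<omega> \<and> a * Re \<omega> \<le> sqrt 3 * (b * Im \<omega>)}"

lemma sector_region_nonneg: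
  assumes "\<omega> \<in> sector_region a b"
  shows "0 \<le> b * Im \<omega>" "0 \<le> a * Re \<omega>"
proof -
  have "b * Im \<omega> \<le> sqrt 3 * (b * Im \<omega>)" using assms by (auto simp: sector_region_def)
  then have "0 \<le> (sqrt 3 - 1) * (b * Im \<omega>)" by (simp add: left_diff_distrib)
  moreover have "sqrt 3 - 1 > (0::real)" by simp
  ultimately show 1: "0 \<le> b * Im \<omega>" by (simp only: zero_le_mult_iff) auto
  then show "0 \<le> a * Re \<omega>" using assms by (auto simp: sector_region_def)
qed

lemma convex_sector_region: "convex (sector_region a b)"
proof (rule convexI)
  fix x y :: complex and u v :: real
  assume A: "x \<in> sector_region a b" "y \<in> sector_region a b" "0 \<le> u" "0 \<le> v" "u + v = 1"
  have 1: "u * (b * Im x) + v * (b * Im y) \<le> u * (a * Re x) + v * (a * Re y)"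
    using A by (intro add_mono mult_left_mono) (auto simp: sector_region_def)
  have 2: "u * (a * Re x) + v * (a * Re y) \<le> u * (sqrt 3 * (b * Im x)) + v * (sqrt 3 * (b * Im y))"
    using A by (intro add_mono mult_left_mono) (auto simp: sector_region_def)
  have "b * Im (u *\<^sub>R x + v *\<^sub>R y) = u * (b * Im x) + v * (b * Im y)"
    "a * Re (u *\<^sub>R x + v *\<^sub>R y) = u * (a * Re x) + v * (a * Re y)"
    by (simp_all add: algebra_simps)
  moreover have "u * (sqrt 3 * (b * Im x)) + v * (sqrt 3 * (b * Im y)) = sqrt 3 * (u * (b * Im x) + v * (b * Im y))"
    by (simp add: algebra_simps)
  ultimately show "u *\<^sub>R x + v *\<^sub>R y \<in> sector_region a b"
    unfolding sector_region_def mem_Collect_eq using 1 2 by (simp only:)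
qed

lemma Re_pow4: "Re (\<omega>^4) = (Re \<omega>)^4 - 6 * (Re \<omega>)^2 * (Im \<omega>)^2 + (Im \<omega>)^4"
proof -
  have "Re (\<omega>^4) = Re ((\<omega>^2)^2)" by (simp flip: power_mult)
  also have "\<dots> = (Re \<omega> ^ 2 - Im \<omega> ^ 2)^2 - (2 * (Re \<omega> * Im \<omega>))^2"
    unfolding power2_eq_square by simp
  also have "\<dots> = (Re \<omega>)^4 - 6 * (Re \<omega>)^2 * (Im \<omega>)^2 + (Im \<omega>)^4" by algebra
  finally show ?thesis .
qed

text \<open>On the sector cos(4\<theta>) \<le> -1/2. The weaker constant 2/9 follows from linear
  combinations of products of Y \<le> X \<le> 3Y, and it suffices, because (2/9)/4 = 1/18 is larger
  than the 1/32 in \<open>decay\<close>.\<close>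

lemma Re_pow4_sector_le:
  assumes w: "\<omega> \<in> sector_region a b" and a: "a^2 = 1" "b^2 = (1::real)"
  shows "Re (\<omega>^4) \<le> - (2/9) * norm \<omega> ^ 4"
proof -
  define X where "X = (Re \<omega>)^2"
  define Y where "Y = (Im \<omega>)^2"
  have X: "X = (a * Re \<omega>)^2" and Y: "Y = (b * Im \<omega>)^2" using a by (simp_all add: X_def Y_def power_mult_distrib)
  have YX: "Y \<le> X" unfolding X Y using w sector_region_nonneg[OF w] by (intro power_mono) (auto simp: sector_region_def)
  have "X \<le> (sqrt 3 * (b * Im \<omega>))^2" unfolding X using w sector_region_nonneg[OF w] by (intro power_mono) (auto simp: sector_region_def)
  then have XY: "X \<le> 3 * Y" unfolding Y by (simp add: power_mult_distrib)
  have "0 \<le> (X - Y) * (3 * Y - X)" using YX XY by (intro mult_nonneg_nonneg) auto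
  then have h1: "X^2 + 3 * Y^2 \<le> 4 * (X * Y)" by (simp add: algebra_simps power2_eq_square)
  have XX: "0 \<le> X" "0 \<le> Y" by (simp_all add: X_def Y_def)
  have h2: "Y * Y \<le> X * X" using YX XX by (intro mult_mono) auto
  have "X * X \<le> 3 * Y * X" using XY XX by (intro mult_right_mono) auto
  then have h3: "X^2 \<le> 3 * (X * Y)" by (simp add: power2_eq_square algebra_simps)
  have "norm \<omega> ^ 4 = ((norm \<omega>)^2)^2" by (simp flip: power_mult)
  also have "(norm \<omega>)^2 = X + Y" by (simp add: cmod_power2 X_def Y_def)
  finally have n: "norm \<omega> ^ 4 = X^2 + 2 * (X * Y) + Y^2" by (simp add: power2_sum)
  have r: "Re (\<omega>^4) = X^2 - 6 * (X * Y) + Y^2" unfolding Re_pow4 X_def Y_def by (simp flip: power_mult)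
  have h2': "Y^2 \<le> X^2" using h2 by (simp add: power2_eq_square)
  have "11 * X^2 + 11 * Y^2 \<le> 50 * (X * Y)"
    using h1 h3 h2' XX mult_nonneg_nonneg[OF XX] by linarith
  then show ?thesis unfolding n r by (simp only: distrib_left)
qed

lemma norm_diff_sector_ge:
  assumes w: "\<omega> \<in> sector_region a b" and a: "\<bar>a\<bar> = 1" "\<bar>b\<bar> = (1::real)"
  shows "\<bar>\<eta>\<bar> / 2 \<le> norm (\<i> * of_real \<eta> - \<omega>)"
proof (cases "\<bar>Im \<omega>\<bar> \<ge> \<bar>\<eta>\<bar> / 2")
  case True
  have "\<bar>Im \<omega>\<bar> = b * Im \<omega>" "\<bar>Re \<omega>\<bar> = a * Re \<omega>"
    using sector_region_nonneg[OF w] a by (metis abs_mult abs_of_nonneg mult_1)+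
  then have "\<bar>Im \<omega>\<bar> \<le> \<bar>Re \<omega>\<bar>" using w by (simp add: sector_region_def)
  then show ?thesis using True abs_Re_le_cmod[of "\<i> * of_real \<eta> - \<omega>"] by simp
next
  case False
  then show ?thesis using abs_Im_le_cmod[of "\<i> * of_real \<eta> - \<omega>"] by simp
qed

lemma ray_rotation:
  fixes A :: complex and \<tau> u :: real
  assumes a: "\<bar>a\<bar> = 1" and b: "\<bar>b\<bar> = (1::real)" and eta: "\<eta> \<noteq> 0"
  defines "F \<equiv> \<lambda>\<omega>. A * exp (\<omega>^4 / 4 + of_real \<tau> * \<omega>^2 / 2 + of_real u * \<omega>) / (\<i> * of_real \<eta> - \<omega>)"
  shows "rayd (Complex (a * (sqrt 3 / 2)) (b / 2)) F = rayd (Complex (a * (sqrt 2 / 2)) (b * (sqrt 2 / 2))) F"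
proof -
  let ?e = "Complex (a * (sqrt 3 / 2)) (b / 2)" and ?e' = "Complex (a * (sqrt 2 / 2)) (b * (sqrt 2 / 2))"
  have a2: "a^2 = 1" "b^2 = 1" using a b by (metis power2_abs one_power2)+
  have aa: "a * a = 1" "b * b = 1" using a2 by (simp_all add: power2_eq_square)
  \<comment> \<open>The pole at i\<eta> must be kept out of an open convex neighbourhood of the
    sector. If it lies on the sector's side of the real axis, a slanted half-plane separates them,
    otherwise a horizontal one.\<close>
  obtain S where S: "convex S" "open S" "sector_region a b \<subseteq> S" "\<i> * of_real \<eta> \<notin> S"
  proof (cases "b * \<eta> > 0")
    case True
    let ?S = "{\<omega>. inner (Complex (- 2 * a) b) \<omega> < \<bar>\<eta>\<bar> / 2}"
    have "sector_region a b \<subseteq> ?S"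
    proof
      fix \<omega> assume w: "\<omega> \<in> sector_region a b"
      have "b * Im \<omega> \<le> a * Re \<omega>" using w by (simp add: sector_region_def)
      then show "\<omega> \<in> ?S" using sector_region_nonneg[OF w] eta by (simp add: inner_complex_def)
    qed
    moreover have "b * \<eta> = \<bar>\<eta>\<bar>" using True b by (metis abs_mult abs_of_pos mult_1)
    then have "\<i> * of_real \<eta> \<notin> ?S" using eta by (simp add: inner_complex_def)
    ultimately show ?thesis using that[of ?S] convex_halfspace_lt open_halfspace_lt by blast
  next
    case False
    let ?S = "{\<omega>. inner (Complex 0 b) \<omega> > - \<bar>\<eta>\<bar> / 2}"
    have "sector_region a b \<subseteq> ?S"
    proof
      fix \<omega> assume w: "\<omega> \<in> sector_region a b"
      then show "\<omega> \<in> ?S" using sector_region_nonneg[OF w] eta by (simp add: inner_complex_def)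
    qed
    moreover have "\<bar>b * \<eta>\<bar> = \<bar>\<eta>\<bar>" using b by (simp add: abs_mult)
    then have "b * \<eta> = - \<bar>\<eta>\<bar>" using False by linarith
    then have "\<i> * of_real \<eta> \<notin> ?S" using eta by (simp add: inner_complex_def)
    ultimately show ?thesis using that[of ?S] convex_halfspace_gt open_halfspace_gt by blast
  qed
  have s23: "sqrt 2 \<le> sqrt 3 * (1::real)" "sqrt 3 \<le> sqrt 3 * (1::real)" "1 \<le> sqrt 2" "1 \<le> sqrt 3" by simp_all
  have in1: "of_real r * ?e \<in> sector_region a b" and in2: "of_real r * ?e' \<in> sector_region a b" if "r \<ge> 0" for r
  proof -
    have "b * (r * (b / 2)) = r * (1/2) * (b * b)" "a * (r * (a * (sqrt 3 / 2))) = r * (sqrt 3 / 2) * (a * a)" by simp_all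
    then have 1: "b * Im (of_real r * ?e) = r * (1/2)" "a * Re (of_real r * ?e) = r * (sqrt 3 / 2)" unfolding aa by simp_all
    show "of_real r * ?e \<in> sector_region a b" unfolding sector_region_def mem_Collect_eq 1
      using that mult_left_mono[OF s23(4) that] by (auto simp: mult_ac)
    have "b * (r * (b * (sqrt 2 / 2))) = r * (sqrt 2/2) * (b * b)" "a * (r * (a * (sqrt 2 / 2))) = r * (sqrt 2 / 2) * (a * a)" by simp_all
    then have 2: "b * Im (of_real r * ?e') = r * (sqrt 2/2)" "a * Re (of_real r * ?e') = r * (sqrt 2 / 2)" unfolding aa by simp_all
    show "of_real r * ?e' \<in> sector_region a b" unfolding sector_region_def mem_Collect_eq 2
      using mult_right_mono[OF s23(4), of "r * (sqrt 2 / 2)"] that by (auto simp: mult_ac)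
  qed
  have hol: "F holomorphic_on S" unfolding F_def using S(4) by (intro holomorphic_intros) auto
  have contS: "continuous_on S F" by (rule holomorphic_on_imp_continuous_on[OF hol])
  define D where "D = \<bar>\<tau>\<bar> + \<bar>u\<bar>"
  have D: "D \<ge> 0" by (simp add: D_def)
  \<comment> \<open>\<beta> is a free parameter here; this is the largest value that
    \<open>decay_le\<close> admits.\<close>
  define \<beta> where "\<beta> = 1 / sqrt (128 * (D + 2))"
  have \<beta>: "\<beta> > 0" "128 * (D + 2) * \<beta>^2 \<le> 1" using D by (simp_all add: \<beta>_def power_divide)
  define K where "K = norm A * exp (64 * (D + 2)^2 + 2 * (D + 2)) * (2 / \<bar>\<eta>\<bar>)"
  have K: "K \<ge> 0" by (simp add: K_def)
  have bnd: "norm (F \<omega>) \<le> K * exp (- 2 * norm \<omega>)" if w: "\<omega> \<in> sector_region a b" for \<omega>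
  proof -
    let ?\<rho> = "norm \<omega>"
    have "Re (\<omega>^4 / 4 + of_real \<tau> * \<omega>^2 / 2 + of_real u * \<omega>) = Re (\<omega>^4) / 4 + \<tau> * Re (\<omega>^2) / 2 + u * Re \<omega>"
      by simp
    also have "\<dots> \<le> - (?\<rho>^4 / (32 * (1 + \<beta>^2 * ?\<rho>^2))) + D * (?\<rho> + ?\<rho>^2)"
    proof -
      have "Re (\<omega>^4) / 4 \<le> - (1/18) * ?\<rho>^4" using Re_pow4_sector_le[OF w a2] by linarith
      moreover have "?\<rho>^4 / (32 * (1 + \<beta>^2 * ?\<rho>^2)) \<le> ?\<rho>^4 / 18"
      proof (rule divide_left_mono)
        have "0 \<le> \<beta>^2 * ?\<rho>^2" by simp
        then show "18 \<le> 32 * (1 + \<beta>^2 * ?\<rho>^2)" "0 < 32 * (1 + \<beta>^2 * ?\<rho>^2) * 18" by (simp_all add: add_pos_nonneg)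
      qed simp
      moreover have "\<tau> * Re (\<omega>^2) \<le> \<bar>\<tau>\<bar> * ?\<rho>^2"
      proof -
        have "\<bar>Re (\<omega>^2)\<bar> \<le> ?\<rho>^2" using abs_Re_le_cmod[of "\<omega>^2"] by (simp add: norm_power)
        then have "\<bar>\<tau> * Re (\<omega>^2)\<bar> \<le> \<bar>\<tau>\<bar> * ?\<rho>^2" unfolding abs_mult by (intro mult_left_mono) auto
        then show ?thesis by linarith
      qed
      moreover have "u * Re \<omega> \<le> \<bar>u\<bar> * ?\<rho>"
      proof -
        have "\<bar>u * Re \<omega>\<bar> \<le> \<bar>u\<bar> * ?\<rho>" unfolding abs_mult using abs_Re_le_cmod[of \<omega>] by (intro mult_left_mono) auto
        then show ?thesis by linarith
      qed
      moreover have "\<bar>\<tau>\<bar> * ?\<rho>^2 / 2 + \<bar>u\<bar> * ?\<rho> \<le> D * (?\<rho> + ?\<rho>^2)"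
      proof -
        have "0 \<le> \<bar>\<tau>\<bar> * ?\<rho>" "0 \<le> \<bar>u\<bar> * ?\<rho>^2" "0 \<le> \<bar>\<tau>\<bar> * ?\<rho>^2" by simp_all
        then show ?thesis unfolding D_def distrib_left distrib_right by linarith
      qed
      ultimately show ?thesis by linarith
    qed
    finally have "exp (Re (\<omega>^4 / 4 + of_real \<tau> * \<omega>^2 / 2 + of_real u * \<omega>)) \<le> decay \<beta> D ?\<rho>"
      unfolding decay_def exp_le_cancel_iff .
    also have "\<dots> \<le> exp (64 * (D + 2)^2 + 2 * (D + 2)) * exp (- 2 * ?\<rho>)"
      by (rule decay_le[OF norm_ge_zero D \<beta>])
    finally have e: "norm (exp (\<omega>^4 / 4 + of_real \<tau> * \<omega>^2 / 2 + of_real u * \<omega>)) \<le> exp (64 * (D + 2)^2 + 2 * (D + 2)) * exp (- 2 * ?\<rho>)"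
      unfolding norm_exp_eq_Re .
    have i: "inverse (norm (\<i> * of_real \<eta> - \<omega>)) \<le> inverse (\<bar>\<eta>\<bar> / 2)"
      by (rule le_imp_inverse_le[OF norm_diff_sector_ge[OF w a b]]) (use eta in simp)
    have "norm (F \<omega>) = norm A * norm (exp (\<omega>^4 / 4 + of_real \<tau> * \<omega>^2 / 2 + of_real u * \<omega>)) * inverse (norm (\<i> * of_real \<eta> - \<omega>))"
      unfolding F_def by (simp only: norm_divide norm_mult divide_inverse norm_inverse)
    also have "\<dots> \<le> norm A * (exp (64 * (D + 2)^2 + 2 * (D + 2)) * exp (- 2 * ?\<rho>)) * inverse (\<bar>\<eta>\<bar> / 2)"
      by (rule mult_mono[OF mult_left_mono[OF e norm_ge_zero] i]) (simp_all)
    also have "\<dots> = K * exp (- 2 * ?\<rho>)" by (simp only: K_def mult_ac inverse_divide)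
    finally show ?thesis .
  qed
  have ne: "norm ?e = 1" "norm ?e' = 1"
    unfolding cmod_def by (simp_all add: power_mult_distrib a2 power_divide)
  have int: "set_integrable lborel {0..} (\<lambda>r. F (0 + of_real r * e) * e)" if e: "e = ?e \<or> e = ?e'" for e
  proof (rule set_integrable_exp_bound[of _ K])
    have ins: "of_real r * e \<in> sector_region a b" if "r \<ge> 0" for r using in1[OF that] in2[OF that] e by blast
    have n: "norm e = 1" using ne e by blast
    show "continuous_on {0..} (\<lambda>r. F (0 + of_real r * e) * e)"
      by (intro continuous_intros continuous_on_compose2[OF contS]) (use ins S(3) in auto)
    show "norm (F (0 + of_real r * e) * e) \<le> K * exp (- r)" if "r \<ge> 0" for r
    proof -
      have "norm (F (of_real r * e)) \<le> K * exp (- 2 * r)" using bnd[OF ins[OF that]] that n by (simp add: norm_mult)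
      also have "\<dots> \<le> K * exp (- r)" using K that by (intro mult_left_mono) auto
      finally show ?thesis using n by (simp add: norm_mult)
    qed
  qed
  have "(LINT r:{0..}|lborel. F (0 + of_real r * ?e) * ?e) - (LINT r:{0..}|lborel. F (0 + of_real r * ?e') * ?e')
    = contour_integral (linepath 0 0) F"
  proof (rule ray_deformation[OF S(1,2) hol _ _ int int])
    show "0 + of_real r * ?e \<in> S" "0 + of_real r * ?e' \<in> S" if "r \<ge> 0" for r using in1[OF that] in2[OF that] S(3) by auto
    show "((\<lambda>R. contour_integral (linepath (0 + of_real R * ?e) (0 + of_real R * ?e')) F) \<longlongrightarrow> 0) at_top"
    proof (rule exp_neg_times_tendsto_0[where K = K and A = 0 and B = 2])
      show "\<forall>\<^sub>F R in at_top. norm (contour_integral (linepath (0 + of_real R * ?e) (0 + of_real R * ?e')) F) \<le> K * exp (- R) * (0 + 2 * R)"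
        using eventually_ge_at_top[of 0]
      proof eventually_elim
        case (elim R)
        have seg: "closed_segment (of_real R * ?e) (of_real R * ?e') \<subseteq> sector_region a b"
          by (rule closed_segment_subset[OF in1[OF elim] in2[OF elim] convex_sector_region])
        have "norm (contour_integral (linepath (of_real R * ?e) (of_real R * ?e')) F) \<le> K * exp (- R) * norm (of_real R * ?e' - of_real R * ?e)"
        proof (rule contour_integral_bound_linepath)
          show "F contour_integrable_on linepath (of_real R * ?e) (of_real R * ?e')"
            by (rule contour_integrable_continuous_linepath, rule continuous_on_subset[OF contS]) (use seg S(3) in auto)
          show "0 \<le> K * exp (- R)" using K by simp
          fix \<omega> assume w: "\<omega> \<in> closed_segment (of_real R * ?e) (of_real R * ?e')"
          then obtain t where t: "0 \<le> t" "t \<le> 1" "\<omega> = (1 - t) *\<^sub>R (of_real R * ?e) + t *\<^sub>R (of_real R * ?e')" by (auto simp: in_segment)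
          have "Re \<omega> = a * (R * ((1 - t) * (sqrt 3 / 2) + t * (sqrt 2 / 2)))" unfolding t(3) by (simp add: algebra_simps diff_divide_distrib)
          then have reR: "\<bar>Re \<omega>\<bar> = R * \<bar>(1 - t) * (sqrt 3 / 2) + t * (sqrt 2 / 2)\<bar>" using a elim by (simp add: abs_mult)
          have "(1 - t) * (1/2) + t * (1/2) \<le> (1 - t) * (sqrt 3 / 2) + t * (sqrt 2 / 2)"
            using t s23 by (intro add_mono mult_left_mono) auto
          moreover have "(1 - t) * (1/2) + t * (1/2) = (1/2::real)" by (simp add: left_diff_distrib diff_divide_distrib)
          ultimately have "1/2 \<le> \<bar>(1 - t) * (sqrt 3 / 2) + t * (sqrt 2 / 2)\<bar>" by linarith
          then have "R * (1/2) \<le> R * \<bar>(1 - t) * (sqrt 3 / 2) + t * (sqrt 2 / 2)\<bar>" using elim by (rule mult_left_mono)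
          then have "R \<le> 2 * norm \<omega>" using reR abs_Re_le_cmod[of \<omega>] by linarith
          then have "K * exp (- 2 * norm \<omega>) \<le> K * exp (- R)" using K by (intro mult_left_mono) auto
          then show "norm (F \<omega>) \<le> K * exp (- R)" using bnd[of \<omega>] seg w by (meson order.trans subsetD)
        qed
        also have "norm (of_real R * ?e' - of_real R * ?e) \<le> norm (of_real R * ?e') + norm (of_real R * ?e)" by (rule norm_triangle_ineq4)
        also have "\<dots> = 2 * R" using ne elim by (simp add: norm_mult)
        finally have "norm (contour_integral (linepath (of_real R * ?e) (of_real R * ?e')) F) \<le> K * exp (- R) * (2 * R)"
          using K by (simp add: mult_left_mono)
        then show ?case by simp
      qed
    qed
  qed auto
  then show ?thesis by (simp add: rayd_def)
qed

lemma cis_quarter_angles: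
  "cis (- pi / 4) = Complex (sqrt 2 / 2) (- (sqrt 2 / 2))" "cis (3 * pi / 4) = Complex (- (sqrt 2 / 2)) (sqrt 2 / 2)"
  "cis (pi / 4) = Complex (sqrt 2 / 2) (sqrt 2 / 2)" "cis (5 * pi / 4) = Complex (- (sqrt 2 / 2)) (- (sqrt 2 / 2))"
proof -
  show 1: "cis (pi / 4) = Complex (sqrt 2 / 2) (sqrt 2 / 2)" by (simp add: complex_eq_iff cos_45 sin_45)
  show "cis (- pi / 4) = Complex (sqrt 2 / 2) (- (sqrt 2 / 2))" by (simp add: complex_eq_iff cos_45 sin_45)
  have "5 * pi / 4 = pi + pi / 4" "3 * pi / 4 = pi + - (pi / 4)" by simp_all
  then have 2: "cis (5 * pi / 4) = - cis (pi / 4)" "cis (3 * pi / 4) = - cis (- (pi / 4))"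
    by (simp_all only: cis_mult[symmetric] cis_pi mult_minus1)
  show "cis (5 * pi / 4) = Complex (- (sqrt 2 / 2)) (- (sqrt 2 / 2))" unfolding 2 1 by (simp add: complex_eq_iff)
  show "cis (3 * pi / 4) = Complex (- (sqrt 2 / 2)) (sqrt 2 / 2)" unfolding 2 by (simp add: complex_eq_iff cos_45 sin_45)
qed

lemma GammaP_eq_four_rays:
  fixes A :: complex and \<tau> u :: real
  assumes eta: "\<eta> \<noteq> 0"
  defines "F \<equiv> \<lambda>\<omega>. A * exp (\<omega>^4 / 4 + of_real \<tau> * \<omega>^2 / 2 + of_real u * \<omega>) / (\<i> * of_real \<eta> - \<omega>)"
  shows "GammaP_integral F = four_rays F"
proof -
  have rot: "rayd (Complex (a * (sqrt 3 / 2)) (b / 2)) F = rayd (Complex (a * (sqrt 2 / 2)) (b * (sqrt 2 / 2))) F"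
    if "\<bar>a\<bar> = 1" "\<bar>b\<bar> = 1" for a b
    unfolding F_def by (rule ray_rotation[OF that eta])
  have ray: "ray_integral t F = rayd (cis t) F" for t by (simp add: ray_integral_def rayd_def)
  have d: "d0 = Complex (sqrt 3 / 2) (1 / 2)" "cnj d0 = Complex (sqrt 3 / 2) (- (1 / 2))"
    "- d0 = Complex (- (sqrt 3 / 2)) (- (1 / 2))" "- cnj d0 = Complex (- (sqrt 3 / 2)) (1 / 2)"
    by (simp_all add: d0_def complex_eq_iff)
  show ?thesis unfolding GammaP_integral_def four_rays_def ray cis_quarter_angles
    unfolding d(3,4) unfolding d(2) unfolding d(1)
    using rot[of 1 1] rot[of 1 "-1"] rot[of "-1" 1] rot[of "-1" "-1"] by (simp add: algebra_simps)
qed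

lemma pearceyK_eq_double_integral:
  assumes P: "\<And>\<eta>. norm (Pfun \<tau>2 v (\<i> * of_real \<eta>)) \<le> p * exp (- \<bar>\<eta>\<bar>)"
    and Q: "ray_decay q (\<lambda>\<omega>. 1 / Pfun \<tau>1 u \<omega>)"
  shows "pearceyK \<tau>1 \<tau>2 u v = 1 / (2 * of_real pi * \<i>)^2 *
      double_integral (\<lambda>\<eta>. Pfun \<tau>2 v (\<i> * of_real \<eta>)) (\<lambda>\<omega>. 1 / Pfun \<tau>1 u \<omega>)
    - (if \<tau>1 > \<tau>2 then of_real (1 / sqrt (2 * pi * (\<tau>1 - \<tau>2)) * exp (- ((u - v)^2) / (2 * (\<tau>1 - \<tau>2)))) else 0)"
proof -
  define f where "f = (\<lambda>\<eta>. Pfun \<tau>2 v (\<i> * of_real \<eta>))"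
  define S where "S = (\<lambda>\<omega>. 1 / Pfun \<tau>1 u \<omega>)"
  let ?L = "\<lambda>\<eta>. \<i> * GammaP_integral (\<lambda>\<omega>. exp (- ((\<i> * of_real \<eta>)^4) / 4 - of_real \<tau>2 * (\<i> * of_real \<eta>)^2 / 2
     - of_real v * (\<i> * of_real \<eta>) + \<omega>^4 / 4 + of_real \<tau>1 * \<omega>^2 / 2 + of_real u * \<omega>) / (\<i> * of_real \<eta> - \<omega>))"
  let ?R = "\<lambda>\<eta>. \<i> * four_rays (\<lambda>\<omega>. f \<eta> * S \<omega> / (\<i> * of_real \<eta> - \<omega>))"
  have eq: "?L \<eta> = ?R \<eta>" if eta: "\<eta> \<noteq> 0" for \<eta>
  proof -
    have S: "S \<omega> = exp (\<omega>^4 / 4 + of_real \<tau>1 * \<omega>^2 / 2 + of_real u * \<omega>)" for \<omega>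
      by (simp add: S_def Pfun_def inverse_eq_divide[symmetric] exp_minus[symmetric] algebra_simps)
    have "exp (- ((\<i> * of_real \<eta>)^4) / 4 - of_real \<tau>2 * (\<i> * of_real \<eta>)^2 / 2
     - of_real v * (\<i> * of_real \<eta>) + \<omega>^4 / 4 + of_real \<tau>1 * \<omega>^2 / 2 + of_real u * \<omega>) = f \<eta> * S \<omega>" for \<omega>
      unfolding f_def S Pfun_def exp_add[symmetric] by (simp only: add.assoc)
    then show ?thesis using GammaP_eq_four_rays[OF eta, of "f \<eta>" \<tau>1 u] unfolding S by simp
  qed
  have fm: "f \<in> borel_measurable borel" unfolding f_def Pfun_def
    by (intro borel_measurable_continuous_onI continuous_intros) auto
  have P': "norm (f \<eta>) \<le> p * exp (- \<bar>\<eta>\<bar>)" for \<eta> unfolding f_def by (rule P)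
  have Sc: "ray_cont S" unfolding ray_cont_def S_def Pfun_def by (intro allI impI continuous_intros) auto
  have i: "integrable lborel (\<lambda>\<eta>. rayd e (\<lambda>\<omega>. f \<eta> * S \<omega> / (\<i> * of_real \<eta> - \<omega>)))" if "e \<in> {cnj d0, d0, - cnj d0, - d0}" for e
    by (rule rayd_kern(1)[OF kern_integrable(1)[OF four_directions(1)[OF that] fm P'
      four_directions(3)[OF that Sc] four_directions(2)[OF that Q[folded S_def]]]])
  have "integrable lborel ?R" unfolding four_rays_def
    by (intro integrable_mult_right Bochner_Integration.integrable_add Bochner_Integration.integrable_diff i) auto
  then have m: "?R \<in> borel_measurable lborel" by (rule borel_measurable_integrable)
  \<comment> \<open>The rotation requires \<eta> \<noteq> 0, so that the pole stays away from the
    origin of the rays. The exceptional point is null, and measurability comes from the four-ray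
    side.\<close>
  have "?L = (\<lambda>\<eta>. if \<eta> = 0 then ?L 0 else ?R \<eta>)" using eq by auto
  also have "\<dots> \<in> borel_measurable lborel" using m by measurable
  finally have m2: "?L \<in> borel_measurable lborel" .
  have "(LINT \<eta>|lborel. ?L \<eta>) = (LINT \<eta>|lborel. ?R \<eta>)"
    by (rule integral_cong_AE[OF m2 m]) (use AE_lborel_singleton[of "0::real"] eq in \<open>auto elim!: eventually_mono\<close>)
  then show ?thesis unfolding pearceyK_def double_integral_def f_def S_def by simp
qed

subsection \<open>Rescaling of the kernel\<close>

lemma rayd_scale:
  assumes k: "k > 0"
  shows "rayd e f = of_real k * rayd e (\<lambda>\<omega>. f (of_real k * \<omega>))"
proof -
  have "rayd e f = \<bar>k\<bar> *\<^sub>R (LINT r|lborel. indicat_real {0..} (0 + k * r) *\<^sub>R (f (of_real (0 + k * r) * e) * e))"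
    unfolding rayd_def set_lebesgue_integral_def
    by (rule lborel_integral_real_affine) (use k in simp)
  also have "(\<lambda>r. indicat_real {0..} (0 + k * r) *\<^sub>R (f (of_real (0 + k * r) * e) * e))
     = (\<lambda>r. indicat_real {0..} r *\<^sub>R (f (of_real k * (of_real r * e)) * e))"
    using k by (auto simp: indicator_def fun_eq_iff zero_le_mult_iff mult.assoc)
  finally have "rayd e f = k *\<^sub>R rayd e (\<lambda>\<omega>. f (of_real k * \<omega>))"
    unfolding abs_of_pos[OF k] rayd_def[of e "\<lambda>\<omega>. f (of_real k * \<omega>)"] set_lebesgue_integral_def .
  then show ?thesis by (simp only: scaleR_conv_of_real)
qed

lemma rayd_cmult: "rayd e (\<lambda>\<omega>. c * f \<omega>) = c * rayd e f"
proof -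
  have "rayd e (\<lambda>\<omega>. c * f \<omega>) = (LINT r:{0..}|lborel. c * (f (of_real r * e) * e))"
    unfolding rayd_def by (simp only: mult.assoc)
  also have "\<dots> = c * rayd e f" unfolding rayd_def by (rule set_integral_mult_right)
  finally show ?thesis .
qed

lemma four_rays_scale:
  assumes "k > 0"
  shows "four_rays f = of_real k * four_rays (\<lambda>\<omega>. f (of_real k * \<omega>))"
  unfolding four_rays_def by (subst (1 2 3 4) rayd_scale[OF assms]) (simp only: distrib_left right_diff_distrib)

lemma four_rays_cmult: "four_rays (\<lambda>\<omega>. c * f \<omega>) = c * four_rays f"
  unfolding four_rays_def rayd_cmult by (simp only: distrib_left right_diff_distrib)

text \<open>An exact identity. Expanding the square gives linear coefficient -(n m1 k + \<nu>) and
  quadratic coefficient (n m2 k^2 - \<sigma>)/2, so \<sigma> and \<nu> are what remains once the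
  compensating terms of \<open>Zfun\<close> are split off.\<close>

lemma rescaled_factor:
  fixes a X :: "nat \<Rightarrow> real" and k xs y t m1 m2 \<delta> \<sigma> \<nu> :: real
  assumes t: "t > 0" and y: "y = xs + t * m1 + \<delta>"
    and a: "\<And>j. j < n \<Longrightarrow> a j \<noteq> xs" and X: "X = (\<lambda>j. k / (xs - a j))"
    and r2: "real n * k^2 / t = real n * m2 * k^2 - \<sigma>" and r1: "real n * \<delta> * k / t = \<nu>"
  shows "exp (of_real (real n / (2 * t)) * (of_real xs + of_real k * \<zeta> - of_real y)^2) * (\<Prod>j<n. of_real xs + of_real k * \<zeta> - of_real (a j))
     = of_real (exp (real n * (t * m1 + \<delta>)^2 / (2 * t)) * (\<Prod>j<n. xs - a j))
       * Zfun n X (real n * m1 * k) (real n * m2 * k^2) \<sigma> \<nu> \<zeta>"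
proof -
  have "(\<Prod>j<n. of_real xs + of_real k * \<zeta> - of_real (a j)) = (\<Prod>j<n. of_real (xs - a j) * (1 + of_real (X j) * \<zeta>))"
  proof (rule prod.cong[OF refl])
    fix j assume "j \<in> {..<n}"
    then have "xs - a j \<noteq> 0" using a by auto
    then have "(xs - a j) * X j = k" by (simp add: X)
    then have "complex_of_real (xs - a j) * of_real (X j) = of_real k" by (metis of_real_mult)
    then show "of_real xs + of_real k * \<zeta> - of_real (a j) = of_real (xs - a j) * (1 + of_real (X j) * \<zeta>)"
      by (simp only: distrib_left mult_1_right mult.assoc[symmetric]) simp
  qed
  also have "\<dots> = of_real (\<Prod>j<n. xs - a j) * (\<Prod>j<n. 1 + of_real (X j) * \<zeta>)" by (simp only: prod.distrib of_real_prod)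
  finally have P: "(\<Prod>j<n. of_real xs + of_real k * \<zeta> - of_real (a j)) = of_real (\<Prod>j<n. xs - a j) * (\<Prod>j<n. 1 + of_real (X j) * \<zeta>)" .
  have e1: "real n / (2 * t) * k^2 = (real n * m2 * k^2 - \<sigma>) / 2" unfolding r2[symmetric] by simp
  have e2: "real n / (2 * t) * (2 * k * (t * m1 + \<delta>)) = real n * m1 * k + \<nu>" unfolding r1[symmetric] using t by (simp add: field_simps)
  have sq: "of_real xs + of_real k * \<zeta> - of_real y = of_real k * \<zeta> - of_real (t * m1 + \<delta>)" unfolding y by simp
  have "of_real (real n / (2 * t)) * (of_real k * \<zeta> - of_real (t * m1 + \<delta>))^2
     = of_real (real n / (2 * t) * k^2) * \<zeta>^2 - of_real (real n / (2 * t) * (2 * k * (t * m1 + \<delta>))) * \<zeta> + of_real (real n / (2 * t) * (t * m1 + \<delta>)^2)"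
    unfolding of_real_mult of_real_power of_real_numeral power2_eq_square by (simp only: ring_distribs) (simp add: algebra_simps)
  also have "\<dots> = of_real ((real n * m2 * k^2 - \<sigma>) / 2) * \<zeta>^2 - of_real (real n * m1 * k + \<nu>) * \<zeta> + of_real (real n * (t * m1 + \<delta>)^2 / (2 * t))"
    unfolding e1 e2 by simp
  also have "\<dots> = of_real (real n * (t * m1 + \<delta>)^2 / (2 * t)) + (- of_real (real n * m1 * k) * \<zeta> + of_real (real n * m2 * k^2) * \<zeta>^2 / 2 - of_real \<sigma> * \<zeta>^2 / 2 - of_real \<nu> * \<zeta>)"
  proof -
    have "of_real ((B - \<sigma>) / 2) * \<zeta>^2 - of_real (A + \<nu>) * \<zeta> + c = c + (- of_real A * \<zeta> + of_real B * \<zeta>^2 / 2 - of_real \<sigma> * \<zeta>^2 / 2 - of_real \<nu> * \<zeta>)"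
      for A B :: real and c :: complex by (simp add: algebra_simps diff_divide_distrib)
    then show ?thesis by blast
  qed
  finally have E: "exp (of_real (real n / (2 * t)) * (of_real xs + of_real k * \<zeta> - of_real y)^2)
     = of_real (exp (real n * (t * m1 + \<delta>)^2 / (2 * t))) * exp (- of_real (real n * m1 * k) * \<zeta> + of_real (real n * m2 * k^2) * \<zeta>^2 / 2 - of_real \<sigma> * \<zeta>^2 / 2 - of_real \<nu> * \<zeta>)"
    unfolding sq by (simp only: exp_add exp_of_real)
  show ?thesis unfolding E P Zfun_def of_real_mult by (simp only: mult_ac)
qed

lemma exp_g_emp:
  assumes "n > 0" "\<And>j. j < n \<Longrightarrow> z \<noteq> of_real (a n j)"
  shows "exp (of_nat n * g_emp a n z) = (\<Prod>j<n. z - of_real (a n j))"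
proof -
  have "of_nat n * g_emp a n z = (\<Sum>j<n. Ln (z - of_real (a n j)))" using assms(1) by (simp add: g_emp_def)
  then have "exp (of_nat n * g_emp a n z) = (\<Prod>j<n. exp (Ln (z - of_real (a n j))))" by (simp add: exp_sum)
  also have "\<dots> = (\<Prod>j<n. z - of_real (a n j))" using assms(2) by (intro prod.cong) auto
  finally show ?thesis .
qed

text \<open>Scaling both variables by k yields k^2 from the two integrals and 1/k from the Cauchy
  kernel. The products of \<open>xs - a n j\<close>, one from the z-factor and one from the
  w-factor, cancel.\<close>

lemma rescaled_kernel_integral:
  fixes a :: "nat \<Rightarrow> nat \<Rightarrow> real" and k xs x y t s m1 m2 \<delta>1 \<delta>2 \<sigma>1 \<sigma>2 \<nu>1 \<nu>2 x0 :: real and \<gamma> :: "real \<Rightarrow> complex"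
  assumes n: "n > 0" and k: "k > 0" and t: "t > 0" and s: "s > 0"
    and x: "x = xs + s * m1 + \<delta>1" and y: "y = xs + t * m1 + \<delta>2"
    and a: "\<And>j. j < n \<Longrightarrow> a n j \<noteq> xs" and X: "X = (\<lambda>j. k / (xs - a n j))"
    and rs: "real n * k^2 / s = real n * m2 * k^2 - \<sigma>1" "real n * \<delta>1 * k / s = \<nu>1"
    and rt: "real n * k^2 / t = real n * m2 * k^2 - \<sigma>2" "real n * \<delta>2 * k / t = \<nu>2"
    and g: "valid_path \<gamma>" "pathfinish \<gamma> = pathstart \<gamma>"
    and ga: "\<And>j. j < n \<Longrightarrow> of_real (a n j) \<notin> path_image \<gamma> \<and> winding_number \<gamma> (of_real (a n j)) = 1"
    and line: "\<And>\<eta>. Complex x0 \<eta> \<notin> path_image \<gamma>"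
  shows "(LINT eta|lborel. \<i> * contour_integral \<gamma> (\<lambda>w.
        exp (of_real (real n / (2 * t)) * ((Complex x0 eta - of_real y)^2 + 2 * of_real t * g_emp a n (Complex x0 eta))
             - of_real (real n / (2 * s)) * ((w - of_real x)^2 + 2 * of_real s * g_emp a n w)) / (Complex x0 eta - w)))
     = of_real (k * exp (real n * (t * m1 + \<delta>2)^2 / (2 * t) - real n * (s * m1 + \<delta>1)^2 / (2 * s)))
       * double_integral (\<lambda>\<eta>. Zfun n X (real n * m1 * k) (real n * m2 * k^2) \<sigma>2 \<nu>2 (\<i> * of_real \<eta>))
           (\<lambda>\<omega>. 1 / Zfun n X (real n * m1 * k) (real n * m2 * k^2) \<sigma>1 \<nu>1 \<omega>)"
proof -
  define p where "p = real n / (2 * t)"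
  define q where "q = real n / (2 * s)"
  have pq: "p > 0" "q > 0" using n t s by (simp_all add: p_def q_def)
  define E where "E = (\<lambda>z::complex. exp (of_real p * (z - of_real y)^2) * (\<Prod>j<n. z - of_real (a n j)))"
  define H where "H = (\<lambda>w::complex. exp (- of_real q * (w - of_real x)^2) / (\<Prod>j<n. w - of_real (a n j)))"
  let ?Z2 = "Zfun n X (real n * m1 * k) (real n * m2 * k^2) \<sigma>2 \<nu>2"
  let ?Z1 = "Zfun n X (real n * m1 * k) (real n * m2 * k^2) \<sigma>1 \<nu>1"
  \<comment> \<open>The path winds once around the initial points but not around points of the line,
    so the logarithms in \<open>g_emp\<close> have nonzero arguments.\<close>
  have zl: "Complex x0 \<eta> \<noteq> of_real (a n j)" if "j < n" for \<eta> j
  proof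
    assume "Complex x0 \<eta> = of_real (a n j)"
    then show False using winding_number_line_zero[OF g line, of \<eta>] ga[OF that] by simp
  qed
  have inner: "exp (of_real p * ((z - of_real y)^2 + 2 * of_real t * g_emp a n z) - of_real q * ((w - of_real x)^2 + 2 * of_real s * g_emp a n w)) = E z * H w"
    if z: "\<And>j. j < n \<Longrightarrow> z \<noteq> of_real (a n j)" and w: "\<And>j. j < n \<Longrightarrow> w \<noteq> of_real (a n j)" for z w
  proof -
    have "p * (2 * t) = real n" "q * (2 * s) = real n" using t s by (simp_all add: p_def q_def)
    then have c: "complex_of_real p * (2 * of_real t) = of_nat n" "complex_of_real q * (2 * of_real s) = of_nat n"
      by (metis of_real_mult of_real_numeral of_real_of_nat_eq)+
    note c' = c[unfolded mult.assoc[symmetric]]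
    have "of_real p * ((z - of_real y)^2 + 2 * of_real t * g_emp a n z) = of_real p * (z - of_real y)^2 + of_nat n * g_emp a n z"
      "of_real q * ((w - of_real x)^2 + 2 * of_real s * g_emp a n w) = of_real q * (w - of_real x)^2 + of_nat n * g_emp a n w"
      by (simp_all only: distrib_left mult.assoc[symmetric] c')
    then have "of_real p * ((z - of_real y)^2 + 2 * of_real t * g_emp a n z) - of_real q * ((w - of_real x)^2 + 2 * of_real s * g_emp a n w)
      = (of_real p * (z - of_real y)^2 + of_nat n * g_emp a n z) + (- of_real q * (w - of_real x)^2 + - (of_nat n * g_emp a n w))"
      by (simp only: mult_minus_left minus_add_distrib diff_conv_add_uminus)
    then have "exp (of_real p * ((z - of_real y)^2 + 2 * of_real t * g_emp a n z) - of_real q * ((w - of_real x)^2 + 2 * of_real s * g_emp a n w))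
      = (exp (of_real p * (z - of_real y)^2) * exp (of_nat n * g_emp a n z)) * (exp (- of_real q * (w - of_real x)^2) * inverse (exp (of_nat n * g_emp a n w)))"
      by (simp only: exp_add exp_minus)
    moreover have "exp (of_nat n * g_emp a n z) = (\<Prod>j<n. z - of_real (a n j))" by (rule exp_g_emp[OF n]) (rule z)
    moreover have "exp (of_nat n * g_emp a n w) = (\<Prod>j<n. w - of_real (a n j))" by (rule exp_g_emp[OF n]) (rule w)
    ultimately show ?thesis by (simp only: E_def H_def divide_inverse)
  qed
  have "(LINT eta|lborel. \<i> * contour_integral \<gamma> (\<lambda>w. exp (of_real p * ((Complex x0 eta - of_real y)^2 + 2 * of_real t * g_emp a n (Complex x0 eta))
             - of_real q * ((w - of_real x)^2 + 2 * of_real s * g_emp a n w)) / (Complex x0 eta - w)))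
     = (LINT eta|lborel. \<i> * contour_integral \<gamma> (\<lambda>w. E (Complex x0 eta) * H w / (Complex x0 eta - w)))"
  proof -
    have "contour_integral \<gamma> (\<lambda>w. exp (of_real p * ((Complex x0 eta - of_real y)^2 + 2 * of_real t * g_emp a n (Complex x0 eta))
             - of_real q * ((w - of_real x)^2 + 2 * of_real s * g_emp a n w)) / (Complex x0 eta - w))
       = contour_integral \<gamma> (\<lambda>w. E (Complex x0 eta) * H w / (Complex x0 eta - w))" for eta
    proof (rule contour_integral_eq)
      fix w assume "w \<in> path_image \<gamma>"
      then have "w \<noteq> of_real (a n j)" if "j < n" for j using ga[OF that] by auto
      from inner[OF zl this, of eta]
      show "exp (of_real p * ((Complex x0 eta - of_real y)^2 + 2 * of_real t * g_emp a n (Complex x0 eta))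
             - of_real q * ((w - of_real x)^2 + 2 * of_real s * g_emp a n w)) / (Complex x0 eta - w) = E (Complex x0 eta) * H w / (Complex x0 eta - w)"
        by (simp only:)
    qed
    then show ?thesis by (simp only:)
  qed
  also have "\<dots> = (LINT \<eta>|lborel. \<i> * four_rays (\<lambda>\<omega>. E (Complex xs \<eta>) * H (of_real xs + \<omega>) / (Complex xs \<eta> - (of_real xs + \<omega>))))"
    unfolding E_def H_def by (rule kernel_deformation[OF pq a g ga line])
  also have "\<dots> = \<bar>k\<bar> *\<^sub>R (LINT \<eta>|lborel. \<i> * four_rays (\<lambda>\<omega>. E (Complex xs (0 + k * \<eta>)) * H (of_real xs + \<omega>) / (Complex xs (0 + k * \<eta>) - (of_real xs + \<omega>))))"
    by (rule lborel_integral_real_affine) (use k in simp)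
  also have "(\<lambda>\<eta>. \<i> * four_rays (\<lambda>\<omega>. E (Complex xs (0 + k * \<eta>)) * H (of_real xs + \<omega>) / (Complex xs (0 + k * \<eta>) - (of_real xs + \<omega>))))
     = (\<lambda>\<eta>. of_real (exp (real n * (t * m1 + \<delta>2)^2 / (2 * t) - real n * (s * m1 + \<delta>1)^2 / (2 * s)))
         * (\<i> * four_rays (\<lambda>\<omega>. ?Z2 (\<i> * of_real \<eta>) * (1 / ?Z1 \<omega>) / (\<i> * of_real \<eta> - \<omega>))))"
  proof (rule ext)
    fix \<eta>
    let ?\<zeta> = "\<i> * of_real \<eta>"
    define e2 where "e2 = exp (real n * (t * m1 + \<delta>2)^2 / (2 * t))"
    define e1 where "e1 = exp (real n * (s * m1 + \<delta>1)^2 / (2 * s))"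
    define D where "D = (\<Prod>j<n. xs - a n j)"
    have D: "D \<noteq> 0" unfolding D_def using a by auto
    have e1: "e1 \<noteq> 0" by (simp add: e1_def)
    have Cz: "Complex xs (0 + k * \<eta>) = of_real xs + of_real k * ?\<zeta>" by (simp add: complex_eq_iff)
    have EZ: "E (of_real xs + of_real k * ?\<zeta>) = of_real (e2 * D) * ?Z2 ?\<zeta>"
      unfolding E_def p_def e2_def D_def by (rule rescaled_factor[OF t y a X rt])
    have HZ: "H (of_real xs + of_real k * \<omega>) = 1 / (of_real (e1 * D) * ?Z1 \<omega>)" for \<omega>
    proof -
      have "H (of_real xs + of_real k * \<omega>) = 1 / (exp (of_real q * (of_real xs + of_real k * \<omega> - of_real x)^2) * (\<Prod>j<n. of_real xs + of_real k * \<omega> - of_real (a n j)))"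
        unfolding H_def mult_minus_left exp_minus by (simp add: divide_inverse)
      also have "exp (of_real q * (of_real xs + of_real k * \<omega> - of_real x)^2) * (\<Prod>j<n. of_real xs + of_real k * \<omega> - of_real (a n j)) = of_real (e1 * D) * ?Z1 \<omega>"
        unfolding q_def e1_def D_def by (rule rescaled_factor[OF s x a X rs])
      finally show ?thesis .
    qed
    have "four_rays (\<lambda>\<omega>. E (Complex xs (0 + k * \<eta>)) * H (of_real xs + \<omega>) / (Complex xs (0 + k * \<eta>) - (of_real xs + \<omega>)))
       = of_real k * four_rays (\<lambda>\<omega>. E (Complex xs (0 + k * \<eta>)) * H (of_real xs + of_real k * \<omega>) / (Complex xs (0 + k * \<eta>) - (of_real xs + of_real k * \<omega>)))"
      by (rule four_rays_scale[OF k])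
    also have "(\<lambda>\<omega>. E (Complex xs (0 + k * \<eta>)) * H (of_real xs + of_real k * \<omega>) / (Complex xs (0 + k * \<eta>) - (of_real xs + of_real k * \<omega>)))
       = (\<lambda>\<omega>. of_real (e2 / e1 / k) * (?Z2 ?\<zeta> * (1 / ?Z1 \<omega>) / (?\<zeta> - \<omega>)))"
    proof (rule ext)
      fix \<omega>
      have d: "of_real xs + of_real k * ?\<zeta> - (of_real xs + of_real k * \<omega>) = of_real k * (?\<zeta> - \<omega>)" by (simp add: right_diff_distrib)
      have alg: "(E2 * D' * Z) * (1 / (E1 * D' * Z')) / (K * w) = E2 / E1 / K * (Z * (1 / Z') / w)" if "D' \<noteq> 0" for E2 E1 D' Z Z' K w :: complex
        using that by simp
      have "complex_of_real D \<noteq> 0" using D by simp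
      from alg[OF this, of "of_real e2" "?Z2 ?\<zeta>" "of_real e1" "?Z1 \<omega>" "of_real k" "?\<zeta> - \<omega>"]
      show "E (Complex xs (0 + k * \<eta>)) * H (of_real xs + of_real k * \<omega>) / (Complex xs (0 + k * \<eta>) - (of_real xs + of_real k * \<omega>))
        = of_real (e2 / e1 / k) * (?Z2 ?\<zeta> * (1 / ?Z1 \<omega>) / (?\<zeta> - \<omega>))"
        unfolding Cz EZ HZ d of_real_mult of_real_divide .
    qed
    also have "of_real k * four_rays \<dots> = of_real k * (of_real (e2 / e1 / k) * four_rays (\<lambda>\<omega>. ?Z2 ?\<zeta> * (1 / ?Z1 \<omega>) / (?\<zeta> - \<omega>)))"
      by (simp only: four_rays_cmult)
    also have "\<dots> = of_real (e2 / e1) * four_rays (\<lambda>\<omega>. ?Z2 ?\<zeta> * (1 / ?Z1 \<omega>) / (?\<zeta> - \<omega>))"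
      unfolding mult.assoc[symmetric] of_real_mult[symmetric] using k by simp
    also have "e2 / e1 = exp (real n * (t * m1 + \<delta>2)^2 / (2 * t) - real n * (s * m1 + \<delta>1)^2 / (2 * s))"
      by (simp only: e1_def e2_def exp_diff)
    finally show "\<i> * four_rays (\<lambda>\<omega>. E (Complex xs (0 + k * \<eta>)) * H (of_real xs + \<omega>) / (Complex xs (0 + k * \<eta>) - (of_real xs + \<omega>)))
      = of_real (exp (real n * (t * m1 + \<delta>2)^2 / (2 * t) - real n * (s * m1 + \<delta>1)^2 / (2 * s)))
         * (\<i> * four_rays (\<lambda>\<omega>. ?Z2 ?\<zeta> * (1 / ?Z1 \<omega>) / (?\<zeta> - \<omega>)))" by (simp only: mult.left_commute)
  qed
  also have "(LINT \<eta>|lborel. of_real (exp (real n * (t * m1 + \<delta>2)^2 / (2 * t) - real n * (s * m1 + \<delta>1)^2 / (2 * s)))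
         * (\<i> * four_rays (\<lambda>\<omega>. ?Z2 (\<i> * of_real \<eta>) * (1 / ?Z1 \<omega>) / (\<i> * of_real \<eta> - \<omega>))))
     = of_real (exp (real n * (t * m1 + \<delta>2)^2 / (2 * t) - real n * (s * m1 + \<delta>1)^2 / (2 * s))) * double_integral (\<lambda>\<eta>. ?Z2 (\<i> * of_real \<eta>)) (\<lambda>\<omega>. 1 / ?Z1 \<omega>)"
    unfolding double_integral_def by (rule integral_mult_right_zero)
  finally show ?thesis using k unfolding p_def[symmetric] q_def[symmetric]
    by (simp only: abs_of_pos scaleR_conv_of_real of_real_mult mult.assoc)
qed

section \<open>Exact matching of parameters, conjugation and Gaussian part\<close>

lemma quarter_powers:
  fixes n :: nat
  assumes "n > 0"
  defines "w \<equiv> real n powr (1/4)"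
  shows "w > 0" "real n = w^4" "sqrt (real n) = w^2" "real n powr (3/4) = w^3" "real n powr (- 1/4) = 1 / w" "real n powr (- 1/2) = 1 / w^2"
proof -
  have n: "real n > 0" using assms by simp
  show w: "w > 0" using n by (simp add: w_def)
  have p: "w ^ j = real n powr (real j / 4)" for j
    using powr_power[of "real n" "1/4" j] n by (simp add: w_def)
  show n4: "real n = w^4" using p[of 4] n by simp
  show "sqrt (real n) = w^2" unfolding n4 using w by (simp add: real_sqrt_unique)
  show "real n powr (3/4) = w^3" using p[of 3] by simp
  show "real n powr (- 1/4) = 1 / w" using powr_minus_divide[of "real n" "1/4"] by (simp add: w_def)
  show "real n powr (- 1/2) = 1 / w^2" using p[of 2] powr_minus_divide[of "real n" "1/2"] by simp
qed

text \<open>\<phi> is the ratio of the critical time to t. The rescaled weights carry exactly the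
  parameters \<phi>\<tau> and \<phi>u in place of \<tau> and u, so at this stage there is no error,
  only a factor close to 1.\<close>

lemma scaling_relations:
  fixes w m2 al \<tau> t u :: real
  assumes pos: "w > 0" "m2 > 0" "al > 0" "t > 0" and t: "t = 1 / m2 + \<tau> / ((m2 * al)^2 * w^2)"
  defines "\<phi> \<equiv> 1 / (m2 * t)" and "\<delta> \<equiv> u / (m2 * al * w^3)" and "k \<equiv> al / w"
  shows "w^4 * k^2 / t = w^4 * m2 * k^2 - \<phi> * \<tau>"
    and "w^4 * \<delta> * k / t = \<phi> * u"
    and "w^4 * \<delta>^2 / (2 * t) = \<phi> * u^2 / (2 * m2 * al^2 * w^2)"
proof -
  have mt: "m2 * t = 1 + \<tau> / (m2 * al^2 * w^2)"
    unfolding t using pos by (simp add: field_simps power2_eq_square)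
  have "(w^4 * m2 * k^2 - \<phi> * \<tau>) * t = al^2 * w^2 * (m2 * t) - \<tau> / m2"
    using pos by (simp add: k_def \<phi>_def field_simps power2_eq_square power4_eq_xxxx)
  also have "\<dots> = w^4 * k^2" unfolding mt using pos by (simp add: k_def field_simps power2_eq_square power4_eq_xxxx)
  finally show "w^4 * k^2 / t = w^4 * m2 * k^2 - \<phi> * \<tau>" using pos by (simp add: nonzero_divide_eq_eq)
  show "w^4 * \<delta> * k / t = \<phi> * u"
    using pos by (simp add: k_def \<phi>_def \<delta>_def field_simps power4_eq_xxxx power3_eq_cube)
  show "w^4 * \<delta>^2 / (2 * t) = \<phi> * u^2 / (2 * m2 * al^2 * w^2)"
    using pos by (simp add: \<phi>_def \<delta>_def field_simps power4_eq_xxxx power3_eq_cube power2_eq_square)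
qed

text \<open>The Gaussian part agrees with its limit without error: the conjugation completes the
  square and thereby removes the drift (s - t) m1 from x - y.\<close>

lemma gauss_term:
  fixes w c m1 \<tau>1 \<tau>2 s t u v x y :: real
  assumes pos: "w > 0" "c > 0" and lt: "\<tau>2 < \<tau>1"
    and st: "s - t = (\<tau>1 - \<tau>2) / (c^2 * w^2)" and xy: "x - y = (s - t) * m1 + (u - v) / (c * w^3)"
  shows "1 / (c * w^3) * (w^2 / sqrt (2 * pi * (s - t)) * exp (- (w^4) * (x - y)^2 / (2 * (s - t))))
       * exp (w^4 * m1 * (x - y) - w^4 * m1^2 * (s - t) / 2)
     = 1 / sqrt (2 * pi * (\<tau>1 - \<tau>2)) * exp (- ((u - v)^2) / (2 * (\<tau>1 - \<tau>2)))"
proof -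
  define \<Delta> where "\<Delta> = s - t"
  define D where "D = \<tau>1 - \<tau>2"
  define e where "e = (u - v) / (c * w^3)"
  have D: "D > 0" using lt by (simp add: D_def)
  have \<Delta>: "\<Delta> = D / (c^2 * w^2)" unfolding \<Delta>_def D_def by (rule st)
  have \<Delta>0: "\<Delta> > 0" unfolding \<Delta> using D pos by simp
  have sq: "sqrt (2 * pi * \<Delta>) = sqrt (2 * pi * D) / (c * w)"
  proof (rule real_sqrt_unique)
    show "(sqrt (2 * pi * D) / (c * w))^2 = 2 * pi * \<Delta>" using D pos unfolding \<Delta> by (simp add: power_divide power_mult_distrib)
    show "0 \<le> sqrt (2 * pi * D) / (c * w)" using D pos by simp
  qed
  have "1 / (c * w^3) * (w^2 / sqrt (2 * pi * \<Delta>)) = 1 / sqrt (2 * pi * D)"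
    unfolding sq using pos D by (simp add: field_simps power2_eq_square power3_eq_cube)
  moreover have "- (w^4) * (\<Delta> * m1 + e)^2 / (2 * \<Delta>) + (w^4 * m1 * (\<Delta> * m1 + e) - w^4 * m1^2 * \<Delta> / 2) = - (w^4 * e^2 / (2 * \<Delta>))"
  proof -
    have "(\<Delta> * m1 + e)^2 = \<Delta> * (\<Delta> * m1^2 + 2 * m1 * e) + e^2" by (simp add: power2_eq_square algebra_simps)
    then have "- (w^4) * (\<Delta> * m1 + e)^2 / (2 * \<Delta>) = - (w^4) * (\<Delta> * m1^2 + 2 * m1 * e) / 2 - w^4 * e^2 / (2 * \<Delta>)"
      using \<Delta>0 by (simp add: field_simps)
    then show ?thesis by (simp add: algebra_simps power2_eq_square add_divide_distrib diff_divide_distrib)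
  qed
  moreover have "w^4 * e^2 / (2 * \<Delta>) = (u - v)^2 / (2 * D)"
    unfolding e_def \<Delta> using pos D by (simp add: field_simps power2_eq_square power3_eq_cube power4_eq_xxxx)
  ultimately have "1 / (c * w^3) * (w^2 / sqrt (2 * pi * \<Delta>)) * exp (- (w^4) * (\<Delta> * m1 + e)^2 / (2 * \<Delta>) + (w^4 * m1 * (\<Delta> * m1 + e) - w^4 * m1^2 * \<Delta> / 2))
     = 1 / sqrt (2 * pi * D) * exp (- ((u - v)^2 / (2 * D)))" by (simp only:)
  then show ?thesis unfolding xy \<Delta>_def[symmetric] D_def[symmetric] e_def[symmetric] exp_add
    by (simp only: mult.assoc minus_divide_left)
qed

text \<open>The conjugating factor removes all dependence on \<open>m1\<close> except the term -N m1
  xs, which is the same for both times and cancels in the quotient.\<close>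

lemma exponent_match:
  fixes N t m1 \<delta> xs y :: real
  assumes "t > 0" "y = xs + t * m1 + \<delta>"
  shows "N * (t * m1 + \<delta>)^2 / (2 * t) + (- N * m1 * y + N * m1^2 * t / 2) = - N * m1 * xs + N * \<delta>^2 / (2 * t)"
proof -
  have "(t * m1 + \<delta>)^2 = t * (t * m1^2 + 2 * m1 * \<delta>) + \<delta>^2" by (simp add: power2_eq_square algebra_simps)
  then have "N * (t * m1 + \<delta>)^2 / (2 * t) = N * (t * m1^2 + 2 * m1 * \<delta>) / 2 + N * \<delta>^2 / (2 * t)"
    using assms(1) by (simp add: field_simps)
  then show ?thesis unfolding assms(2) by (simp add: algebra_simps power2_eq_square add_divide_distrib)
qed

text \<open>Still exact. Only two things remain to be estimated, the scalar prefactor against 1 and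
  the double integral with \<open>Zfun\<close> against the one with \<open>Pfun\<close>; the
  Gaussian term is already that of the limit.\<close>

lemma Ktilde_eq:
  fixes mu :: "real measure" and a :: "nat \<Rightarrow> nat \<Rightarrow> real" and n :: nat and xs \<tau>1 \<tau>2 u v :: real
  assumes n: "n > 0" and a: "\<And>j. j < n \<Longrightarrow> a n j \<noteq> xs"
    and g: "valid_path (Gam n)" "pathfinish (Gam n) = pathstart (Gam n)"
    and ga: "\<And>j. j < n \<Longrightarrow> of_real (a n j) \<notin> path_image (Gam n) \<and> winding_number (Gam n) (of_real (a n j)) = 1"
    and line: "\<And>\<eta>. Complex (xl n) \<eta> \<notin> path_image (Gam n)"
    and m2: "m2 > 0" "tcr mu xs = 1 / m2" and al: "al > 0" "c3 mu xs = m2 * al"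
    and tpos: "tP mu xs n \<tau>1 > 0" "tP mu xs n \<tau>2 > 0"
  defines "w \<equiv> real n powr (1/4)" and "m1 \<equiv> Gcoef mu xs 0"
    and "\<phi>1 \<equiv> 1 / (m2 * tP mu xs n \<tau>1)" and "\<phi>2 \<equiv> 1 / (m2 * tP mu xs n \<tau>2)"
  defines "X \<equiv> (\<lambda>j. al / w / (xs - a n j))" and "A1 \<equiv> real n * m1 * (al / w)" and "A2 \<equiv> real n * m2 * (al / w)^2"
  shows "of_real (1 / (c3 mu xs * real n powr (3/4))) * Ktilde mu xs a Gam xl n (tP mu xs n \<tau>1) (tP mu xs n \<tau>2)
                 (xP mu xs n \<tau>1 + u / (c3 mu xs * real n powr (3/4)))
                 (xP mu xs n \<tau>2 + v / (c3 mu xs * real n powr (3/4)))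
    = of_real (sqrt (\<phi>1 * \<phi>2) * exp (\<phi>2 * v^2 / (2 * m2 * al^2 * w^2) - \<phi>1 * u^2 / (2 * m2 * al^2 * w^2))) *
        (1 / (2 * of_real pi * \<i>)^2 * double_integral (\<lambda>\<eta>. Zfun n X A1 A2 (\<phi>2 * \<tau>2) (\<phi>2 * v) (\<i> * of_real \<eta>))
           (\<lambda>\<omega>. 1 / Zfun n X A1 A2 (\<phi>1 * \<tau>1) (\<phi>1 * u) \<omega>))
      - (if \<tau>1 > \<tau>2 then of_real (1 / sqrt (2 * pi * (\<tau>1 - \<tau>2)) * exp (- ((u - v)^2) / (2 * (\<tau>1 - \<tau>2)))) else 0)"
proof -
  note q = quarter_powers[OF n, folded w_def]
  define s where "s = tP mu xs n \<tau>1"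
  define t where "t = tP mu xs n \<tau>2"
  have s: "s > 0" "s = 1 / m2 + \<tau>1 / ((m2 * al)^2 * w^2)" and t: "t > 0" "t = 1 / m2 + \<tau>2 / ((m2 * al)^2 * w^2)"
    using tpos by (simp_all only: s_def t_def tP_def m2 al q(3))
  define \<delta>1 where "\<delta>1 = u / (m2 * al * w^3)"
  define \<delta>2 where "\<delta>2 = v / (m2 * al * w^3)"
  define x where "x = xs + s * m1 + \<delta>1"
  define y where "y = xs + t * m1 + \<delta>2"
  have xy: "xP mu xs n \<tau>1 + u / (c3 mu xs * real n powr (3/4)) = x" "xP mu xs n \<tau>2 + v / (c3 mu xs * real n powr (3/4)) = y"
    by (simp_all only: x_def y_def xP_def s_def t_def m1_def \<delta>1_def \<delta>2_def al q(4))
  have k: "al / w > 0" using al q(1) by simp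
  note rs1 = scaling_relations(1)[OF q(1) m2(1) al(1) s, folded \<delta>1_def \<phi>1_def[folded s_def] q(2)]
  note rs2 = scaling_relations(2)[OF q(1) m2(1) al(1) s, where u = u, folded \<delta>1_def \<phi>1_def[folded s_def] q(2)]
  note rs3 = scaling_relations(3)[OF q(1) m2(1) al(1) s, where u = u, folded \<delta>1_def \<phi>1_def[folded s_def] q(2)]
  note rt1 = scaling_relations(1)[OF q(1) m2(1) al(1) t, folded \<delta>2_def \<phi>2_def[folded t_def] q(2)]
  note rt2 = scaling_relations(2)[OF q(1) m2(1) al(1) t, where u = v, folded \<delta>2_def \<phi>2_def[folded t_def] q(2)]
  note rt3 = scaling_relations(3)[OF q(1) m2(1) al(1) t, where u = v, folded \<delta>2_def \<phi>2_def[folded t_def] q(2)]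
  let ?Z2 = "\<lambda>\<eta>. Zfun n X A1 A2 (\<phi>2 * \<tau>2) (\<phi>2 * v) (\<i> * of_real \<eta>)"
  let ?S1 = "\<lambda>\<omega>. 1 / Zfun n X A1 A2 (\<phi>1 * \<tau>1) (\<phi>1 * u) \<omega>"
  let ?P = "1 / (2 * of_real pi * \<i>)^2 :: complex"
  define J where "J = double_integral ?Z2 ?S1"
  define Q where "Q = exp (real n * (t * m1 + \<delta>2)^2 / (2 * t) - real n * (s * m1 + \<delta>1)^2 / (2 * s))"
  define I where "I = (LINT eta|lborel. \<i> * contour_integral (Gam n) (\<lambda>w.
        exp (of_real (real n / (2 * t)) * ((Complex (xl n) eta - of_real y)^2 + 2 * of_real t * g_emp a n (Complex (xl n) eta))
             - of_real (real n / (2 * s)) * ((w - of_real x)^2 + 2 * of_real s * g_emp a n w)) / (Complex (xl n) eta - w)))"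
  have Xe: "X = (\<lambda>j. al / w / (xs - a n j))" by (simp only: X_def)
  have I: "I = of_real (al / w * Q) * J"
    unfolding I_def Q_def J_def A1_def A2_def
    by (rule rescaled_kernel_integral[where a = a, OF n k t(1) s(1) x_def y_def a Xe rs1 rs2 rt1 rt2 g ga line])
  define F where "F = exp (fconj mu xs n t y - fconj mu xs n s x)"
  define G where "G = (if s > t then sqrt (real n) / sqrt (2 * pi * (s - t)) * exp (- real n * (x - y)^2 / (2 * (s - t))) else 0)"
  have Kn: "Kn a Gam xl n s t x y = of_real (real n / sqrt (s * t)) / (2 * of_real pi * \<i>)^2 * I - of_real G"
    unfolding Kn_def I_def G_def by simp
  let ?c = "1 / (m2 * al * w^3)"
  have L: "of_real ?c * Ktilde mu xs a Gam xl n s t x y = of_real (?c * (real n / sqrt (s * t)) * (al / w * Q) * F) * (?P * J) - of_real (?c * G * F)"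
    unfolding Ktilde_def Kn I F_def[symmetric]
    by (simp only: of_real_mult of_real_divide left_diff_distrib right_diff_distrib divide_inverse mult_ac of_real_1 mult_1_left mult_1_right)
  have pre: "?c * (real n / sqrt (s * t)) * (al / w * Q) * F = sqrt (\<phi>1 * \<phi>2) * exp (\<phi>2 * v^2 / (2 * m2 * al^2 * w^2) - \<phi>1 * u^2 / (2 * m2 * al^2 * w^2))"
  proof -
    have "sqrt (\<phi>1 * \<phi>2) = 1 / (m2 * sqrt (s * t))"
    proof (rule real_sqrt_unique)
      show "(1 / (m2 * sqrt (s * t)))^2 = \<phi>1 * \<phi>2"
        using s t m2 by (simp add: \<phi>1_def \<phi>2_def s_def[symmetric] t_def[symmetric] power_divide power_mult_distrib power2_eq_square[of m2])
      show "0 \<le> 1 / (m2 * sqrt (s * t))" using s t m2 by simp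
    qed
    moreover have "?c * (real n / sqrt (s * t)) * (al / w) = 1 / (m2 * sqrt (s * t))"
      unfolding q(2) using q(1) al(1) m2(1) by (simp add: field_simps power4_eq_xxxx power3_eq_cube)
    moreover have "Q * F = exp (\<phi>2 * v^2 / (2 * m2 * al^2 * w^2) - \<phi>1 * u^2 / (2 * m2 * al^2 * w^2))"
    proof -
      have f2: "real n * (t * m1 + \<delta>2)^2 / (2 * t) + fconj mu xs n t y = - real n * m1 * xs + \<phi>2 * v^2 / (2 * m2 * al^2 * w^2)"
        unfolding fconj_def m1_def[symmetric] rt3[symmetric] by (rule exponent_match[OF t(1) y_def])
      have f1: "real n * (s * m1 + \<delta>1)^2 / (2 * s) + fconj mu xs n s x = - real n * m1 * xs + \<phi>1 * u^2 / (2 * m2 * al^2 * w^2)"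
        unfolding fconj_def m1_def[symmetric] rs3[symmetric] by (rule exponent_match[OF s(1) x_def])
      have "real n * (t * m1 + \<delta>2)^2 / (2 * t) - real n * (s * m1 + \<delta>1)^2 / (2 * s) + (fconj mu xs n t y - fconj mu xs n s x)
        = \<phi>2 * v^2 / (2 * m2 * al^2 * w^2) - \<phi>1 * u^2 / (2 * m2 * al^2 * w^2)" using f1 f2 by linarith
      then show ?thesis unfolding Q_def F_def exp_add[symmetric] by (simp only:)
    qed
    moreover have "?c * (real n / sqrt (s * t)) * (al / w * Q) * F = (?c * (real n / sqrt (s * t)) * (al / w)) * (Q * F)" by (simp only: mult.assoc)
    ultimately show ?thesis by (simp only:)
  qed
  have cw: "(m2 * al)^2 * w^2 > 0" using m2 al q(1) by simp
  have st: "s - t = (\<tau>1 - \<tau>2) / ((m2 * al)^2 * w^2)" unfolding s(2) t(2) by (simp add: diff_divide_distrib)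
  have iff: "s > t \<longleftrightarrow> \<tau>1 > \<tau>2"
  proof -
    have "s > t \<longleftrightarrow> (\<tau>1 - \<tau>2) / ((m2 * al)^2 * w^2) > 0" unfolding st[symmetric] by simp
    also have "\<dots> \<longleftrightarrow> \<tau>1 - \<tau>2 > 0" using cw by (simp only: zero_less_divide_iff) auto
    finally show ?thesis by simp
  qed
  have gs: "?c * G * F = (if \<tau>1 > \<tau>2 then 1 / sqrt (2 * pi * (\<tau>1 - \<tau>2)) * exp (- ((u - v)^2) / (2 * (\<tau>1 - \<tau>2))) else 0)"
  proof (cases "\<tau>1 > \<tau>2")
    case False
    then show ?thesis using iff by (simp add: G_def)
  next
    case True
    have xmy: "x - y = (s - t) * m1 + (u - v) / (m2 * al * w^3)"
      unfolding x_def y_def \<delta>1_def \<delta>2_def by (simp add: algebra_simps diff_divide_distrib)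
    have "fconj mu xs n t y - fconj mu xs n s x = real n * m1 * (x - y) - real n * m1^2 * (s - t) / 2"
      unfolding fconj_def m1_def[symmetric] by (simp add: algebra_simps diff_divide_distrib)
    then have F: "F = exp (w^4 * m1 * (x - y) - w^4 * m1^2 * (s - t) / 2)" unfolding F_def q(2)[symmetric] by (simp only:)
    have G: "G = w^2 / sqrt (2 * pi * (s - t)) * exp (- (w^4) * (x - y)^2 / (2 * (s - t)))"
      using True iff by (simp only: G_def if_True q(3) q(2)[symmetric])
    have c0: "m2 * al > 0" using m2 al by simp
    show ?thesis unfolding G F using gauss_term[OF q(1) c0 True st xmy] True by (simp only: if_True)
  qed
  show ?thesis unfolding xy unfolding s_def[symmetric] t_def[symmetric] al(2) q(4) L pre gs J_def[symmetric]
    by (cases "\<tau>1 > \<tau>2") (simp_all only: if_True if_False of_real_0)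
qed

subsection \<open>Proof of the theorem\<close>

lemma time_ratio_close:
  fixes m2 al w \<tau> t h :: real
  assumes pos: "m2 > 0" "al > 0" "w > 0" and t: "t = 1 / m2 + \<tau> / ((m2 * al)^2 * w^2)"
    and h: "\<bar>\<tau>\<bar> / (m2 * al^2 * w^2) \<le> h" "h \<le> 1/2"
  shows "t > 0" "\<bar>1 / (m2 * t) - 1\<bar> \<le> 2 * h" "0 \<le> 1 / (m2 * t)" "1 / (m2 * t) \<le> 2"
proof -
  define y where "y = \<tau> / (m2 * al^2 * w^2)"
  have mt: "m2 * t = 1 + y" unfolding t y_def using pos by (simp add: field_simps power2_eq_square)
  have "\<bar>y\<bar> = \<bar>\<tau>\<bar> / (m2 * al^2 * w^2)" unfolding y_def using pos by (simp add: abs_mult)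
  then have y: "\<bar>y\<bar> \<le> h" using h by simp
  have y1: "1 + y \<ge> 1/2" using y h by linarith
  then have "m2 * t > 0" unfolding mt by linarith
  then show "t > 0" using pos by (simp add: zero_less_mult_iff)
  show "0 \<le> 1 / (m2 * t)" unfolding mt using y1 by simp
  show "1 / (m2 * t) \<le> 2" unfolding mt using y1 by (simp add: divide_le_eq)
  have "1 / (1 + y) - 1 = - y / (1 + y)" using y1 by (simp add: field_simps)
  then have "\<bar>1 / (m2 * t) - 1\<bar> = \<bar>y\<bar> / (1 + y)" unfolding mt using y1 by (simp add: abs_divide)
  also have "\<dots> \<le> h / (1/2)" using y y1 by (intro frac_le) auto
  finally show "\<bar>1 / (m2 * t) - 1\<bar> \<le> 2 * h" by simp
qed

lemma prefactor_close:
  fixes \<phi>1 \<phi>2 x l l' :: real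
  assumes "\<bar>\<phi>1 - 1\<bar> \<le> l" "\<bar>\<phi>2 - 1\<bar> \<le> l" "0 \<le> \<phi>1" "0 \<le> \<phi>2" "\<phi>1 \<le> 2" "\<phi>2 \<le> 2" "\<bar>x\<bar> \<le> l'" "l' \<le> 1"
  shows "\<bar>sqrt (\<phi>1 * \<phi>2) * exp x - 1\<bar> \<le> 4 * l' + 3 * l"
proof -
  define A where "A = sqrt (\<phi>1 * \<phi>2)"
  have A: "A \<ge> 0" "A^2 = \<phi>1 * \<phi>2" using assms by (simp_all add: A_def)
  have "\<phi>1 * \<phi>2 \<le> 2 * 2" using assms by (intro mult_mono) auto
  then have A2: "A \<le> 2" using A by (intro power2_le_imp_le[of A 2]) auto
  have "\<phi>1 * \<phi>2 - 1 = (\<phi>1 - 1) * \<phi>2 + (\<phi>2 - 1)" by (simp add: algebra_simps)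
  then have "\<bar>\<phi>1 * \<phi>2 - 1\<bar> \<le> \<bar>\<phi>1 - 1\<bar> * \<phi>2 + \<bar>\<phi>2 - 1\<bar>"
    using abs_triangle_ineq[of "(\<phi>1 - 1) * \<phi>2" "\<phi>2 - 1"] by (simp only: abs_mult abs_of_nonneg[OF assms(4)])
  moreover have "\<bar>\<phi>1 - 1\<bar> * \<phi>2 \<le> l * 2" using assms by (intro mult_mono) auto
  ultimately have p: "\<bar>\<phi>1 * \<phi>2 - 1\<bar> \<le> 3 * l" using assms by linarith
  have "A^2 - 1 = (A - 1) * (A + 1)" by (simp add: power2_eq_square algebra_simps)
  then have "\<bar>A - 1\<bar> * \<bar>A + 1\<bar> = \<bar>\<phi>1 * \<phi>2 - 1\<bar>" unfolding A(2)[symmetric] by (simp only: abs_mult)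
  moreover have "\<bar>A + 1\<bar> = A + 1" using A(1) by simp
  ultimately have eq: "\<bar>A - 1\<bar> * (A + 1) = \<bar>\<phi>1 * \<phi>2 - 1\<bar>" by (simp only:)
  have "\<bar>A - 1\<bar> * 1 \<le> \<bar>A - 1\<bar> * (A + 1)" using A(1) by (intro mult_left_mono) auto
  then have A1: "\<bar>A - 1\<bar> \<le> 3 * l" unfolding eq mult_1_right by (rule order.trans[OF _ p])
  have e: "\<bar>exp x - 1\<bar> \<le> 2 * l'"
  proof (cases "x \<ge> 0")
    case True
    have "exp x \<le> 1 + x + x^2" using True assms by (intro exp_bound) auto
    moreover have "x^2 \<le> x" using True assms by (simp add: power2_eq_square mult_left_le)
    moreover have "exp x \<ge> 1" using True by simp
    ultimately show ?thesis using assms True by linarith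
  next
    case False
    then have "exp x \<le> 1" by simp
    then show ?thesis using exp_ge_add_one_self[of x] assms False by linarith
  qed
  have "A * exp x - 1 = A * (exp x - 1) + (A - 1)" by (simp add: algebra_simps)
  then have "\<bar>A * exp x - 1\<bar> \<le> A * \<bar>exp x - 1\<bar> + \<bar>A - 1\<bar>"
    using abs_triangle_ineq[of "A * (exp x - 1)" "A - 1"] by (simp only: abs_mult abs_of_nonneg[OF A(1)])
  moreover have "A * \<bar>exp x - 1\<bar> \<le> 2 * (2 * l')" using A A2 e by (intro mult_mono) auto
  ultimately show ?thesis using A1 unfolding A_def by linarith
qed

text \<open>Zeros of \<open>Zfun\<close> are real, while the rays meet the real axis only at the
  origin, where every linear factor is 1.\<close>

lemma Zfun_ray_nonzero:
  assumes "dir d"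
  shows "Zfun n X A1 A2 \<sigma> \<nu> (of_real r * d) \<noteq> 0"
proof -
  have "1 + of_real (X j) * (of_real r * d) \<noteq> 0" for j
  proof
    assume eq: "1 + of_real (X j) * (of_real r * d) = 0"
    have "X j * (r * Im d) = 0" using arg_cong[OF eq, of Im] by simp
    then have "X j * r = 0" using dir_facts(5)[OF assms] by auto
    then have "X j = 0 \<or> r = 0" by simp
    then show False using eq by (elim disjE) simp_all
  qed
  then show ?thesis by (simp add: Zfun_def)
qed

lemma ray_cont_inverse_Zfun: "ray_cont (\<lambda>\<omega>. 1 / Zfun n X A1 A2 \<sigma> \<nu> \<omega>)"
  unfolding ray_cont_def
proof (intro allI impI)
  fix d assume d: "dir d"
  have "continuous_on UNIV (\<lambda>r. Zfun n X A1 A2 \<sigma> \<nu> (of_real r * d))"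
    unfolding Zfun_def by (intro continuous_intros) auto
  then show "continuous_on UNIV (\<lambda>r. 1 / Zfun n X A1 A2 \<sigma> \<nu> (of_real r * d))"
    using Zfun_ray_nonzero[OF d] by (intro continuous_on_divide continuous_on_const) auto
qed

lemma ray_cont_inverse_Pfun: "ray_cont (\<lambda>\<omega>. 1 / Pfun \<tau> u \<omega>)"
  unfolding ray_cont_def Pfun_def by (intro allI impI continuous_intros) auto

lemma borel_Zfun_imag: "(\<lambda>\<eta>. Zfun n X A1 A2 \<sigma> \<nu> (\<i> * of_real \<eta>)) \<in> borel_measurable borel"
  and borel_Pfun_imag: "(\<lambda>\<eta>. Pfun \<tau> v (\<i> * of_real \<eta>)) \<in> borel_measurable borel"
  unfolding Zfun_def Pfun_def by (intro borel_measurable_continuous_onI continuous_intros; simp)+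

context configuration
begin

text \<open>The \<open>w\<close>- and \<open>z\<close>-factors converge separately at rate \<open>\<beta>\<close>, so the double integral does too.\<close>
lemma double_integral_comparison:
  assumes B: "B \<ge> 0" "128 * (B + 3) * \<beta>^2 \<le> 1"
    and b1: "\<bar>\<sigma>1\<bar> \<le> B" "\<bar>\<nu>1\<bar> \<le> B" "\<bar>\<tau>1\<bar> \<le> B" "\<bar>u\<bar> \<le> B" and c1: "\<bar>\<sigma>1 - \<tau>1\<bar> \<le> C * \<beta>" "\<bar>\<nu>1 - u\<bar> \<le> C * \<beta>"
    and b2: "\<bar>\<sigma>2\<bar> \<le> B" "\<bar>\<nu>2\<bar> \<le> B" "\<bar>\<tau>2\<bar> \<le> B" "\<bar>v\<bar> \<le> B" and c2: "\<bar>\<sigma>2 - \<tau>2\<bar> \<le> C * \<beta>" "\<bar>\<nu>2 - v\<bar> \<le> C * \<beta>"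
  defines "J \<equiv> double_integral (\<lambda>\<eta>. Zfun n x A1 A2 \<sigma>2 \<nu>2 (\<i> * of_real \<eta>)) (\<lambda>\<omega>. 1 / Zfun n x A1 A2 \<sigma>1 \<nu>1 \<omega>)"
    and "J' \<equiv> double_integral (\<lambda>\<eta>. Pfun \<tau>2 v (\<i> * of_real \<eta>)) (\<lambda>\<omega>. 1 / Pfun \<tau>1 u \<omega>)"
  shows "norm J \<le> 4 * (Kc B * Kc B * wt_const)"
    and "norm (J - J') \<le> 8 * (Kc B * Kc B * wt_const) * \<beta>"
    and "pearceyK \<tau>1 \<tau>2 u v = 1 / (2 * of_real pi * \<i>)^2 * J'
    - (if \<tau>1 > \<tau>2 then of_real (1 / sqrt (2 * pi * (\<tau>1 - \<tau>2)) * exp (- ((u - v)^2) / (2 * (\<tau>1 - \<tau>2)))) else 0)"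
proof -
  note z = Zfun_comparison[OF B b2 c2] and w = Zfun_comparison[OF B b1 c1]
  have rd: "ray_decay (Kc B) (\<lambda>\<omega>. 1 / Zfun n x A1 A2 \<sigma>1 \<nu>1 \<omega>)" "ray_decay (Kc B) (\<lambda>\<omega>. 1 / Pfun \<tau>1 u \<omega>)"
    "ray_decay (Kc B * \<beta>) (\<lambda>\<omega>. 1 / Zfun n x A1 A2 \<sigma>1 \<nu>1 \<omega> - 1 / Pfun \<tau>1 u \<omega>)"
    unfolding ray_decay_def using w(4-6) by blast+
  show "norm J \<le> 4 * (Kc B * Kc B * wt_const)"
    unfolding J_def by (rule norm_double_integral_le[OF borel_Zfun_imag z(1) ray_cont_inverse_Zfun rd(1)])
  have "norm (J - J') \<le> 4 * ((Kc B * \<beta> * Kc B + Kc B * (Kc B * \<beta>)) * wt_const)"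
    unfolding J_def J'_def
    by (rule double_integral_diff[OF borel_Zfun_imag z(1) borel_Pfun_imag z(2) z(3) ray_cont_inverse_Zfun rd(1) ray_cont_inverse_Pfun rd(2) rd(3)])
  also have "4 * ((a * b * a + a * (a * b)) * c) = 8 * (a * a * c) * b" for a b c :: real by simp
  finally show "norm (J - J') \<le> 8 * (Kc B * Kc B * wt_const) * \<beta>" .
  show "pearceyK \<tau>1 \<tau>2 u v = 1 / (2 * of_real pi * \<i>)^2 * J'
    - (if \<tau>1 > \<tau>2 then of_real (1 / sqrt (2 * pi * (\<tau>1 - \<tau>2)) * exp (- ((u - v)^2) / (2 * (\<tau>1 - \<tau>2)))) else 0)"
    unfolding J'_def by (rule pearceyK_eq_double_integral[OF z(2) rd(2)])
qed

end

lemma norm_inverse_2pi_i: "norm (1 / (2 * of_real pi * \<i>)^2 :: complex) \<le> 1"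
proof -
  have "norm ((2 * of_real pi * \<i>)^2 :: complex) = (2 * pi)^2" by (simp add: norm_power norm_mult)
  moreover have "(1::real)^2 \<le> (2 * pi)^2" using pi_gt3 by (intro power_mono) auto
  ultimately show ?thesis by (simp add: norm_divide divide_le_eq)
qed

section \<open>Uniform estimate of the rescaled kernel\<close>

context regular_critical_point
begin

lemma kernel_estimate:
  fixes Gam :: "nat \<Rightarrow> real \<Rightarrow> complex" and xl :: "nat \<Rightarrow> real" and BT M :: real
  assumes G2: "Gcoef mu xs 2 = 0"
    and contours: "\<And>n. valid_path (Gam n) \<and> pathfinish (Gam n) = pathstart (Gam n)
        \<and> (\<forall>j<n. of_real (a n j) \<notin> path_image (Gam n) \<and> winding_number (Gam n) (of_real (a n j)) = 1)
        \<and> (\<forall>eta. Complex (xl n) eta \<notin> path_image (Gam n))"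
    and BT: "BT \<ge> 0" and M: "M \<ge> 0"
  obtains K N where "\<And>n \<tau>1 \<tau>2 u v. n \<ge> N \<Longrightarrow> \<bar>\<tau>1\<bar> \<le> BT \<Longrightarrow> \<bar>\<tau>2\<bar> \<le> BT \<Longrightarrow> \<bar>u\<bar> \<le> M \<Longrightarrow> \<bar>v\<bar> \<le> M \<Longrightarrow>
     cmod (of_real (1 / (c3 mu xs * real n powr (3/4)))
             * Ktilde mu xs a Gam xl n (tP mu xs n \<tau>1) (tP mu xs n \<tau>2)
                 (xP mu xs n \<tau>1 + u / (c3 mu xs * real n powr (3/4)))
                 (xP mu xs n \<tau>2 + v / (c3 mu xs * real n powr (3/4)))
           - pearceyK \<tau>1 \<tau>2 u v) \<le> K * real n powr (- ((\<kappa> - 3) / (4 * (\<kappa> + 1))))" "K \<ge> 0" "N \<ge> 1"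
proof -
  from moment_rate obtain C0 m0 n1 where C0: "C0 > 0" and m0: "m0 > 0"
    and int: "\<And>k. 1 \<le> k \<Longrightarrow> k \<le> 4 \<Longrightarrow> integrable mu (\<lambda>s. 1 / (xs - s) ^ k)"
    and gp: "\<And>n j. n \<ge> n1 \<Longrightarrow> j < n \<Longrightarrow> \<bar>a n j - xs\<bar> > m0 * real n powr (- 1 / (\<kappa> + 1))"
    and rate: "\<And>n k. n \<ge> n1 \<Longrightarrow> 1 \<le> k \<Longrightarrow> k \<le> 4 \<Longrightarrow>
       \<bar>(\<Sum>j<n. 1 / (xs - a n j) ^ k) / real n - (LINT s|mu. 1 / (xs - s) ^ k)\<bar> \<le> C0 / (real n * (m0 * real n powr (- 1 / (\<kappa> + 1))) ^ k)"
    by metis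
  define m where "m = (\<lambda>k. LINT s|mu. 1 / (xs - s) ^ k)"
  have m2: "m 2 > 0" and m4: "m 4 > 0" unfolding m_def by (auto intro!: even_moment_pos int)
  \<comment> \<open>Orders shift by one: \<open>Gcoef\<close> of order j is, up to sign and j!, the
    moment of order j + 1. Thus G_2 = 0 says that the third moment vanishes.\<close>
  have m1: "Gcoef mu xs 0 = m 1" by (simp add: Gcoef_def m_def)
  have m3: "m 3 = 0" using G2 by (simp add: Gcoef_def m_def numeral_3_eq_3 numeral_2_eq_2)
  have G3: "Gcoef mu xs 3 = - (6 * m 4)" by (simp add: Gcoef_def m_def fact_numeral)
  \<comment> \<open>With the scale al / n^(1/4), the fourth power sum is close to al^4 times the
    fourth moment, which this choice makes equal to 1.\<close>
  define al where "al = m 4 powr (- 1/4)"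
  have al: "al > 0" using m4 by (simp add: al_def)
  have al4: "al^4 * m 4 = 1"
  proof -
    have "al^4 = m 4 powr (real 4 * (- 1/4))" unfolding al_def using m4 by (subst powr_power) auto
    also have "\<dots> = 1 / m 4" using m4 by (simp add: powr_minus_divide)
    finally show ?thesis using m4 by simp
  qed
  have tc: "tcr mu xs = 1 / m 2" by (simp add: tcr_def m_def)
  have c3: "c3 mu xs = m 2 * al"
  proof -
    have "6 / (- Gcoef mu xs 3) = 1 / m 4" unfolding G3 by simp
    moreover have "(1 / m 4) powr (1/4) = al" unfolding al_def using m4 by (simp add: powr_divide powr_minus_divide)
    ultimately show ?thesis unfolding c3_def tc by simp
  qed
  define \<rho> where "\<rho> = (\<kappa> - 3) / (4 * (\<kappa> + 1))"
  \<comment> \<open>The exponent of the ratio between the scale n^(-1/4) and the gap n^(-1/(\<kappa>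
    + 1)).\<close>
  have rho: "\<rho> = 1/4 - 1 / (\<kappa> + 1)" unfolding \<rho>_def using kappa by (simp add: field_simps)
  have rho0: "\<rho> > 0" unfolding \<rho>_def using kappa by simp
  \<comment> \<open>Corrections from the time scale are of order n^(-1/2); this bound lets the rate
    n^(-\<rho>) absorb them.\<close>
  have rho1: "\<rho> \<le> 1/2"
  proof -
    have "1 / (\<kappa> + 1) \<ge> 0" using kappa by simp
    then show ?thesis unfolding rho by linarith
  qed
  define r where "r = (\<lambda>n::nat. real n powr (- \<rho>))"
  \<comment> \<open>The factor 2 leaves room for the parameters multiplied by \<phi> \<le>
    2.\<close>
  define B where "B = 2 * (BT + M)"
  have B: "B \<ge> 0" "BT \<le> B" "M \<le> B" "2 * BT \<le> B" "2 * M \<le> B" unfolding B_def using BT M by simp_all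
  define L where "L = B / (m 2 * al^2)"
  have L: "L \<ge> 0" unfolding L_def using B m2 al by simp
  define q where "q = al / m0"
  have q: "q > 0" unfolding q_def using al m0 by simp
  \<comment> \<open>\<open>C0\<close> serves the power sums, and the last summand the shift of the
    parameters by \<phi>, which is of order \<open>r n\<close> and is re-expressed through \<beta> =
    q r n.\<close>
  define C where "C = 1 + C0 + 2 * L * B / q"
  have C: "C \<ge> 1" "C0 \<le> C" "2 * L * B / q \<le> C" unfolding C_def using C0 L B q by simp_all
  define K6 where "K6 = 2 * B * L"
  have K6: "K6 \<ge> 0" unfolding K6_def using B L by simp
  \<comment> \<open>A single condition Lam * r n < 1/2 yields every smallness requirement: the time
    ratio, the exponent in the prefactor, C \<beta> \<le> 1/2 and the condition of
    \<open>decay_le\<close>.\<close>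
  define Lam where "Lam = L + K6 + C * q + 128 * (B + 3) * q"
  have Lam: "L \<le> Lam" "K6 \<le> Lam" "C * q \<le> Lam" "128 * (B + 3) * q \<le> Lam"
    unfolding Lam_def using L K6 C q B by simp_all
  have "r \<longlonglongrightarrow> 0" unfolding r_def
    by (rule tendsto_neg_powr[OF _ filterlim_real_sequentially]) (use rho0 in simp)
  then have "(\<lambda>n. Lam * r n) \<longlonglongrightarrow> Lam * 0" by (rule tendsto_mult[OF tendsto_const])
  then have "\<forall>\<^sub>F n in sequentially. Lam * r n < 1/2" by (rule order_tendstoD(2)) simp
  then obtain n2 where n2: "\<forall>n\<ge>n2. Lam * r n < 1/2" unfolding eventually_sequentially by (elim exE)
  define N where "N = max (max n1 n2) 1"
  \<comment> \<open>\<open>Kc B\<close> written out: the locale that provides it is interpreted anew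
    for each n, whereas this constant must be fixed before n.\<close>
  define K0 where "K0 = (306 * C * exp (64 * (B + 3)^2 + 2 * (B + 3))) * (306 * C * exp (64 * (B + 3)^2 + 2 * (B + 3))) * wt_const"
  have K0: "K0 \<ge> 0" unfolding K0_def wt_const_def using C by simp
  \<comment> \<open>The prefactor error times the bound 4 K0 of the double integral, plus the error
    of the double integral itself.\<close>
  define K where "K = (4 * K6 + 6 * L) * (4 * K0) + 8 * K0 * q"
  have K: "K \<ge> 0" unfolding K_def using K6 L K0 q by simp
  have main: "cmod (of_real (1 / (c3 mu xs * real n powr (3/4)))
             * Ktilde mu xs a Gam xl n (tP mu xs n \<tau>1) (tP mu xs n \<tau>2)
                 (xP mu xs n \<tau>1 + u / (c3 mu xs * real n powr (3/4)))
                 (xP mu xs n \<tau>2 + v / (c3 mu xs * real n powr (3/4)))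
           - pearceyK \<tau>1 \<tau>2 u v) \<le> K * r n"
    if n: "n \<ge> N" and tau: "\<bar>\<tau>1\<bar> \<le> BT" "\<bar>\<tau>2\<bar> \<le> BT" and uv: "\<bar>u\<bar> \<le> M" "\<bar>v\<bar> \<le> M" for n \<tau>1 \<tau>2 u v
  proof -
    have ns: "n \<ge> n1" "n \<ge> n2" "n > 0" using n unfolding N_def by linarith+
    define w where "w = real n powr (1/4)"
    note qp = quarter_powers[OF ns(3), folded w_def]
    have r0: "r n > 0" unfolding r_def using ns by simp
    have Lr: "Lam * r n < 1/2" using n2 ns by blast
    have Lr': "y * r n \<le> 1/2" if "y \<le> Lam" for y
      using mult_right_mono[OF that less_imp_le[OF r0]] Lr by linarith
    have wr: "1 / w^2 \<le> r n"
    proof -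
      have "real n powr (- 1/2) \<le> real n powr (- \<rho>)" using rho1 ns by (intro powr_mono) auto
      then show ?thesis unfolding qp(6) r_def .
    qed
    define \<beta> where "\<beta> = q * r n"
    have b0: "\<beta> > 0" unfolding \<beta>_def using q r0 by simp
    have Cb: "C * \<beta> \<le> 1/2" using Lr'[OF Lam(3)] unfolding \<beta>_def by (simp only: mult.assoc)
    have b1: "\<beta> \<le> 1" using Cb mult_right_mono[OF C(1) less_imp_le[OF b0]] by linarith
    have Bb: "128 * (B + 3) * \<beta>^2 \<le> 1"
    proof -
      have "128 * (B + 3) * \<beta> \<le> 1/2" using Lr'[OF Lam(4)] unfolding \<beta>_def by (simp only: mult.assoc)
      moreover have "128 * (B + 3) * \<beta> * \<beta> \<le> 128 * (B + 3) * \<beta> * 1" using b0 b1 B by (intro mult_left_mono) auto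
      ultimately show ?thesis by (simp only: power2_eq_square mult.assoc mult_1_right)
    qed
    define g where "g = m0 * real n powr (- 1 / (\<kappa> + 1))"
    have g0: "g > 0" unfolding g_def using m0 ns by simp
    have kg: "al / w / g = \<beta>"
    proof -
      have "real n powr (- \<rho>) = real n powr (- 1/4) * real n powr (1 / (\<kappa> + 1))"
        unfolding powr_add[symmetric] rho by simp
      also have "real n powr (1 / (\<kappa> + 1)) = 1 / real n powr (- 1 / (\<kappa> + 1))"
        using powr_minus_divide[of "real n" "- 1 / (\<kappa> + 1)"] by simp
      finally have "r n = 1 / w * (1 / real n powr (- 1 / (\<kappa> + 1)))" unfolding r_def qp(5) .
      then show ?thesis unfolding \<beta>_def q_def g_def by simp
    qed
    have ne: "a n j \<noteq> xs" if "j < n" for j using gp[OF ns(1) that] g0 unfolding g_def by auto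
    define X where "X = (\<lambda>j. al / w / (xs - a n j))"
    define A1 where "A1 = real n * Gcoef mu xs 0 * (al / w)"
    define A2 where "A2 = real n * m 2 * (al / w)^2"
    have k0: "al / w > 0" using al qp(1) by simp
    \<comment> \<open>The factor n in the power sum cancels the 1/n of the moment rate and leaves
      (scale / gap)^i = \<beta>^i, which is at most \<beta>.\<close>
    have S: "\<bar>(\<Sum>j<n. X j ^ i) - real n * (al / w)^i * m i\<bar> \<le> C * \<beta>" if i: "1 \<le> i" "i \<le> 4" for i
    proof -
      have "(\<Sum>j<n. X j ^ i) = real n * (al / w)^i * ((\<Sum>j<n. 1 / (xs - a n j)^i) / real n)"
      proof -
        have "X j ^ i = (al / w)^i * (1 / (xs - a n j)^i)" for j
          unfolding X_def power_divide[of "al / w"] by (simp only: times_divide_eq_right mult_1_right)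
        then have "(\<Sum>j<n. X j ^ i) = (al / w)^i * (\<Sum>j<n. 1 / (xs - a n j)^i)" by (simp only: sum_distrib_left)
        then show ?thesis using ns by simp
      qed
      then have "(\<Sum>j<n. X j ^ i) - real n * (al / w)^i * m i = real n * (al / w)^i * ((\<Sum>j<n. 1 / (xs - a n j)^i) / real n - m i)"
        by (simp only: right_diff_distrib)
      then have "\<bar>(\<Sum>j<n. X j ^ i) - real n * (al / w)^i * m i\<bar> = real n * (al / w)^i * \<bar>(\<Sum>j<n. 1 / (xs - a n j)^i) / real n - m i\<bar>"
        using k0 by (simp only: abs_mult abs_of_nat abs_of_nonneg zero_le_power less_imp_le)
      also have "\<dots> \<le> real n * (al / w)^i * (C0 / (real n * g ^ i))"
        using rate[OF ns(1) i] k0 unfolding m_def g_def by (intro mult_left_mono) auto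
      also have "\<dots> = C0 * (al / w / g)^i"
      proof -
        have "real n * k^i * (C0 / (real n * g ^ i)) = C0 * (k / g)^i" for k using ns by (simp add: power_divide)
        then show ?thesis .
      qed
      also have "\<dots> = C0 * \<beta>^i" unfolding kg ..
      also have "\<dots> \<le> C * \<beta>"
      proof (rule mult_mono)
        show "\<beta>^i \<le> \<beta>" using power_decreasing[of 1 i \<beta>] i b0 b1 by simp
      qed (use C C0 b0 in auto)
      finally show ?thesis .
    qed
    interpret cf: configuration n X A1 A2 \<beta> C
    proof
      show "\<bar>X j\<bar> \<le> \<beta>" if "j < n" for j
      proof -
        have "\<bar>X j\<bar> = al / w / \<bar>a n j - xs\<bar>" unfolding X_def abs_divide[of "al / w"] abs_of_pos[OF k0] by (simp only: abs_minus_commute)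
        also have "\<dots> \<le> al / w / g" using gp[OF ns(1) that] g0 k0 unfolding g_def[symmetric] by (intro divide_left_mono mult_pos_pos) auto
        finally show ?thesis unfolding kg .
      qed
      show "\<bar>(\<Sum>j<n. X j) - A1\<bar> \<le> C * \<beta>" using S[of 1] unfolding A1_def m1 by (simp add: mult_ac)
      show "\<bar>(\<Sum>j<n. X j ^ 2) - A2\<bar> \<le> C * \<beta>" using S[of 2] unfolding A2_def by (simp add: mult_ac)
      show "\<bar>\<Sum>j<n. X j ^ 3\<bar> \<le> C * \<beta>" using S[of 3] m3 by simp
      have "real n * (al / w)^4 * m 4 = 1" unfolding qp(2) power_divide using qp(1) al4 by simp
      then show "\<bar>(\<Sum>j<n. X j ^ 4) - 1\<bar> \<le> C * \<beta>" using S[of 4] by simp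
    qed (use b0 Cb C in auto)
    have tm: "tP mu xs n \<tau> = 1 / m 2 + \<tau> / ((m 2 * al)^2 * w^2)" for \<tau> unfolding tP_def tc c3 qp(3) ..
    define \<phi> where "\<phi> = (\<lambda>\<tau>. 1 / (m 2 * tP mu xs n \<tau>))"
    have phi: "tP mu xs n \<tau> > 0" "\<bar>\<phi> \<tau> - 1\<bar> \<le> 2 * (L * r n)" "0 \<le> \<phi> \<tau>" "\<phi> \<tau> \<le> 2" if tau: "\<bar>\<tau>\<bar> \<le> BT" for \<tau>
    proof -
      have "\<bar>\<tau>\<bar> / (m 2 * al^2 * w^2) \<le> B / (m 2 * al^2 * w^2)" using tau B m2 al by (intro divide_right_mono) auto
      also have "\<dots> = L * (1 / w^2)" unfolding L_def by simp
      also have "\<dots> \<le> L * r n" by (rule mult_left_mono[OF wr L])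
      finally have h: "\<bar>\<tau>\<bar> / (m 2 * al^2 * w^2) \<le> L * r n" .
      note tr = time_ratio_close[OF m2 al qp(1) tm h Lr'[OF Lam(1)]]
      show "tP mu xs n \<tau> > 0" "\<bar>\<phi> \<tau> - 1\<bar> \<le> 2 * (L * r n)" "0 \<le> \<phi> \<tau>" "\<phi> \<tau> \<le> 2"
        unfolding \<phi>_def by (rule tr)+
    qed
    have scal: "\<bar>\<phi> \<tau> * y\<bar> \<le> B" "\<bar>\<phi> \<tau> * y - y\<bar> \<le> C * \<beta>" if tau: "\<bar>\<tau>\<bar> \<le> BT" and y: "2 * \<bar>y\<bar> \<le> B" for \<tau> y
    proof -
      have "\<bar>\<phi> \<tau> * y\<bar> = \<phi> \<tau> * \<bar>y\<bar>" unfolding abs_mult using phi(3)[OF tau] by simp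
      also have "\<dots> \<le> 2 * \<bar>y\<bar>" using phi(4)[OF tau] by (intro mult_right_mono) auto
      finally show "\<bar>\<phi> \<tau> * y\<bar> \<le> B" using y by linarith
      have "\<phi> \<tau> * y - y = (\<phi> \<tau> - 1) * y" by (simp add: algebra_simps)
      then have "\<bar>\<phi> \<tau> * y - y\<bar> = \<bar>\<phi> \<tau> - 1\<bar> * \<bar>y\<bar>" by (simp only: abs_mult)
      also have "\<dots> \<le> 2 * (L * r n) * B" using phi(2)[OF tau] y B L r0 by (intro mult_mono) auto
      also have "\<dots> = 2 * L * B / q * \<beta>" unfolding \<beta>_def using q by simp
      also have "\<dots> \<le> C * \<beta>" using C(3) b0 by (intro mult_right_mono) auto
      finally show "\<bar>\<phi> \<tau> * y - y\<bar> \<le> C * \<beta>" .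
    qed
    have tb: "2 * \<bar>\<tau>1\<bar> \<le> B" "2 * \<bar>\<tau>2\<bar> \<le> B" "2 * \<bar>u\<bar> \<le> B" "2 * \<bar>v\<bar> \<le> B" using tau uv B by linarith+
    have ub: "\<bar>\<tau>1\<bar> \<le> B" "\<bar>\<tau>2\<bar> \<le> B" "\<bar>u\<bar> \<le> B" "\<bar>v\<bar> \<le> B" using tau uv B by linarith+
    define J where "J = double_integral (\<lambda>\<eta>. Zfun n X A1 A2 (\<phi> \<tau>2 * \<tau>2) (\<phi> \<tau>2 * v) (\<i> * of_real \<eta>))
       (\<lambda>\<omega>. 1 / Zfun n X A1 A2 (\<phi> \<tau>1 * \<tau>1) (\<phi> \<tau>1 * u) \<omega>)"
    define J' where "J' = double_integral (\<lambda>\<eta>. Pfun \<tau>2 v (\<i> * of_real \<eta>)) (\<lambda>\<omega>. 1 / Pfun \<tau>1 u \<omega>)"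
    note cmp = cf.double_integral_comparison[OF B(1) Bb
        scal(1)[OF tau(1) tb(1)] scal(1)[OF tau(1) tb(3)] ub(1) ub(3) scal(2)[OF tau(1) tb(1)] scal(2)[OF tau(1) tb(3)]
        scal(1)[OF tau(2) tb(2)] scal(1)[OF tau(2) tb(4)] ub(2) ub(4) scal(2)[OF tau(2) tb(2)] scal(2)[OF tau(2) tb(4)],
        folded J_def J'_def]
    have Kc: "cf.Kc B * cf.Kc B * wt_const = K0" unfolding cf.Kc_def K0_def ..
    define P where "P = (1 / (2 * of_real pi * \<i>)^2 :: complex)"
    define expo where "expo = \<phi> \<tau>2 * v^2 / (2 * m 2 * al^2 * w^2) - \<phi> \<tau>1 * u^2 / (2 * m 2 * al^2 * w^2)"
    define cc where "cc = sqrt (\<phi> \<tau>1 * \<phi> \<tau>2) * exp expo"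
    have chi1: "0 \<le> \<phi> \<tau> * y^2 / (2 * m 2 * al^2 * w^2) \<and> \<phi> \<tau> * y^2 / (2 * m 2 * al^2 * w^2) \<le> K6 * r n"
      if tau: "\<bar>\<tau>\<bar> \<le> BT" and y: "\<bar>y\<bar> \<le> B" for \<tau> y
    proof
      have d: "2 * m 2 * al^2 * w^2 > 0" using m2 al qp(1) by simp
      show "0 \<le> \<phi> \<tau> * y^2 / (2 * m 2 * al^2 * w^2)" by (rule divide_nonneg_nonneg[OF mult_nonneg_nonneg[OF phi(3)[OF tau] zero_le_power2] less_imp_le[OF d]])
      have "y^2 \<le> B^2" using power_mono[OF y, of 2] by simp
      then have "\<phi> \<tau> * y^2 \<le> 2 * B^2" using phi(3,4)[OF tau] by (intro mult_mono) auto
      then have "\<phi> \<tau> * y^2 / (2 * m 2 * al^2 * w^2) \<le> 2 * B^2 / (2 * m 2 * al^2 * w^2)" using d by (intro divide_right_mono) auto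
      also have "\<dots> = B * L * (1 / w^2)" unfolding L_def by (simp add: power2_eq_square)
      also have "\<dots> \<le> B * L * r n" using B L by (intro mult_left_mono wr) auto
      also have "\<dots> \<le> K6 * r n" unfolding K6_def using B L r0 by (intro mult_right_mono) auto
      finally show "\<phi> \<tau> * y^2 / (2 * m 2 * al^2 * w^2) \<le> K6 * r n" .
    qed
    have chi: "\<bar>expo\<bar> \<le> K6 * r n" unfolding expo_def using chi1[OF tau(1) ub(3)] chi1[OF tau(2) ub(4)] by linarith
    have ccb: "\<bar>cc - 1\<bar> \<le> (4 * K6 + 6 * L) * r n"
    proof -
      have "K6 * r n \<le> 1" using Lr'[OF Lam(2)] by linarith
      from prefactor_close[OF phi(2)[OF tau(1)] phi(2)[OF tau(2)] phi(3)[OF tau(1)] phi(3)[OF tau(2)] phi(4)[OF tau(1)] phi(4)[OF tau(2)] chi this]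
      have "\<bar>cc - 1\<bar> \<le> 4 * (K6 * r n) + 3 * (2 * (L * r n))" unfolding cc_def .
      also have "\<dots> = (4 * K6 + 6 * L) * r n" by (simp add: algebra_simps)
      finally show ?thesis .
    qed
    have con: "valid_path (Gam n)" "pathfinish (Gam n) = pathstart (Gam n)"
      "\<And>j. j < n \<Longrightarrow> of_real (a n j) \<notin> path_image (Gam n) \<and> winding_number (Gam n) (of_real (a n j)) = 1"
      "\<And>\<eta>. Complex (xl n) \<eta> \<notin> path_image (Gam n)" using contours[of n] by blast+
    let ?G = "if \<tau>1 > \<tau>2 then complex_of_real (1 / sqrt (2 * pi * (\<tau>1 - \<tau>2)) * exp (- ((u - v)^2) / (2 * (\<tau>1 - \<tau>2)))) else 0"
    have 1: "of_real (1 / (c3 mu xs * real n powr (3/4)))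
             * Ktilde mu xs a Gam xl n (tP mu xs n \<tau>1) (tP mu xs n \<tau>2)
                 (xP mu xs n \<tau>1 + u / (c3 mu xs * real n powr (3/4)))
                 (xP mu xs n \<tau>2 + v / (c3 mu xs * real n powr (3/4))) = of_real cc * (P * J) - ?G"
      using Ktilde_eq[where a = a and n = n and Gam = Gam and xl = xl, OF ns(3) ne con m2 tc al c3 phi(1)[OF tau(1)] phi(1)[OF tau(2)], of u v]
      unfolding cc_def expo_def P_def J_def X_def A1_def A2_def w_def \<phi>_def .
    have 2: "pearceyK \<tau>1 \<tau>2 u v = P * J' - ?G" unfolding P_def by (rule cmp(3))
    \<comment> \<open>The Gaussian terms cancel, and the rest telescopes into a prefactor error and
      a double integral error.\<close>
    have "of_real cc * (P * J) - ?G - (P * J' - ?G) = of_real (cc - 1) * (P * J) + P * (J - J')"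
      by (simp only: of_real_diff of_real_1 left_diff_distrib right_diff_distrib mult_1_left) simp
    then have "cmod (of_real cc * (P * J) - ?G - (P * J' - ?G)) \<le> cmod (of_real (cc - 1) * (P * J)) + cmod (P * (J - J'))"
      by (simp only: norm_triangle_ineq)
    also have "\<dots> = \<bar>cc - 1\<bar> * (cmod P * cmod J) + cmod P * cmod (J - J')" by (simp only: norm_mult norm_of_real)
    also have "\<dots> \<le> (4 * K6 + 6 * L) * r n * (1 * (4 * K0)) + 1 * (8 * K0 * \<beta>)"
    proof (intro add_mono mult_mono ccb)
      show "cmod P \<le> 1" "cmod P \<le> 1" unfolding P_def by (rule norm_inverse_2pi_i)+
      show "cmod J \<le> 4 * K0" using cmp(1) unfolding Kc .
      show "cmod (J - J') \<le> 8 * K0 * \<beta>" using cmp(2) unfolding Kc .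
    qed (use K6 L r0 K0 in auto)
    also have "\<dots> = K * r n"
    proof -
      have "a1 * rr * (1 * (4 * k)) + 1 * (8 * k * (qq * rr)) = (a1 * (4 * k) + 8 * k * qq) * rr" for a1 rr k qq :: real
        by (simp add: algebra_simps)
      then show ?thesis unfolding K_def \<beta>_def .
    qed
    finally show ?thesis unfolding 1 2 .
  qed
  show ?thesis
  proof (rule that)
    show "N \<ge> 1" unfolding N_def by simp
  qed (rule main[unfolded r_def \<rho>_def], assumption+, rule K)
qed

end

theorem mainTheorem3:
  fixes a :: "nat \<Rightarrow> nat \<Rightarrow> real"
    and mu :: "real measure" and psi :: "real \<Rightarrow> real"
    and xs c \<kappa> \<epsilon> :: real
    and Gam :: "nat \<Rightarrow> real \<Rightarrow> complex" and x0 :: "nat \<Rightarrow> real"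
  assumes A1_bdd: "\<exists>B. \<forall>n j. j < n \<longrightarrow> \<bar>a n j\<bar> \<le> B"
    and A1_prob: "prob_space mu"
    and A1_weak: "\<And>f::real \<Rightarrow> real. continuous_on UNIV f \<Longrightarrow> bounded (range f) \<Longrightarrow>
                   (\<lambda>n. (\<Sum>j<n. f (a n j)) / real n) \<longlonglongrightarrow> (LINT s|mu. f s)"
    and A1_dens: "mu = density lborel (\<lambda>x. ennreal (psi x))"
    and A1_meas: "psi \<in> borel_measurable borel"
    and A1_nonneg: "\<And>x. psi x \<ge> 0"
    and A1_cont: "continuous_on (measure_support mu) psi"
    and A1_c: "c > 0"
    and A1_asym: "((\<lambda>x. psi x / (c * \<bar>x - xs\<bar> powr \<kappa>)) \<longlongrightarrow> 1) (at xs)"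
    and A2: "\<exists>M0 n0. \<forall>n\<ge>n0. \<forall>x. \<bar>emp_cdf a n x - measure mu {..x}\<bar> \<le> M0 / real n"
    and A3: "\<exists>m0>0. \<exists>n0. \<forall>n\<ge>n0. \<forall>j<n. \<bar>a n j - xs\<bar> > m0 * real n powr (- 1 / (\<kappa> + 1))"
    and kappa: "\<kappa> > 3"
    and G2: "Gcoef mu xs 2 = 0"
    and eps: "0 < \<epsilon>" "\<epsilon> < min ((\<kappa> - 3) / (8 * (\<kappa> + 1))) (1 / 24)"
    and contours: "\<And>n. valid_path (Gam n) \<and> pathfinish (Gam n) = pathstart (Gam n)
        \<and> (\<forall>j<n. of_real (a n j) \<notin> path_image (Gam n)
                   \<and> winding_number (Gam n) (of_real (a n j)) = 1)
        \<and> (\<forall>eta. Complex (x0 n) eta \<notin> path_image (Gam n))"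
  shows "\<forall>T M. compact T \<and> M > 0 \<longrightarrow> (\<exists>C N. \<forall>n\<ge>N. \<forall>\<tau>1\<in>T. \<forall>\<tau>2\<in>T. \<forall>u\<in>{-M..M}. \<forall>v\<in>{-M..M}.
     cmod (of_real (1 / (c3 mu xs * real n powr (3/4)))
             * Ktilde mu xs a Gam x0 n (tP mu xs n \<tau>1) (tP mu xs n \<tau>2)
                 (xP mu xs n \<tau>1 + u / (c3 mu xs * real n powr (3/4)))
                 (xP mu xs n \<tau>2 + v / (c3 mu xs * real n powr (3/4)))
           - pearceyK \<tau>1 \<tau>2 u v) \<le> C * real n powr (- \<epsilon>))"
proof (intro allI impI; elim conjE)
  fix T :: "real set" and M :: real
  assume T: "compact T" and M: "M > 0"
  interpret regular_critical_point a mu psi xs c \<kappa>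
    by (rule regular_critical_point.intro[OF A1_prob A1_dens A1_meas A1_nonneg A1_c A1_asym A2 A3 kappa])
  obtain BT where BT: "\<And>\<tau>. \<tau> \<in> T \<Longrightarrow> \<bar>\<tau>\<bar> \<le> BT" "BT \<ge> 0"
  proof -
    obtain b where "\<forall>x\<in>T. norm x \<le> b" using compact_imp_bounded[OF T] unfolding bounded_iff by blast
    then show ?thesis using that[of "max b 0"] by fastforce
  qed
  from M have M0: "M \<ge> 0" by simp
  let ?\<rho> = "(\<kappa> - 3) / (4 * (\<kappa> + 1))"
  obtain N K where KN:
    "\<And>n \<tau>1 \<tau>2 u v. n \<ge> N \<Longrightarrow> \<bar>\<tau>1\<bar> \<le> BT \<Longrightarrow> \<bar>\<tau>2\<bar> \<le> BT \<Longrightarrow> \<bar>u\<bar> \<le> M \<Longrightarrow> \<bar>v\<bar> \<le> M \<Longrightarrow>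
     cmod (of_real (1 / (c3 mu xs * real n powr (3/4)))
             * Ktilde mu xs a Gam x0 n (tP mu xs n \<tau>1) (tP mu xs n \<tau>2)
                 (xP mu xs n \<tau>1 + u / (c3 mu xs * real n powr (3/4)))
                 (xP mu xs n \<tau>2 + v / (c3 mu xs * real n powr (3/4)))
           - pearceyK \<tau>1 \<tau>2 u v) \<le> K * real n powr (- ?\<rho>)" "K \<ge> 0" "N \<ge> 1"
  proof (rule kernel_estimate[where Gam = Gam and xl = x0, OF G2 contours BT(2) M0])
    fix K N
    assume h: "\<And>n \<tau>1 \<tau>2 u v. n \<ge> N \<Longrightarrow> \<bar>\<tau>1\<bar> \<le> BT \<Longrightarrow> \<bar>\<tau>2\<bar> \<le> BT \<Longrightarrow> \<bar>u\<bar> \<le> M \<Longrightarrow> \<bar>v\<bar> \<le> M \<Longrightarrow>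
     cmod (of_real (1 / (c3 mu xs * real n powr (3/4)))
             * Ktilde mu xs a Gam x0 n (tP mu xs n \<tau>1) (tP mu xs n \<tau>2)
                 (xP mu xs n \<tau>1 + u / (c3 mu xs * real n powr (3/4)))
                 (xP mu xs n \<tau>2 + v / (c3 mu xs * real n powr (3/4)))
           - pearceyK \<tau>1 \<tau>2 u v) \<le> K * real n powr (- ?\<rho>)" and KN: "K \<ge> 0" "N \<ge> 1"
    show ?thesis by (rule that[of N K]) (rule h, assumption+, rule KN, rule KN)
  qed
  \<comment> \<open>The rate obtained has twice the exponent that bounds \<epsilon>. Weakening it to
    n^(-\<epsilon>) uses n \<ge> 1, whence the requirement N \<ge> 1.\<close>
  have "(\<kappa> - 3) / (8 * (\<kappa> + 1)) \<le> ?\<rho>" using kappa by (intro divide_left_mono) auto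
  then have e: "\<epsilon> \<le> ?\<rho>" using eps by simp
  show "\<exists>C N. \<forall>n\<ge>N. \<forall>\<tau>1\<in>T. \<forall>\<tau>2\<in>T. \<forall>u\<in>{-M..M}. \<forall>v\<in>{-M..M}.
     cmod (of_real (1 / (c3 mu xs * real n powr (3/4)))
             * Ktilde mu xs a Gam x0 n (tP mu xs n \<tau>1) (tP mu xs n \<tau>2)
                 (xP mu xs n \<tau>1 + u / (c3 mu xs * real n powr (3/4)))
                 (xP mu xs n \<tau>2 + v / (c3 mu xs * real n powr (3/4)))
           - pearceyK \<tau>1 \<tau>2 u v) \<le> C * real n powr (- \<epsilon>)"
  proof (rule exI[of _ K], rule exI[of _ N], intro allI impI ballI)
    fix n \<tau>1 \<tau>2 u v assume h: "N \<le> n" "\<tau>1 \<in> T" "\<tau>2 \<in> T" "u \<in> {-M..M}" "v \<in> {-M..M}"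
    have "\<bar>u\<bar> \<le> M" "\<bar>v\<bar> \<le> M" using h by auto
    note KN(1)[OF h(1) BT(1)[OF h(2)] BT(1)[OF h(3)] this]
    also have "K * real n powr (- ?\<rho>) \<le> K * real n powr (- \<epsilon>)"
      using KN(2,3) h(1) e by (intro mult_left_mono powr_mono) auto
    finally show "cmod (of_real (1 / (c3 mu xs * real n powr (3/4)))
             * Ktilde mu xs a Gam x0 n (tP mu xs n \<tau>1) (tP mu xs n \<tau>2)
                 (xP mu xs n \<tau>1 + u / (c3 mu xs * real n powr (3/4)))
                 (xP mu xs n \<tau>2 + v / (c3 mu xs * real n powr (3/4)))
           - pearceyK \<tau>1 \<tau>2 u v) \<le> K * real n powr (- \<epsilon>)" .
  qed
qed

end
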